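(* Let $k$ be a field with $\operatorname{char} k\ne2$, let $q\in k^\times$ be not a root of unity, let $C_0\neq 0$ be in the center of $U_q(\mathfrak{sl}_2)$, and let $A$ be the associated quantized symplectic oscillator algebra of rank $1$. Then the category $\mathcal{O}$ of $A$-modules decomposes as a direct sum of subcategories $$\mathcal{O}=\bigoplus_r\mathcal{O}(r),$$ where $r$ runs over representatives of the distinct sets $T(r)$, $r\in k^\times$.
   Context: $U_q(\mathfrak{sl}_2)$ is the $k$-algebra generated by $E,F,K,K^{-1}$ with $KK^{-1}=K^{-1}K=1$, $KEK^{-1}=q^2E$, $KFK^{-1}=q^{-2}F$, $EF-FE=\frac{K-K^{-1}}{q-q^{-1}}$. For $C_0$ in its center, $A$ is the $k$-algebra generated by $E,F,K,K^{-1},X,Y$ with these relations together with $EX=qXE$, $EY=X+q^{-1}YE$, $FX=YK^{-1}+XF$, $FY=YF$, $KXK^{-1}=qX$, $KYK^{-1}=q^{-1}Y$, $qYX-XY=C_0$. $B_+\subset A$ is the subalgebra generated by $E,X,K,K^{-1}$. The category $\mathcal{O}$ is the full subcategory of finitely generated $A$-modules on which $K$ acts diagonalizably with finite dimensional weight spaces (eigenspaces) and $B_+$ acts locally finitely. For $r\in k^\times$, $Z(r)=A/(AE+AX+A(K-r))$ is the Verma module and $V(r)$ its unique simple quotient. Make $k^\times$ into a graph by joining $r$ and $t$ by an edge if and only if $V(t)$ is a subquotient of $Z(r)$ or $V(r)$ is a subquotient of $Z(t)$; $T(r)$ is the connected component containing $r$. $\mathcal{O}(r)$ is the full subcategory of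 $\mathcal{O}$ of all modules all of whose simple subquotients are of the form $V(t)$ with $t\in T(r)$. *)

theory Defs
  imports
    "HOL-Algebra.Module"
    "HOL-Algebra.QuotRing"
    "HOL-Algebra.Generated_Rings"
    "HOL-Library.Poly_Mapping"
begin

section \<open>Algebras given by generators and relations\<close>

text \<open>
  Words over an alphabet form a monoid, written additively so that the convolution product of
  \<^theory>\<open>HOL-Library.Poly_Mapping\<close> makes finitely supported functions on words into the free
  associative unital algebra.
\<close>

datatype 'g word = Word "'g list"

instantiation word :: (type) monoid_add
begin

definition zero_word :: "'a word" where
  "0 = Word []"

fun plus_word :: "'a word \<Rightarrow> 'a word \<Rightarrow> 'a word" where
  "Word u + Word v = Word (u @ v)"

instance
proof
  fix a b c :: "'a word"
  show "a + b + c = a + (b + c)" by (cases a; cases b; cases c) simp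
  show "0 + a = a" by (cases a) (simp add: zero_word_def)
  show "a + 0 = a" by (cases a) (simp add: zero_word_def)
qed

end

type_synonym ('g, 'k) free_elt = "'g word \<Rightarrow>\<^sub>0 'k"
type_synonym ('g, 'k) pres_elt = "('g, 'k) free_elt set"

definition letter :: "'g \<Rightarrow> ('g, 'k::field) free_elt" where
  "letter g = Poly_Mapping.single (Word [g]) 1"

definition const :: "'k::field \<Rightarrow> ('g, 'k) free_elt" where
  "const c = Poly_Mapping.single 0 c"

definition free_algebra :: "('g, 'k::field) free_elt ring" where
  "free_algebra = \<lparr>carrier = UNIV, monoid.mult = (*), one = 1, zero = 0, add = (+)\<rparr>"

definition free_map :: "('g \<Rightarrow> 'h) \<Rightarrow> ('g, 'k::field) free_elt \<Rightarrow> ('h, 'k) free_elt" where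
  "free_map f p =
    (\<Sum>w\<in>Poly_Mapping.keys p. Poly_Mapping.single (map_word f w) (Poly_Mapping.lookup p w))"

text \<open>
  The elements of \<open>presented_algebra P\<close> are cosets of the two-sided ideal generated by \<open>P\<close>;
  \<open>pres_class P p\<close> is the class of the noncommutative polynomial \<open>p\<close>.
\<close>

definition presented_algebra :: "('g, 'k::field) free_elt set \<Rightarrow> ('g, 'k) pres_elt ring" where
  "presented_algebra P = free_algebra Quot (Idl\<^bsub>free_algebra\<^esub> P)"

definition pres_class ::
  "('g, 'k::field) free_elt set \<Rightarrow> ('g, 'k) free_elt \<Rightarrow> ('g, 'k) pres_elt" where
  "pres_class P p = (Idl\<^bsub>free_algebra\<^esub> P) +>\<^bsub>free_algebra\<^esub> p"


section \<open>The quantum group and the quantized symplectic oscillator algebra\<close>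

datatype uq_gen = Gen_E | Gen_F | Gen_K | Gen_K_inv

definition uq_relations :: "'k::field \<Rightarrow> (uq_gen, 'k) free_elt set" where
  "uq_relations q =
    (let e = letter Gen_E; f = letter Gen_F; k = letter Gen_K; k' = letter Gen_K_inv in
     { k * k' - 1,
       k' * k - 1,
       k * e * k' - const (q ^ 2) * e,
       k * f * k' - const (inverse (q ^ 2)) * f,
       e * f - f * e - const (inverse (q - inverse q)) * (k - k') })"

definition uq_sl2 :: "'k::field \<Rightarrow> (uq_gen, 'k) pres_elt ring" where
  "uq_sl2 q = presented_algebra (uq_relations q)"

definition ring_center :: "('a, 'b) ring_scheme \<Rightarrow> 'a set" where
  "ring_center R = {z \<in> carrier R. \<forall>x\<in>carrier R. z \<otimes>\<^bsub>R\<^esub> x = x \<otimes>\<^bsub>R\<^esub> z}"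

datatype osc_gen = Uq_gen uq_gen | Gen_X | Gen_Y

text \<open>
  The parameter \<open>C0\<close> is an element of \<open>uq_sl2 q\<close>, hence a coset. In the last relation \<open>C0\<close>
  stands for its image in the new algebra; imposing the relation for every representative \<open>c\<close>
  of the coset is the same as imposing it for one, since two representatives differ by a
  consequence of the relations of \<open>uq_sl2 q\<close>.
\<close>

definition osc_relations ::
  "'k::field \<Rightarrow> (uq_gen, 'k) pres_elt \<Rightarrow> (osc_gen, 'k) free_elt set" where
  "osc_relations q C0 =
    (let e = letter (Uq_gen Gen_E); f = letter (Uq_gen Gen_F);
         k = letter (Uq_gen Gen_K); k' = letter (Uq_gen Gen_K_inv);
         x = letter Gen_X; y = letter Gen_Y in
     free_map Uq_gen ` uq_relations q \<union>
     { e * x - const q * x * e,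
       e * y - (x + const (inverse q) * y * e),
       f * x - (y * k' + x * f),
       f * y - y * f,
       k * x * k' - const q * x,
       k * y * k' - const (inverse q) * y } \<union>
     {const q * y * x - x * y - free_map Uq_gen c | c. c \<in> C0})"

type_synonym 'k osc_elt = "(osc_gen, 'k) pres_elt"

definition osc_algebra :: "'k::field \<Rightarrow> (uq_gen, 'k) pres_elt \<Rightarrow> 'k osc_elt ring" where
  "osc_algebra q C0 = presented_algebra (osc_relations q C0)"

definition osc_gen :: "'k::field \<Rightarrow> (uq_gen, 'k) pres_elt \<Rightarrow> osc_gen \<Rightarrow> 'k osc_elt" where
  "osc_gen q C0 g = pres_class (osc_relations q C0) (letter g)"

definition osc_scalar :: "'k::field \<Rightarrow> (uq_gen, 'k) pres_elt \<Rightarrow> 'k \<Rightarrow> 'k osc_elt" where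
  "osc_scalar q C0 c = pres_class (osc_relations q C0) (const c)"

text \<open>
  The ground field, embedded as the scalar multiples of 1, as a subring of the algebra.
\<close>

definition osc_ground :: "'k::field \<Rightarrow> (uq_gen, 'k) pres_elt \<Rightarrow> 'k osc_elt ring" where
  "osc_ground q C0 = (osc_algebra q C0)\<lparr>carrier := range (osc_scalar q C0)\<rparr>"

text \<open>
  A subring containing the scalars is the same as a subalgebra.
\<close>

definition osc_B_plus :: "'k::field \<Rightarrow> (uq_gen, 'k) pres_elt \<Rightarrow> 'k osc_elt ring" where
  "osc_B_plus q C0 = (osc_algebra q C0)
    \<lparr>carrier := generate_ring (osc_algebra q C0)
       (range (osc_scalar q C0) \<union>
        osc_gen q C0 ` {Uq_gen Gen_E, Gen_X, Uq_gen Gen_K, Uq_gen Gen_K_inv})\<rparr>"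


section \<open>Left modules over noncommutative rings\<close>

text \<open>
  The locale \<^locale>\<open>module\<close> assumes a commutative ring. We keep its record type, whose
  multiplicative fields are irrelevant, and its notion \<^locale>\<open>submodule\<close>, which does not
  depend on commutativity. Shrinking the carrier of \<open>R\<close> to a subring yields
  \<open>submodule\<close> for restricted scalars.
\<close>

locale left_module = R?: ring R + M?: abelian_group M
  for R :: "('a, 'b) ring_scheme" (structure) and M :: "('a, 'm) module" (structure) +
  assumes smult_closed:
      "\<lbrakk>a \<in> carrier R; x \<in> carrier M\<rbrakk> \<Longrightarrow> a \<odot>\<^bsub>M\<^esub> x \<in> carrier M"
    and smult_l_distr:
      "\<lbrakk>a \<in> carrier R; b \<in> carrier R; x \<in> carrier M\<rbrakk> \<Longrightarrow>
      (a \<oplus>\<^bsub>R\<^esub> b) \<odot>\<^bsub>M\<^esub> x = a \<odot>\<^bsub>M\<^esub> x \<oplus>\<^bsub>M\<^esub> b \<odot>\<^bsub>M\<^esub> x"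
    and smult_r_distr:
      "\<lbrakk>a \<in> carrier R; x \<in> carrier M; y \<in> carrier M\<rbrakk> \<Longrightarrow>
      a \<odot>\<^bsub>M\<^esub> (x \<oplus>\<^bsub>M\<^esub> y) = a \<odot>\<^bsub>M\<^esub> x \<oplus>\<^bsub>M\<^esub> a \<odot>\<^bsub>M\<^esub> y"
    and smult_assoc:
      "\<lbrakk>a \<in> carrier R; b \<in> carrier R; x \<in> carrier M\<rbrakk> \<Longrightarrow>
      (a \<otimes>\<^bsub>R\<^esub> b) \<odot>\<^bsub>M\<^esub> x = a \<odot>\<^bsub>M\<^esub> (b \<odot>\<^bsub>M\<^esub> x)"
    and smult_one:
      "x \<in> carrier M \<Longrightarrow> \<one>\<^bsub>R\<^esub> \<odot>\<^bsub>M\<^esub> x = x"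

definition regular_module :: "('a, 'b) ring_scheme \<Rightarrow> ('a, 'a) module" where
  "regular_module R =
    \<lparr>carrier = carrier R, monoid.mult = monoid.mult R, one = one R, zero = zero R,
     add = add R, smult = monoid.mult R\<rparr>"

definition quotient_module :: "('a, 'm) module \<Rightarrow> 'm set \<Rightarrow> ('a, 'm set) module" where
  "quotient_module M N =
    \<lparr>carrier = a_rcosets\<^bsub>M\<^esub> N, monoid.mult = undefined, one = undefined, zero = N, add = set_add M,
     smult = (\<lambda>a S. \<Union>x\<in>S. N +>\<^bsub>M\<^esub> (a \<odot>\<^bsub>M\<^esub> x))\<rparr>"

definition submodule_span :: "('a, 'b) ring_scheme \<Rightarrow> ('a, 'm) module \<Rightarrow> 'm set \<Rightarrow> 'm set" where
  "submodule_span R M S = \<Inter>{H. submodule H R M \<and> S \<subseteq> H}"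

definition fin_generated :: "('a, 'b) ring_scheme \<Rightarrow> ('a, 'm) module \<Rightarrow> 'm set \<Rightarrow> bool" where
  "fin_generated R M N \<longleftrightarrow> (\<exists>S. finite S \<and> S \<subseteq> N \<and> submodule_span R M S = N)"

definition module_homs ::
  "('a, 'b) ring_scheme \<Rightarrow> ('a, 'm) module \<Rightarrow> ('a, 'n) module \<Rightarrow> ('m \<Rightarrow> 'n) set" where
  "module_homs R M N = {h \<in> carrier M \<rightarrow> carrier N.
     (\<forall>x\<in>carrier M. \<forall>y\<in>carrier M. h (x \<oplus>\<^bsub>M\<^esub> y) = h x \<oplus>\<^bsub>N\<^esub> h y) \<and>
     (\<forall>a\<in>carrier R. \<forall>x\<in>carrier M. h (a \<odot>\<^bsub>M\<^esub> x) = a \<odot>\<^bsub>N\<^esub> h x)}"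

definition module_iso ::
  "('a, 'b) ring_scheme \<Rightarrow> ('a, 'm) module \<Rightarrow> ('a, 'n) module \<Rightarrow> bool" where
  "module_iso R M N \<longleftrightarrow> (\<exists>h\<in>module_homs R M N. bij_betw h (carrier M) (carrier N))"

definition simple_module :: "('a, 'b) ring_scheme \<Rightarrow> ('a, 'm) module \<Rightarrow> bool" where
  "simple_module R M \<longleftrightarrow> left_module R M \<and> carrier M \<noteq> {\<zero>\<^bsub>M\<^esub>} \<and>
     (\<forall>N. submodule N R M \<longrightarrow> N = {\<zero>\<^bsub>M\<^esub>} \<or> N = carrier M)"

text \<open>
  The subquotients of \<open>M\<close> are the modules \<open>N / L\<close> for submodules \<open>L \<subseteq> N\<close> of \<open>M\<close>.
\<close>

definition subquotients :: "('a, 'b) ring_scheme \<Rightarrow> ('a, 'm) module \<Rightarrow> ('a, 'm set) module set" where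
  "subquotients R M = {quotient_module (M\<lparr>carrier := N\<rparr>) L | N L.
     submodule N R M \<and> submodule L R M \<and> L \<subseteq> N}"

definition internal_direct_sum ::
  "('a, 'b) ring_scheme \<Rightarrow> ('a, 'm) module \<Rightarrow> 'i set \<Rightarrow> ('i \<Rightarrow> 'm set) \<Rightarrow> bool" where
  "internal_direct_sum R M I N \<longleftrightarrow> (\<forall>i\<in>I. submodule (N i) R M) \<and>
     (\<forall>m\<in>carrier M. \<exists>!f. f \<in> (\<Pi>\<^sub>E i\<in>I. N i) \<and> finite {i\<in>I. f i \<noteq> \<zero>\<^bsub>M\<^esub>} \<and>
        m = finsum M f {i\<in>I. f i \<noteq> \<zero>\<^bsub>M\<^esub>})"

text \<open>
  Full subcategories of the category of left \<open>R\<close>-modules are given by their classes of objects.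
  \<open>C\<close> is the direct sum of its full subcategories \<open>D i\<close> if its objects are exactly the
  finite direct sums of objects of the \<open>D i\<close>, and there are no nonzero morphisms between
  different \<open>D i\<close>; in other words, if the direct sum functor from the direct sum of the
  categories \<open>D i\<close> (families of objects with almost all members zero) to \<open>C\<close> is an
  equivalence. The type \<open>'m\<close> of module elements plays the role of a universe.
\<close>

definition direct_sum_of_subcategories ::
  "('a, 'b) ring_scheme \<Rightarrow> ('a, 'm) module set \<Rightarrow> ('i \<Rightarrow> ('a, 'm) module set) \<Rightarrow> 'i set \<Rightarrow> bool" where
  "direct_sum_of_subcategories R C D I \<longleftrightarrow>
     (\<forall>i\<in>I. D i \<subseteq> C) \<and>
     (\<forall>M. M \<in> C \<longleftrightarrow> left_module R M \<and>
        (\<exists>N. internal_direct_sum R M I N \<and> (\<forall>i\<in>I. M\<lparr>carrier := N i\<rparr> \<in> D i) \<and>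
             finite {i\<in>I. N i \<noteq> {\<zero>\<^bsub>M\<^esub>}})) \<and>
     (\<forall>i\<in>I. \<forall>j\<in>I. i \<noteq> j \<longrightarrow>
        (\<forall>M\<in>D i. \<forall>N\<in>D j. \<forall>h\<in>module_homs R M N. \<forall>x\<in>carrier M. h x = \<zero>\<^bsub>N\<^esub>))"


section \<open>Category O, Verma modules and blocks\<close>

definition weight_space ::
  "'k::field \<Rightarrow> (uq_gen, 'k) pres_elt \<Rightarrow> ('k osc_elt, 'm) module \<Rightarrow> 'k \<Rightarrow> 'm set" where
  "weight_space q C0 M r =
    {m \<in> carrier M. osc_gen q C0 (Uq_gen Gen_K) \<odot>\<^bsub>M\<^esub> m = osc_scalar q C0 r \<odot>\<^bsub>M\<^esub> m}"

text \<open>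
  The conditions are, in this order: \<open>M\<close> is a finitely generated module, \<open>M\<close> is spanned over
  the ground field by weight vectors, the weight spaces are finite dimensional, and each
  \<open>B_+ m\<close> is finite dimensional.
\<close>

definition category_O ::
  "'k::field \<Rightarrow> (uq_gen, 'k) pres_elt \<Rightarrow> ('k osc_elt, 'm) module set" where
  "category_O q C0 = {M.
     left_module (osc_algebra q C0) M \<and>
     fin_generated (osc_algebra q C0) M (carrier M) \<and>
     submodule_span (osc_ground q C0) M (\<Union>r. weight_space q C0 M r) = carrier M \<and>
     (\<forall>r. fin_generated (osc_ground q C0) M (weight_space q C0 M r)) \<and>
     (\<forall>m\<in>carrier M. fin_generated (osc_ground q C0) M (submodule_span (osc_B_plus q C0) M {m}))}"

definition verma_ideal :: "'k::field \<Rightarrow> (uq_gen, 'k) pres_elt \<Rightarrow> 'k \<Rightarrow> 'k osc_elt set" where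
  "verma_ideal q C0 r =
    (let A = osc_algebra q C0; E = osc_gen q C0 (Uq_gen Gen_E); X = osc_gen q C0 Gen_X;
         K = osc_gen q C0 (Uq_gen Gen_K) in
     {a \<otimes>\<^bsub>A\<^esub> E \<oplus>\<^bsub>A\<^esub> b \<otimes>\<^bsub>A\<^esub> X \<oplus>\<^bsub>A\<^esub> c \<otimes>\<^bsub>A\<^esub> (K \<ominus>\<^bsub>A\<^esub> osc_scalar q C0 r) | a b c.
        a \<in> carrier A \<and> b \<in> carrier A \<and> c \<in> carrier A})"

definition verma ::
  "'k::field \<Rightarrow> (uq_gen, 'k) pres_elt \<Rightarrow> 'k \<Rightarrow> ('k osc_elt, 'k osc_elt set) module" where
  "verma q C0 r = quotient_module (regular_module (osc_algebra q C0)) (verma_ideal q C0 r)"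

text \<open>
  The unique simple quotient: the description picks the unique submodule with simple quotient.
\<close>

definition simple_V ::
  "'k::field \<Rightarrow> (uq_gen, 'k) pres_elt \<Rightarrow> 'k \<Rightarrow> ('k osc_elt, 'k osc_elt set set) module" where
  "simple_V q C0 r = quotient_module (verma q C0 r)
    (THE N. submodule N (osc_algebra q C0) (verma q C0 r) \<and>
            simple_module (osc_algebra q C0) (quotient_module (verma q C0 r) N))"

definition linked :: "'k::field \<Rightarrow> (uq_gen, 'k) pres_elt \<Rightarrow> 'k \<Rightarrow> 'k \<Rightarrow> bool" where
  "linked q C0 r t \<longleftrightarrow>
    (\<exists>S\<in>subquotients (osc_algebra q C0) (verma q C0 r). module_iso (osc_algebra q C0) S (simple_V q C0 t)) \<or>
    (\<exists>S\<in>subquotients (osc_algebra q C0) (verma q C0 t). module_iso (osc_algebra q C0) S (simple_V q C0 r))"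

definition component_T :: "'k::field \<Rightarrow> (uq_gen, 'k) pres_elt \<Rightarrow> 'k \<Rightarrow> 'k set" where
  "component_T q C0 r = {t. (r, t) \<in> {(s, s'). s \<noteq> 0 \<and> s' \<noteq> 0 \<and> linked q C0 s s'}\<^sup>*}"

definition block_O ::
  "'k::field \<Rightarrow> (uq_gen, 'k) pres_elt \<Rightarrow> 'k \<Rightarrow> ('k osc_elt, 'm) module set" where
  "block_O q C0 r = {M \<in> category_O q C0.
     \<forall>S\<in>subquotients (osc_algebra q C0) M. simple_module (osc_algebra q C0) S \<longrightarrow>
       (\<exists>t\<in>component_T q C0 r. module_iso (osc_algebra q C0) S (simple_V q C0 t))}"

end

theory Submission imports Defs begin

text \<open>
  Call a weight vector \<open>w\<close> of a module \<open>M\<close> singular modulo a submodule \<open>L\<close> if it is not in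
  \<open>L\<close> but \<open>E w\<close> and \<open>X w\<close> are. The weight \<open>t\<close> of such a vector is said to occur in \<open>M\<close>. This is
  the same as \<open>V(t)\<close> being a subquotient of \<open>M\<close>: dividing by a submodule maximal among those that
  contain \<open>L\<close> but not \<open>w\<close> gives a simple module with a highest weight vector
  (\<open>simple_subquotient\<close>), and such a module is \<open>V(t)\<close> because two proper submodules of \<open>Z(t)\<close>
  have a proper sum (\<open>verma_sum_proper\<close>). In category O every nonzero quotient of submodules
  has a singular vector, since \<open>B_+ m\<close> has a highest weight (\<open>highest_weight_vector_exists\<close>).
  So simple subquotients can be traded for singular vectors.

  For a union \<open>\<Theta>\<close> of linkage classes let \<open>component \<Theta>\<close> be the largest submodule in which only
  weights in \<open>\<Theta>\<close> occur. Components of disjoint sets meet trivially, a homomorphism between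
  modules of different blocks vanishes because a singular vector modulo its kernel would show a
  common weight, and direct summands and finite direct sums stay in category O. What has to be
  proved is that the components of the linkage classes span \<open>M\<close> (\<open>component_sum_eq_carrier\<close>).
  Let \<open>H\<close> be their sum. If \<open>H\<close> is not \<open>M\<close>, then there is a vector \<open>w\<close>, of weight \<open>r\<close> say, that is
  singular modulo \<open>H\<close>. If \<open>w\<close> can be changed by an element of \<open>H\<close> so as to become annihilated by
  \<open>E\<close> and \<open>X\<close> modulo \<open>component (T r)\<close>, then the result generates a submodule in which only weights
  from \<open>T r\<close> occur (\<open>highest_weight_mem_component\<close>), so it lies in \<open>H\<close>, a contradiction.

  That this change is possible is an extension statement (\<open>lift_singular\<close>): an extension of a
  highest weight module of weight \<open>r\<close> by a module in which only weights \<open>s\<close> outside \<open>T r\<close> occur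
  has a highest weight vector of weight \<open>r\<close>. The obstruction would be a weight \<open>s = q\<^sup>j r\<close> above
  \<open>r\<close>, and the reason why it forces \<open>r\<close> and \<open>s\<close> to be linked is duality (\<open>pairing_link\<close>). The
  algebra has an anti-involution \<open>iota\<close> that fixes \<open>K\<close> and exchanges the raising and the lowering
  generators, so that the dual of a module is a module with the same weights. A functional on the
  weight space of a top weight \<open>s\<close> is then a highest weight vector of the dual, and if it pairs
  nontrivially with the submodule generated by \<open>w\<close>, then applying a suitable element of the
  algebra to it gives a singular vector of weight \<open>r\<close> in a quotient of \<open>Z(s)\<close>.

  Two facts about the algebra carry this. First, \<open>iota\<close> respects the relation \<open>q Y X - X Y = C0\<close>
  (\<open>iota_ideal\<close>): as \<open>C0\<close> commutes with \<open>K\<close>, it is a polynomial in \<open>F E\<close>, \<open>K\<close> and the inverse of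
  \<open>K\<close> (\<open>weight_zero_if_commutes_K\<close>), and \<open>iota\<close> fixes those. Secondly, the module generated by a
  singular vector is spanned by its images under words in \<open>F\<close> and \<open>Y\<close> (\<open>descends_stable\<close>), so its
  weights are \<open>r, r / q, r / q\<^sup>2, ...\<close> and the first of these has multiplicity one.
\<close>

section \<open>Differences in abelian groups\<close>

context abelian_group
begin

lemma minus_zero_right: "x \<in> carrier G \<Longrightarrow> x \<ominus> \<zero> = x"
  using minus_equality[of \<zero> \<zero>] by (simp add: minus_eq)

lemma add_minus_cancel_left:
  "a \<in> carrier G \<Longrightarrow> b \<in> carrier G \<Longrightarrow> (a \<oplus> b) \<ominus> a = b"
  by (simp add: minus_eq a_comm[of a b] a_assoc r_neg)

lemma minus_add_cancel:
  "a \<in> carrier G \<Longrightarrow> b \<in> carrier G \<Longrightarrow> a \<ominus> (a \<oplus> b) = \<ominus> b"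
  by (simp add: minus_eq minus_add r_neg2)

lemma minus_minus_cancel:
  "a \<in> carrier G \<Longrightarrow> b \<in> carrier G \<Longrightarrow> a \<ominus> (a \<ominus> b) = b"
  by (simp add: minus_eq minus_add r_neg2)

end

section \<open>Left modules over a ring\<close>

context left_module
begin

lemma smult_zero_left: "x \<in> carrier M \<Longrightarrow> \<zero>\<^bsub>R\<^esub> \<odot>\<^bsub>M\<^esub> x = \<zero>\<^bsub>M\<^esub>"
  using smult_l_distr[of "\<zero>\<^bsub>R\<^esub>" "\<zero>\<^bsub>R\<^esub>" x] smult_closed[of "\<zero>\<^bsub>R\<^esub>" x]
  by (simp add: M.add.l_cancel_one')

lemma smult_zero_right: "a \<in> carrier R \<Longrightarrow> a \<odot>\<^bsub>M\<^esub> \<zero>\<^bsub>M\<^esub> = \<zero>\<^bsub>M\<^esub>"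
  using smult_r_distr[of a "\<zero>\<^bsub>M\<^esub>" "\<zero>\<^bsub>M\<^esub>"] smult_closed[of a "\<zero>\<^bsub>M\<^esub>"]
  by (simp add: M.add.l_cancel_one')

lemma smult_neg_one:
  assumes x: "x \<in> carrier M"
  shows "(\<ominus>\<^bsub>R\<^esub> \<one>\<^bsub>R\<^esub>) \<odot>\<^bsub>M\<^esub> x = \<ominus>\<^bsub>M\<^esub> x"
proof -
  have "\<one>\<^bsub>R\<^esub> \<odot>\<^bsub>M\<^esub> x \<oplus>\<^bsub>M\<^esub> (\<ominus>\<^bsub>R\<^esub> \<one>\<^bsub>R\<^esub>) \<odot>\<^bsub>M\<^esub> x = \<zero>\<^bsub>M\<^esub>"
    using smult_l_distr[of "\<one>\<^bsub>R\<^esub>" "\<ominus>\<^bsub>R\<^esub> \<one>\<^bsub>R\<^esub>" x] x by (simp add: R.r_neg smult_zero_left)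
  then have "(\<ominus>\<^bsub>R\<^esub> \<one>\<^bsub>R\<^esub>) \<odot>\<^bsub>M\<^esub> x \<oplus>\<^bsub>M\<^esub> x = \<zero>\<^bsub>M\<^esub>"
    using x smult_closed[of "\<ominus>\<^bsub>R\<^esub> \<one>\<^bsub>R\<^esub>" x] by (simp add: smult_one M.a_comm)
  then show ?thesis
    using x smult_closed[of "\<ominus>\<^bsub>R\<^esub> \<one>\<^bsub>R\<^esub>" x] M.minus_equality by force
qed

lemma minus_eq_zero_iff: "x \<in> carrier M \<Longrightarrow> y \<in> carrier M \<Longrightarrow> x \<ominus>\<^bsub>M\<^esub> y = \<zero>\<^bsub>M\<^esub> \<longleftrightarrow> x = y"
  by (metis M.a_inv_closed M.minus_eq M.minus_equality M.minus_minus M.r_neg)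

lemma submodule_iff:
  "submodule H R M \<longleftrightarrow> H \<subseteq> carrier M \<and> \<zero>\<^bsub>M\<^esub> \<in> H \<and> (\<forall>x\<in>H. \<forall>y\<in>H. x \<oplus>\<^bsub>M\<^esub> y \<in> H) \<and>
     (\<forall>a\<in>carrier R. \<forall>x\<in>H. a \<odot>\<^bsub>M\<^esub> x \<in> H)" (is "?L \<longleftrightarrow> ?R")
proof
  assume ?L
  then interpret submodule H R M .
  show ?R
    using subset m_closed one_closed smult_closed by auto
next
  assume r: ?R
  have "\<ominus>\<^bsub>M\<^esub> x \<in> H" if "x \<in> H" for x
  proof -
    have "(\<ominus>\<^bsub>R\<^esub> \<one>\<^bsub>R\<^esub>) \<odot>\<^bsub>M\<^esub> x \<in> H" using r that R.a_inv_closed[OF R.one_closed] by blast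
    then show ?thesis using r that smult_neg_one[of x] by (metis subsetD)
  qed
  then show ?L
    using r by (intro submodule.intro subgroup.intro submodule_axioms.intro)
      (auto simp: a_inv_def)
qed

lemma submodule_subset: "submodule H R M \<Longrightarrow> x \<in> H \<Longrightarrow> x \<in> carrier M"
  by (auto simp: submodule_iff)

lemma submodule_zero: "submodule H R M \<Longrightarrow> \<zero>\<^bsub>M\<^esub> \<in> H"
  by (auto simp: submodule_iff)

lemma submodule_add: "submodule H R M \<Longrightarrow> x \<in> H \<Longrightarrow> y \<in> H \<Longrightarrow> x \<oplus>\<^bsub>M\<^esub> y \<in> H"
  by (auto simp: submodule_iff)

lemma submodule_smult: "submodule H R M \<Longrightarrow> a \<in> carrier R \<Longrightarrow> x \<in> H \<Longrightarrow> a \<odot>\<^bsub>M\<^esub> x \<in> H"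
  by (auto simp: submodule_iff)

lemma submodule_neg: "submodule H R M \<Longrightarrow> x \<in> H \<Longrightarrow> \<ominus>\<^bsub>M\<^esub> x \<in> H"
  by (metis R.a_inv_closed R.one_closed smult_neg_one submodule_smult submodule_subset)

lemma submodule_minus: "submodule H R M \<Longrightarrow> x \<in> H \<Longrightarrow> y \<in> H \<Longrightarrow> x \<ominus>\<^bsub>M\<^esub> y \<in> H"
  by (simp add: M.minus_eq submodule_add submodule_neg)

lemma submodule_carrier: "submodule (carrier M) R M"
  by (simp add: submodule_iff smult_closed)

lemma submodule_trivial: "submodule {\<zero>\<^bsub>M\<^esub>} R M"
  by (simp add: submodule_iff smult_zero_right)

lemma submodule_Inter:
  "(\<And>H. H \<in> \<H> \<Longrightarrow> submodule H R M) \<Longrightarrow> \<H> \<noteq> {} \<Longrightarrow> submodule (\<Inter>\<H>) R M"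
  by (fastforce simp: submodule_iff)

lemma submodule_Int: "submodule H R M \<Longrightarrow> submodule N R M \<Longrightarrow> submodule (H \<inter> N) R M"
  by (fastforce simp: submodule_iff)

lemma submodule_set_add:
  assumes "submodule H R M" "submodule N R M"
  shows "submodule (H <+>\<^bsub>M\<^esub> N) R M"
  unfolding submodule_iff set_add_def'
proof (intro conjI ballI subsetI)
  show "\<zero>\<^bsub>M\<^esub> \<in> (\<Union>h\<in>H. \<Union>k\<in>N. {h \<oplus>\<^bsub>M\<^esub> k})"
    using submodule_zero[OF assms(1)] submodule_zero[OF assms(2)] by fastforce
next
  fix x y assume "x \<in> (\<Union>h\<in>H. \<Union>k\<in>N. {h \<oplus>\<^bsub>M\<^esub> k})" "y \<in> (\<Union>h\<in>H. \<Union>k\<in>N. {h \<oplus>\<^bsub>M\<^esub> k})"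
  then obtain a b c d where abcd: "a \<in> H" "b \<in> N" "c \<in> H" "d \<in> N" "x = a \<oplus>\<^bsub>M\<^esub> b" "y = c \<oplus>\<^bsub>M\<^esub> d"
    by auto
  then have "x \<oplus>\<^bsub>M\<^esub> y = (a \<oplus>\<^bsub>M\<^esub> c) \<oplus>\<^bsub>M\<^esub> (b \<oplus>\<^bsub>M\<^esub> d)"
    using submodule_subset[OF assms(1)] submodule_subset[OF assms(2)] by (simp add: M.a_ac)
  then show "x \<oplus>\<^bsub>M\<^esub> y \<in> (\<Union>h\<in>H. \<Union>k\<in>N. {h \<oplus>\<^bsub>M\<^esub> k})"
    using submodule_add[OF assms(1), of a c] submodule_add[OF assms(2), of b d] abcd by auto
next
  fix a x assume "a \<in> carrier R" "x \<in> (\<Union>h\<in>H. \<Union>k\<in>N. {h \<oplus>\<^bsub>M\<^esub> k})"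
  then show "a \<odot>\<^bsub>M\<^esub> x \<in> (\<Union>h\<in>H. \<Union>k\<in>N. {h \<oplus>\<^bsub>M\<^esub> k})"
    using submodule_subset[OF assms(1)] submodule_subset[OF assms(2)]
      submodule_smult[OF assms(1)] submodule_smult[OF assms(2)] by (clarsimp simp: smult_r_distr) blast
qed (use submodule_subset[OF assms(1)] submodule_subset[OF assms(2)] in auto)

lemma set_add_iff: "x \<in> H <+>\<^bsub>M\<^esub> N \<longleftrightarrow> (\<exists>h\<in>H. \<exists>n\<in>N. x = h \<oplus>\<^bsub>M\<^esub> n)"
  by (auto simp: set_add_def')

lemma subset_set_add:
  assumes "submodule H R M" "submodule N R M"
  shows "H \<subseteq> H <+>\<^bsub>M\<^esub> N" "N \<subseteq> H <+>\<^bsub>M\<^esub> N"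
  using submodule_zero[OF assms(1)] submodule_zero[OF assms(2)] submodule_subset[OF assms(1)]
    submodule_subset[OF assms(2)] by (force simp: set_add_iff)+

lemma set_add_subset:
  "submodule L R M \<Longrightarrow> H \<subseteq> L \<Longrightarrow> N \<subseteq> L \<Longrightarrow> H <+>\<^bsub>M\<^esub> N \<subseteq> L"
  by (force simp: set_add_iff intro: submodule_add)

lemma submodule_cyclic:
  assumes "w \<in> carrier M"
  shows "submodule ((\<lambda>a. a \<odot>\<^bsub>M\<^esub> w) ` carrier R) R M"
  unfolding submodule_iff
proof (intro conjI ballI)
  show "\<zero>\<^bsub>M\<^esub> \<in> (\<lambda>a. a \<odot>\<^bsub>M\<^esub> w) ` carrier R"
    using smult_zero_left[OF assms] by (metis R.zero_closed imageI)
next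
  fix x y assume "x \<in> (\<lambda>a. a \<odot>\<^bsub>M\<^esub> w) ` carrier R" "y \<in> (\<lambda>a. a \<odot>\<^bsub>M\<^esub> w) ` carrier R"
  then obtain a b where "a \<in> carrier R" "b \<in> carrier R" "x = a \<odot>\<^bsub>M\<^esub> w" "y = b \<odot>\<^bsub>M\<^esub> w" by auto
  then show "x \<oplus>\<^bsub>M\<^esub> y \<in> (\<lambda>a. a \<odot>\<^bsub>M\<^esub> w) ` carrier R"
    using assms by (metis R.a_closed imageI smult_l_distr)
next
  fix a x assume "a \<in> carrier R" "x \<in> (\<lambda>a. a \<odot>\<^bsub>M\<^esub> w) ` carrier R"
  then show "a \<odot>\<^bsub>M\<^esub> x \<in> (\<lambda>a. a \<odot>\<^bsub>M\<^esub> w) ` carrier R"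
    using assms by (force simp flip: smult_assoc)
qed (use assms smult_closed in auto)

lemma left_module_submodule:
  assumes "submodule H R M"
  shows "left_module R (M\<lparr>carrier := H\<rparr>)"
proof -
  note sub = submodule_subset[OF assms]
  have "abelian_group (M\<lparr>carrier := H\<rparr>)"
  proof (rule abelian_groupI)
    fix x assume "x \<in> carrier (M\<lparr>carrier := H\<rparr>)"
    then show "\<exists>y\<in>carrier (M\<lparr>carrier := H\<rparr>). y \<oplus>\<^bsub>M\<lparr>carrier := H\<rparr>\<^esub> x = \<zero>\<^bsub>M\<lparr>carrier := H\<rparr>\<^esub>"
      using submodule_neg[OF assms, of x] sub[of x] by (auto simp: M.l_neg intro!: bexI[of _ "\<ominus>\<^bsub>M\<^esub> x"])
  qed (use assms sub in \<open>auto simp: submodule_add submodule_zero M.a_ac\<close>)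
  then show ?thesis
    using sub submodule_smult[OF assms] R.ring_axioms
    by (auto intro!: left_module.intro left_module_axioms.intro
        simp: smult_l_distr smult_r_distr smult_assoc smult_one)
qed

lemma submodule_restrict_iff:
  assumes "submodule H R M"
  shows "submodule N R (M\<lparr>carrier := H\<rparr>) \<longleftrightarrow> submodule N R M \<and> N \<subseteq> H"
  using left_module.submodule_iff[OF left_module_submodule[OF assms]] submodule_subset[OF assms]
  by (auto simp: submodule_iff)

lemma left_module_subring:
  assumes "subring S R"
  shows "left_module (R\<lparr>carrier := S\<rparr>) M"
proof -
  have S: "S \<subseteq> carrier R" using assms by (rule subringE)
  have "ring (R\<lparr>carrier := S\<rparr>)"
    using R.subring_iff[OF S] assms by blast
  then show ?thesis
    using S M.abelian_group_axioms
    by (auto intro!: left_module.intro left_module_axioms.intro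
        simp: smult_l_distr smult_r_distr smult_assoc smult_one smult_closed subset_iff)
qed

section \<open>Spans\<close>

lemma submodule_span_submodule:
  assumes "S \<subseteq> carrier M" shows "submodule (submodule_span R M S) R M"
  unfolding submodule_span_def using assms submodule_carrier by (intro submodule_Inter) auto

lemma subset_submodule_span: "S \<subseteq> submodule_span R M S"
  by (auto simp: submodule_span_def)

lemma submodule_span_minimal: "submodule H R M \<Longrightarrow> S \<subseteq> H \<Longrightarrow> submodule_span R M S \<subseteq> H"
  by (auto simp: submodule_span_def)

lemma submodule_span_mono: "S \<subseteq> T \<Longrightarrow> submodule_span R M S \<subseteq> submodule_span R M T"
  by (auto simp: submodule_span_def)

lemma submodule_span_restrict:
  assumes H: "submodule H R M" and S: "S \<subseteq> H"
  shows "submodule_span R (M\<lparr>carrier := H\<rparr>) S = submodule_span R M S"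
proof
  have "submodule_span R M S \<subseteq> H" by (rule submodule_span_minimal[OF H S])
  moreover have "submodule (submodule_span R M S) R M"
    using H S submodule_subset by (intro submodule_span_submodule) auto
  ultimately show "submodule_span R (M\<lparr>carrier := H\<rparr>) S \<subseteq> submodule_span R M S"
    using subset_submodule_span
    by (intro left_module.submodule_span_minimal[OF left_module_submodule[OF H]])
      (simp_all add: submodule_restrict_iff[OF H])
next
  have "submodule (submodule_span R (M\<lparr>carrier := H\<rparr>) S) R (M\<lparr>carrier := H\<rparr>)"
    by (intro left_module.submodule_span_submodule left_module_submodule H) (simp add: S)
  then show "submodule_span R M S \<subseteq> submodule_span R (M\<lparr>carrier := H\<rparr>) S"
    by (intro submodule_span_minimal)
      (simp_all add: submodule_restrict_iff[OF H]
        left_module.subset_submodule_span[OF left_module_submodule[OF H]])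
qed

lemma submodule_span_insert:
  assumes s: "s \<in> carrier M" and S: "S \<subseteq> carrier M"
  shows "submodule_span R M (insert s S) = (\<lambda>a. a \<odot>\<^bsub>M\<^esub> s) ` carrier R <+>\<^bsub>M\<^esub> submodule_span R M S"
proof
  note cyc = submodule_cyclic[OF s] and sp = submodule_span_submodule[OF S]
  have "s \<in> (\<lambda>a. a \<odot>\<^bsub>M\<^esub> s) ` carrier R" using smult_one[OF s] by (metis R.one_closed imageI)
  then show "submodule_span R M (insert s S) \<subseteq> (\<lambda>a. a \<odot>\<^bsub>M\<^esub> s) ` carrier R <+>\<^bsub>M\<^esub> submodule_span R M S"
    using subset_set_add[OF cyc sp] subset_submodule_span
    by (intro submodule_span_minimal submodule_set_add cyc sp) auto
  have sp': "submodule (submodule_span R M (insert s S)) R M"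
    using s S by (intro submodule_span_submodule) auto
  show "(\<lambda>a. a \<odot>\<^bsub>M\<^esub> s) ` carrier R <+>\<^bsub>M\<^esub> submodule_span R M S \<subseteq> submodule_span R M (insert s S)"
    using subset_submodule_span[of "insert s S"] submodule_smult[OF sp']
    by (intro set_add_subset[OF sp'] submodule_span_mono) auto
qed

end

section \<open>Homomorphisms and quotients\<close>

lemma module_homsD:
  assumes "h \<in> module_homs R M N"
  shows "x \<in> carrier M \<Longrightarrow> h x \<in> carrier N"
    and "x \<in> carrier M \<Longrightarrow> y \<in> carrier M \<Longrightarrow> h (x \<oplus>\<^bsub>M\<^esub> y) = h x \<oplus>\<^bsub>N\<^esub> h y"
    and "a \<in> carrier R \<Longrightarrow> x \<in> carrier M \<Longrightarrow> h (a \<odot>\<^bsub>M\<^esub> x) = a \<odot>\<^bsub>N\<^esub> h x"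
  using assms by (auto simp: module_homs_def)

locale left_module_hom = dom: left_module R M + cod: left_module R N
  for R :: "('a, 'b) ring_scheme" and M :: "('a, 'm) module" and N :: "('a, 'n) module" +
  fixes h assumes hom: "h \<in> module_homs R M N"
begin

lemmas hom_closed = module_homsD(1)[OF hom]
lemmas hom_add = module_homsD(2)[OF hom]
lemmas hom_smult = module_homsD(3)[OF hom]

lemma hom_zero: "h \<zero>\<^bsub>M\<^esub> = \<zero>\<^bsub>N\<^esub>"
  using hom_smult[of "\<zero>\<^bsub>R\<^esub>" "\<zero>\<^bsub>M\<^esub>"] hom_closed[of "\<zero>\<^bsub>M\<^esub>"]
  by (simp add: dom.smult_zero_left cod.smult_zero_left)

lemma hom_neg: "x \<in> carrier M \<Longrightarrow> h (\<ominus>\<^bsub>M\<^esub> x) = \<ominus>\<^bsub>N\<^esub> h x"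
  using hom_smult[of "\<ominus>\<^bsub>R\<^esub> \<one>\<^bsub>R\<^esub>" x] hom_closed[of x]
  by (simp add: dom.smult_neg_one cod.smult_neg_one)

lemma hom_minus: "x \<in> carrier M \<Longrightarrow> y \<in> carrier M \<Longrightarrow> h (x \<ominus>\<^bsub>M\<^esub> y) = h x \<ominus>\<^bsub>N\<^esub> h y"
  by (simp add: hom_add hom_neg dom.M.minus_eq cod.M.minus_eq)

definition ker where "ker = {x \<in> carrier M. h x = \<zero>\<^bsub>N\<^esub>}"

lemma hom_eq_iff:
  assumes "x \<in> carrier M" "y \<in> carrier M" shows "h x = h y \<longleftrightarrow> x \<ominus>\<^bsub>M\<^esub> y \<in> ker"
  using assms by (simp add: ker_def hom_minus hom_closed cod.minus_eq_zero_iff)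

lemma submodule_preimage:
  assumes "submodule H R N" shows "submodule {x \<in> carrier M. h x \<in> H} R M"
  using assms unfolding dom.submodule_iff cod.submodule_iff
  by (auto simp: hom_zero hom_add hom_smult dom.smult_closed)

lemma submodule_ker: "submodule ker R M"
  using submodule_preimage[OF cod.submodule_trivial] by (simp add: ker_def)

lemma submodule_image:
  assumes H: "submodule H R M" shows "submodule (h ` H) R N"
proof -
  note sub = dom.submodule_subset[OF H]
  have "x \<oplus>\<^bsub>N\<^esub> y \<in> h ` H" if xy: "x \<in> h ` H" "y \<in> h ` H" for x y
  proof -
    obtain a b where ab: "a \<in> H" "b \<in> H" "x = h a" "y = h b" using xy by blast
    then have "x \<oplus>\<^bsub>N\<^esub> y = h (a \<oplus>\<^bsub>M\<^esub> b)" using sub by (simp add: hom_add)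
    then show ?thesis using ab dom.submodule_add[OF H] by blast
  qed
  moreover have "a \<odot>\<^bsub>N\<^esub> x \<in> h ` H" if a: "a \<in> carrier R" and x: "x \<in> h ` H" for a x
  proof -
    obtain b where b: "b \<in> H" "x = h b" using x by blast
    then have "a \<odot>\<^bsub>N\<^esub> x = h (a \<odot>\<^bsub>M\<^esub> b)" using sub a by (simp add: hom_smult)
    then show ?thesis using a b dom.submodule_smult[OF H] by blast
  qed
  moreover have "\<zero>\<^bsub>N\<^esub> \<in> h ` H" using dom.submodule_zero[OF H] hom_zero by (metis imageI)
  moreover have "h ` H \<subseteq> carrier N" using sub hom_closed by blast
  ultimately show ?thesis by (simp add: cod.submodule_iff)
qed

lemma mem_image_iff:
  assumes "submodule H R M" "ker \<subseteq> H" "x \<in> carrier M"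
  shows "h x \<in> h ` H \<longleftrightarrow> x \<in> H"
proof
  assume "h x \<in> h ` H"
  then obtain y where y: "y \<in> H" "h x = h y" by auto
  then have "x \<ominus>\<^bsub>M\<^esub> y \<in> H" using hom_eq_iff[of x y] assms dom.submodule_subset[OF assms(1)] by auto
  then have "(x \<ominus>\<^bsub>M\<^esub> y) \<oplus>\<^bsub>M\<^esub> y \<in> H" using y dom.submodule_add[OF assms(1)] by blast
  then show "x \<in> H"
    using y assms dom.submodule_subset[OF assms(1)] 
    by (simp add: dom.M.minus_eq dom.M.a_assoc dom.M.l_neg)
qed simp

text \<open>Submodules of an image correspond to the submodules that contain the kernel. An arbitrary
  surjection is considered here, because a simple module will be presented both as an image of
  the algebra and as a quotient of a Verma module.\<close>

lemma simple_iff_maximal_ker: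
  assumes surj: "h ` carrier M = carrier N"
  shows "simple_module R N \<longleftrightarrow> ker \<noteq> carrier M \<and>
    (\<forall>H. submodule H R M \<longrightarrow> ker \<subseteq> H \<longrightarrow> H = ker \<or> H = carrier M)" (is "?L \<longleftrightarrow> ?R")
proof
  assume s: ?L
  have N0: "carrier N \<noteq> {\<zero>\<^bsub>N\<^esub>}"
    and sN: "\<And>H. submodule H R N \<Longrightarrow> H = {\<zero>\<^bsub>N\<^esub>} \<or> H = carrier N"
    using s unfolding simple_module_def by blast+
  have "ker \<noteq> carrier M"
  proof
    assume k: "ker = carrier M"
    have "h x = \<zero>\<^bsub>N\<^esub>" if "x \<in> carrier M" for x
      using that unfolding k[symmetric] by (simp add: ker_def)
    then have "h ` carrier M \<subseteq> {\<zero>\<^bsub>N\<^esub>}" by (intro image_subsetI) simp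
    then have "carrier N \<subseteq> {\<zero>\<^bsub>N\<^esub>}" unfolding surj .
    then show False using N0 cod.M.zero_closed by blast
  qed
  moreover have "H = ker \<or> H = carrier M" if H: "submodule H R M" "ker \<subseteq> H" for H
  proof -
    have "h ` H = {\<zero>\<^bsub>N\<^esub>} \<or> h ` H = carrier N"
      by (rule sN[OF submodule_image[OF H(1)]])
    then show ?thesis
    proof
      assume "h ` H = {\<zero>\<^bsub>N\<^esub>}"
      then have "H \<subseteq> ker" using dom.submodule_subset[OF H(1)] by (auto simp: ker_def)
      then show ?thesis using H by blast
    next
      assume "h ` H = carrier N"
      then have "carrier M \<subseteq> H" using mem_image_iff[OF H] hom_closed by blast
      then show ?thesis using dom.submodule_subset[OF H(1)] by blast
    qed
  qed
  ultimately show ?R by blast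
next
  assume r: ?R
  have "carrier N \<noteq> {\<zero>\<^bsub>N\<^esub>}"
  proof
    assume "carrier N = {\<zero>\<^bsub>N\<^esub>}"
    then have "carrier M \<subseteq> ker" using hom_closed by (force simp: ker_def)
    moreover have "ker \<subseteq> carrier M" by (auto simp: ker_def)
    ultimately show False using r by blast
  qed
  moreover have "H = {\<zero>\<^bsub>N\<^esub>} \<or> H = carrier N" if H: "submodule H R N" for H
  proof -
    let ?P = "{x \<in> carrier M. h x \<in> H}"
    have "ker \<subseteq> ?P" using cod.submodule_zero[OF H] by (auto simp: ker_def)
    then have "?P = ker \<or> ?P = carrier M" using r submodule_preimage[OF H] by blast
    moreover have "h ` ?P = H"
    proof
      show "H \<subseteq> h ` ?P"
      proof
        fix y assume y: "y \<in> H"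
        then have "y \<in> h ` carrier M" unfolding surj by (rule cod.submodule_subset[OF H])
        then show "y \<in> h ` ?P" using y by blast
      qed
    qed blast
    moreover have "h ` ker = {\<zero>\<^bsub>N\<^esub>}"
    proof
      show "h ` ker \<subseteq> {\<zero>\<^bsub>N\<^esub>}" by (auto simp: ker_def)
      show "{\<zero>\<^bsub>N\<^esub>} \<subseteq> h ` ker"
        using imageI[OF dom.submodule_zero[OF submodule_ker], of h] by (simp add: hom_zero)
    qed
    ultimately show ?thesis using surj by (elim disjE) simp_all
  qed
  ultimately show ?L
    unfolding simple_module_def by (intro conjI allI impI cod.left_module_axioms)
qed

end

lemma module_iso_of_same_ker:
  assumes f: "left_module_hom R P S f" and g: "left_module_hom R P T g"
    and sf: "f ` carrier P = carrier S" and sg: "g ` carrier P = carrier T"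
    and ker: "left_module_hom.ker P S f = left_module_hom.ker P T g"
  shows "module_iso R S T"
proof -
  interpret f: left_module_hom R P S f by (rule f)
  interpret g: left_module_hom R P T g by (rule g)
  define pre where "pre s = (SOME x. x \<in> carrier P \<and> f x = s)" for s
  have pre: "pre s \<in> carrier P" "f (pre s) = s" if "s \<in> carrier S" for s
  proof -
    have "s \<in> f ` carrier P" unfolding sf by (rule that)
    then have "\<exists>x. x \<in> carrier P \<and> f x = s" by (elim imageE) blast
    from someI_ex[OF this] show "pre s \<in> carrier P" "f (pre s) = s" by (simp_all add: pre_def)
  qed
  define h where "h s = g (pre s)" for s
  have fg: "f x = f y \<longleftrightarrow> g x = g y" if "x \<in> carrier P" "y \<in> carrier P" for x y
    using f.hom_eq_iff[OF that] g.hom_eq_iff[OF that] ker by simp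
  have hf: "h (f x) = g x" if "x \<in> carrier P" for x
    unfolding h_def using fg[OF pre(1)[OF f.hom_closed[OF that]] that] pre(2)[OF f.hom_closed[OF that]]
    by blast
  have S: "\<exists>a\<in>carrier P. x = f a" if "x \<in> carrier S" for x
    using pre[OF that] by metis
  have h_add: "h (x \<oplus>\<^bsub>S\<^esub> y) = h x \<oplus>\<^bsub>T\<^esub> h y" if xy: "x \<in> carrier S" "y \<in> carrier S" for x y
  proof -
    obtain a b where ab: "a \<in> carrier P" "b \<in> carrier P" "x = f a" "y = f b" using S xy by meson
    have "x \<oplus>\<^bsub>S\<^esub> y = f (a \<oplus>\<^bsub>P\<^esub> b)" using ab by (simp add: f.hom_add)
    then show ?thesis using ab by (simp add: hf g.hom_add)
  qed
  have h_smult: "h (a \<odot>\<^bsub>S\<^esub> x) = a \<odot>\<^bsub>T\<^esub> h x" if a: "a \<in> carrier R" and x: "x \<in> carrier S" for a x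
  proof -
    obtain b where b: "b \<in> carrier P" "x = f b" using S x by meson
    have "a \<odot>\<^bsub>S\<^esub> x = f (a \<odot>\<^bsub>P\<^esub> b)" using a b by (simp add: f.hom_smult)
    then show ?thesis using a b by (simp add: hf g.hom_smult f.dom.smult_closed)
  qed
  have h_closed: "h x \<in> carrier T" if "x \<in> carrier S" for x
    unfolding h_def by (rule g.hom_closed[OF pre(1)[OF that]])
  have "h \<in> module_homs R S T"
    unfolding module_homs_def using h_closed h_add h_smult by blast
  moreover have "inj_on h (carrier S)"
  proof (rule inj_onI)
    fix x y assume xy: "x \<in> carrier S" "y \<in> carrier S" "h x = h y"
    then have "f (pre x) = f (pre y)" using fg[OF pre(1) pre(1)] unfolding h_def by blast
    then show "x = y" using xy pre(2) by simp
  qed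
  moreover have "h ` carrier S = carrier T"
  proof
    show "carrier T \<subseteq> h ` carrier S"
    proof
      fix y assume "y \<in> carrier T"
      then have "y \<in> g ` carrier P" unfolding sg .
      then obtain a where "a \<in> carrier P" "y = g a" by (elim imageE)
      then show "y \<in> h ` carrier S" using hf f.hom_closed by (metis imageI)
    qed
  qed (use h_closed in blast)
  ultimately show ?thesis by (auto simp: module_iso_def bij_betw_def)
qed

lemma module_iso_sym:
  assumes "left_module R M" "left_module R N" "module_iso R M N"
  shows "module_iso R N M"
proof -
  interpret M: left_module R M by fact
  obtain h where h: "h \<in> module_homs R M N" "bij_betw h (carrier M) (carrier N)"
    using assms by (auto simp: module_iso_def)
  interpret h: left_module_hom R M N h
    using assms h by (auto intro!: left_module_hom.intro left_module_hom_axioms.intro)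
  have id: "left_module_hom R M M id"
    using assms by (auto intro!: left_module_hom.intro left_module_hom_axioms.intro simp: module_homs_def)
  have "h.ker = {\<zero>\<^bsub>M\<^esub>}"
  proof
    show "h.ker \<subseteq> {\<zero>\<^bsub>M\<^esub>}"
    proof
      fix x assume "x \<in> h.ker"
      then have "x \<in> carrier M" "h x = h \<zero>\<^bsub>M\<^esub>" by (simp_all add: h.ker_def h.hom_zero)
      then have "x = \<zero>\<^bsub>M\<^esub>" using bij_betw_imp_inj_on[OF h(2)] M.M.zero_closed by (blast dest: inj_onD)
      then show "x \<in> {\<zero>\<^bsub>M\<^esub>}" by simp
    qed
    show "{\<zero>\<^bsub>M\<^esub>} \<subseteq> h.ker" by (simp add: h.ker_def h.hom_zero)
  qed
  moreover have "left_module_hom.ker M M id = {\<zero>\<^bsub>M\<^esub>}"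
    by (auto simp: left_module_hom.ker_def[OF id])
  ultimately have "left_module_hom.ker M N h = left_module_hom.ker M M id" by simp
  from module_iso_of_same_ker[OF h.left_module_hom_axioms id bij_betw_imp_surj_on[OF h(2)] _ this]
  show ?thesis by simp
qed

lemma module_iso_trans:
  assumes "module_iso R M N" "module_iso R N P"
  shows "module_iso R M P"
proof -
  obtain f where f: "f \<in> module_homs R M N" "bij_betw f (carrier M) (carrier N)"
    using assms(1) unfolding module_iso_def by (elim bexE)
  obtain g where g: "g \<in> module_homs R N P" "bij_betw g (carrier N) (carrier P)"
    using assms(2) unfolding module_iso_def by (elim bexE)
  have "g \<circ> f \<in> module_homs R M P"
    unfolding module_homs_def
    by (simp add: module_homsD[OF f(1)] module_homsD[OF g(1)])
  then show ?thesis
    unfolding module_iso_def using bij_betw_trans[OF f(2) g(2)] by (intro bexI)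
qed

context left_module
begin

context
  fixes N assumes N: "submodule N R M"
begin

interpretation N: abelian_subgroup N M
  using N M.abelian_group_axioms
  by (intro abelian_subgroupI3 additive_subgroup.intro submodule.axioms(1))

lemma coset_eq_iff:
  assumes "x \<in> carrier M" "y \<in> carrier M"
  shows "N +>\<^bsub>M\<^esub> x = N +>\<^bsub>M\<^esub> y \<longleftrightarrow> x \<ominus>\<^bsub>M\<^esub> y \<in> N"
  using assms N.a_rcos_module[of y x] 
    N.a_repr_independence'[of x y] N.a_rcos_self[of x] by (auto simp: M.minus_eq)

lemma quotient_smult:
  assumes a: "a \<in> carrier R" and x: "x \<in> carrier M"
  shows "a \<odot>\<^bsub>quotient_module M N\<^esub> (N +>\<^bsub>M\<^esub> x) = N +>\<^bsub>M\<^esub> (a \<odot>\<^bsub>M\<^esub> x)"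
proof -
  have "N +>\<^bsub>M\<^esub> (a \<odot>\<^bsub>M\<^esub> y) = N +>\<^bsub>M\<^esub> (a \<odot>\<^bsub>M\<^esub> x)" if "y \<in> N +>\<^bsub>M\<^esub> x" for y
  proof -
    obtain n where n: "n \<in> N" "y = n \<oplus>\<^bsub>M\<^esub> x" using \<open>y \<in> _\<close> by (auto simp: a_r_coset_def')
    then have nc: "n \<in> carrier M" using submodule_subset[OF N] by blast
    have "a \<odot>\<^bsub>M\<^esub> y \<ominus>\<^bsub>M\<^esub> a \<odot>\<^bsub>M\<^esub> x = a \<odot>\<^bsub>M\<^esub> n"
      using a x n nc by (simp add: smult_r_distr smult_closed M.minus_eq M.a_assoc M.r_neg)
    then show ?thesis
      using a x n nc submodule_smult[OF N] by (simp add: coset_eq_iff smult_closed)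
  qed
  then have "(\<Union>y\<in>N +>\<^bsub>M\<^esub> x. N +>\<^bsub>M\<^esub> (a \<odot>\<^bsub>M\<^esub> y)) = (\<Union>y\<in>N +>\<^bsub>M\<^esub> x. N +>\<^bsub>M\<^esub> (a \<odot>\<^bsub>M\<^esub> x))"
    by (rule SUP_cong[OF refl])
  also have "\<dots> = N +>\<^bsub>M\<^esub> (a \<odot>\<^bsub>M\<^esub> x)" using N.a_rcos_self[OF x] by (intro SUP_const) blast
  finally show ?thesis by (simp add: quotient_module_def)
qed

lemma quotient_carrier: "carrier (quotient_module M N) = (\<lambda>x. N +>\<^bsub>M\<^esub> x) ` carrier M"
  by (auto simp: quotient_module_def A_RCOSETS_def')

lemma quotient_add:
  "x \<in> carrier M \<Longrightarrow> y \<in> carrier M \<Longrightarrow>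
    (N +>\<^bsub>M\<^esub> x) \<oplus>\<^bsub>quotient_module M N\<^esub> (N +>\<^bsub>M\<^esub> y) = N +>\<^bsub>M\<^esub> (x \<oplus>\<^bsub>M\<^esub> y)"
  by (simp add: quotient_module_def N.a_rcos_sum)

lemma quotient_zero: "\<zero>\<^bsub>quotient_module M N\<^esub> = N +>\<^bsub>M\<^esub> \<zero>\<^bsub>M\<^esub>"
  using N submodule_subset by (simp add: quotient_module_def subset_iff)

lemma left_module_quotient: "left_module R (quotient_module M N)"
proof -
  let ?Q = "quotient_module M N"
  have "abelian_group ?Q"
  proof (rule abelian_groupI)
    fix x assume "x \<in> carrier ?Q"
    then obtain m where "m \<in> carrier M" "x = N +>\<^bsub>M\<^esub> m" by (auto simp: quotient_carrier)
    then show "\<exists>y\<in>carrier ?Q. y \<oplus>\<^bsub>?Q\<^esub> x = \<zero>\<^bsub>?Q\<^esub>"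
      by (auto simp: quotient_carrier quotient_add quotient_zero M.l_neg intro!: bexI[of _ "\<ominus>\<^bsub>M\<^esub> m"])
  qed (auto simp: quotient_carrier quotient_add quotient_zero M.a_ac)
  then show ?thesis
    using R.ring_axioms
    by (auto intro!: left_module.intro left_module_axioms.intro simp: quotient_carrier quotient_add
        quotient_smult smult_closed smult_l_distr smult_r_distr smult_assoc smult_one)
qed

lemma left_module_hom_quotient: "left_module_hom R M (quotient_module M N) (\<lambda>x. N +>\<^bsub>M\<^esub> x)"
  using left_module_quotient left_module_axioms
  by (auto intro!: left_module_hom.intro left_module_hom_axioms.intro
      simp: module_homs_def quotient_carrier quotient_add quotient_smult)

lemma ker_quotient: "left_module_hom.ker M (quotient_module M N) (\<lambda>x. N +>\<^bsub>M\<^esub> x) = N"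
proof -
  interpret h: left_module_hom R M "quotient_module M N" "\<lambda>x. N +>\<^bsub>M\<^esub> x"
    by (rule left_module_hom_quotient)
  have "\<ominus>\<^bsub>M\<^esub> \<zero>\<^bsub>M\<^esub> = \<zero>\<^bsub>M\<^esub>" by (rule M.minus_equality) simp_all
  then have "x \<ominus>\<^bsub>M\<^esub> \<zero>\<^bsub>M\<^esub> = x" if "x \<in> carrier M" for x using that by (simp add: M.minus_eq)
  then have "x \<in> h.ker \<longleftrightarrow> x \<in> N" if "x \<in> carrier M" for x
    using that coset_eq_iff[of x "\<zero>\<^bsub>M\<^esub>"] unfolding h.ker_def quotient_zero
    by simp
  moreover have "h.ker \<subseteq> carrier M" by (simp add: h.ker_def)
  ultimately show ?thesis using submodule_subset[OF N] by (intro equalityI subsetI) (metis subsetD)+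
qed

end

end

section \<open>Linear extensions on free algebras\<close>

lemma const_add: "const (a + b) = const a + const b"
  by (simp add: const_def single_add)

lemma const_mult: "const (a * b) = const a * const b"
  by (simp add: const_def mult_single)

lemma const_zero [simp]: "const 0 = 0" and const_one [simp]: "const 1 = 1"
  by (simp_all add: const_def)

lemma const_minus: "const (- a) = - const a"
  by (simp add: const_def single_uminus)

lemma const_diff: "const (a - b) = const a - const b"
  by (simp add: const_def single_diff)

lemma const_mult_single: "const a * Poly_Mapping.single w b = Poly_Mapping.single w (a * b)"
  by (simp add: const_def mult_single)

lemma single_mult_const: "Poly_Mapping.single w b * const a = Poly_Mapping.single w (b * a)"
  by (simp add: const_def mult_single)

lemma single_Nil: "Poly_Mapping.single (Word []) c = const c"
  by (simp add: const_def zero_word_def)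

lemma single_Cons: "Poly_Mapping.single (Word (g # gs)) c = letter g * Poly_Mapping.single (Word gs) c"
  by (simp add: letter_def mult_single)

lemma sum_singles: "p = (\<Sum>w\<in>Poly_Mapping.keys p. Poly_Mapping.single w (Poly_Mapping.lookup p w))"
proof (rule poly_mapping_eqI)
  fix v
  have "Poly_Mapping.lookup (\<Sum>w\<in>Poly_Mapping.keys p. Poly_Mapping.single w (Poly_Mapping.lookup p w)) v
    = (\<Sum>w\<in>Poly_Mapping.keys p. if w = v then Poly_Mapping.lookup p w else 0)"
    by (simp add: lookup_sum lookup_single when_def)
  also have "\<dots> = Poly_Mapping.lookup p v" by (simp add: in_keys_iff)
  finally show "Poly_Mapping.lookup p v = Poly_Mapping.lookup
    (\<Sum>w\<in>Poly_Mapping.keys p. Poly_Mapping.single w (Poly_Mapping.lookup p w)) v" by simp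
qed

lemma free_induct_single [case_names single add]:
  assumes "\<And>w c. P (Poly_Mapping.single w c)" and "\<And>p p'. P p \<Longrightarrow> P p' \<Longrightarrow> P (p + p')"
  shows "P (p :: ('g, 'k::field) free_elt)"
proof -
  have "P (\<Sum>w\<in>W. Poly_Mapping.single w (Poly_Mapping.lookup p w))" if "finite W" for W
    using that
  proof (induction W)
    case empty
    then show ?case using assms(1)[of undefined 0] by simp
  next
    case (insert w W)
    then show ?case by (simp add: assms)
  qed
  from this[OF finite_keys] have "P (\<Sum>w\<in>Poly_Mapping.keys p. Poly_Mapping.single w (Poly_Mapping.lookup p w))" .
  then show ?thesis by (simp only: sum_singles[symmetric])
qed

lemma free_induct [case_names const letter add]:
  assumes "\<And>c. P (const c)" and "\<And>g p. P p \<Longrightarrow> P (letter g * p)" and "\<And>p p'. P p \<Longrightarrow> P p' \<Longrightarrow> P (p + p')"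
  shows "P (p :: ('g, 'k::field) free_elt)"
proof (induction p rule: free_induct_single)
  case (single w c)
  obtain gs where w: "w = Word gs" by (cases w)
  show ?case unfolding w by (induction gs) (simp_all add: single_Nil single_Cons assms)
qed (rule assms)

lemma const_commute: "const c * p = p * const c"
  by (induction p rule: free_induct_single)
    (simp_all add: const_mult_single single_mult_const algebra_simps)

definition linear_extension :: "('g word \<Rightarrow> ('h, 'k::field) free_elt) \<Rightarrow> ('g, 'k) free_elt \<Rightarrow> ('h, 'k) free_elt" where
  "linear_extension u p = (\<Sum>w\<in>Poly_Mapping.keys p. const (Poly_Mapping.lookup p w) * u w)"

lemma linear_extension_add: "linear_extension u (p + p') = linear_extension u p + linear_extension u p'"
  unfolding linear_extension_def
  by (rule setsum_keys_plus_distrib) (simp_all add: const_add algebra_simps)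

lemma linear_extension_single: "linear_extension u (Poly_Mapping.single w c) = const c * u w"
  by (simp add: linear_extension_def)

lemma linear_extension_const: "u 0 = 1 \<Longrightarrow> linear_extension u (const c) = const c"
  by (simp add: const_def[of c] linear_extension_single)

lemma linear_extension_mult:
  assumes u: "\<And>v w. u (v + w) = u v * u w"
  shows "linear_extension u (p * p') = linear_extension u p * linear_extension u p'"
proof (induction p rule: free_induct_single)
  case (single v a)
  show ?case
  proof (induction p' rule: free_induct_single)
    case (single w b)
    have "const a * const b * (u v * u w) = const a * (const b * u v) * u w" by (simp add: mult.assoc)
    also have "\<dots> = const a * u v * (const b * u w)" by (simp only: const_commute[of b "u v"] mult.assoc)
    finally show ?case by (simp add: mult_single linear_extension_single u const_mult)
  qed (simp add: algebra_simps linear_extension_add)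
qed (simp add: algebra_simps linear_extension_add)

lemma linear_extension_mult_rev:
  assumes u: "\<And>v w. u (v + w) = u w * u v"
  shows "linear_extension u (p * p') = linear_extension u p' * linear_extension u p"
proof (induction p rule: free_induct_single)
  case (single v a)
  show ?case
  proof (induction p' rule: free_induct_single)
    case (single w b)
    have "const a * const b * (u w * u v) = const b * (const a * u w) * u v"
      by (simp only: const_commute[of a "const b"] mult.assoc)
    also have "\<dots> = const b * u w * (const a * u v)" by (simp only: const_commute[of a "u w"] mult.assoc)
    finally show ?case by (simp add: mult_single linear_extension_single u const_mult)
  qed (simp add: algebra_simps linear_extension_add)
qed (simp add: algebra_simps linear_extension_add)

lemma free_map_eq_linear_extension:
  "free_map f = linear_extension (\<lambda>w. Poly_Mapping.single (map_word f w) 1)"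
  by (rule ext) (simp add: free_map_def linear_extension_def const_mult_single)

lemma free_map_add: "free_map f (p + p') = free_map f p + free_map f p'"
  by (simp add: free_map_eq_linear_extension linear_extension_add)

lemma free_map_mult: "free_map f (p * p') = free_map f p * free_map f p'"
proof -
  have "map_word f (v + w) = map_word f v + map_word f w" for v w by (cases v; cases w) simp
  then show ?thesis
    unfolding free_map_eq_linear_extension by (intro linear_extension_mult) (simp add: mult_single)
qed

lemma free_map_single: "free_map f (Poly_Mapping.single w c) = Poly_Mapping.single (map_word f w) c"
  by (simp add: free_map_eq_linear_extension linear_extension_single const_mult_single)

lemma free_map_const: "free_map f (const c) = const c"
  by (simp add: const_def free_map_single zero_word_def)

lemma free_map_letter: "free_map f (letter g) = letter (f g)"
  by (simp add: letter_def free_map_single)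

lemma free_map_minus: "free_map f (p - p') = free_map f p - free_map f p'"
  using free_map_add[of f "p - p'" p'] by (simp add: algebra_simps)

section \<open>Presented algebras\<close>

interpretation free_algebra: ring free_algebra
proof (rule ringI)
  show "abelian_group (free_algebra :: ('g, 'k::field) free_elt ring)"
  proof (rule abelian_groupI)
    fix x :: "('g, 'k) free_elt" assume "x \<in> carrier free_algebra"
    show "\<exists>y\<in>carrier free_algebra. y \<oplus>\<^bsub>free_algebra\<^esub> x = \<zero>\<^bsub>free_algebra\<^esub>"
      by (intro bexI[of _ "- x"]) (simp_all add: free_algebra_def)
  qed (simp_all add: free_algebra_def algebra_simps)
  show "Group.monoid (free_algebra :: ('g, 'k::field) free_elt ring)"
    by (rule monoidI) (simp_all add: free_algebra_def algebra_simps)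
qed (simp_all add: free_algebra_def algebra_simps)

lemma free_algebra_simps [simp]:
  "carrier free_algebra = UNIV" "x \<otimes>\<^bsub>free_algebra\<^esub> y = x * y" "\<one>\<^bsub>free_algebra\<^esub> = 1"
  "\<zero>\<^bsub>free_algebra\<^esub> = 0" "x \<oplus>\<^bsub>free_algebra\<^esub> y = x + y"
  by (simp_all add: free_algebra_def)

lemma free_algebra_uminus [simp]: "\<ominus>\<^bsub>free_algebra\<^esub> x = - x"
  by (rule free_algebra.minus_equality) simp_all

context
  fixes P :: "('g, 'k::field) free_elt set"
begin

lemma ideal_relations: "ideal (Idl\<^bsub>free_algebra\<^esub> P) free_algebra"
  by (rule free_algebra.genideal_ideal) simp

interpretation I: ideal "Idl\<^bsub>free_algebra\<^esub> P" free_algebra by (rule ideal_relations)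

lemma genideal_add: "p \<in> Idl\<^bsub>free_algebra\<^esub> P \<Longrightarrow> p' \<in> Idl\<^bsub>free_algebra\<^esub> P \<Longrightarrow> p + p' \<in> Idl\<^bsub>free_algebra\<^esub> P"
  using I.a_closed by simp

lemma genideal_zero: "0 \<in> Idl\<^bsub>free_algebra\<^esub> P"
  using I.zero_closed by simp

lemma genideal_mult_left: "p \<in> Idl\<^bsub>free_algebra\<^esub> P \<Longrightarrow> a * p \<in> Idl\<^bsub>free_algebra\<^esub> P"
  using I.I_l_closed[of p a] by simp

lemma genideal_mult_right: "p \<in> Idl\<^bsub>free_algebra\<^esub> P \<Longrightarrow> p * a \<in> Idl\<^bsub>free_algebra\<^esub> P"
  using I.I_r_closed[of p a] by simp

lemma genideal_generator: "p \<in> P \<Longrightarrow> p \<in> Idl\<^bsub>free_algebra\<^esub> P"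
  using free_algebra.genideal_self[of P] by auto

lemma genideal_least:
  assumes "P \<subseteq> J" "0 \<in> J" "\<And>p p'. p \<in> J \<Longrightarrow> p' \<in> J \<Longrightarrow> p + p' \<in> J"
    "\<And>a p. p \<in> J \<Longrightarrow> a * p \<in> J" "\<And>a p. p \<in> J \<Longrightarrow> p * a \<in> J"
  shows "Idl\<^bsub>free_algebra\<^esub> P \<subseteq> J"
proof (rule free_algebra.genideal_minimal)
  have "- p \<in> J" if "p \<in> J" for p using assms(4)[OF that, of "- 1"] by simp
  then have "additive_subgroup J free_algebra"
    using assms by (intro additive_subgroup.intro free_algebra.add.subgroupI) (auto simp: a_inv_def[symmetric])
  then show "ideal J free_algebra"
    using assms free_algebra.ring_axioms by (intro idealI) (auto simp: additive_subgroup_def)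
qed (use assms in auto)

lemma ring_presented_algebra: "ring (presented_algebra P)"
  unfolding presented_algebra_def by (rule I.quotient_is_ring)

lemma pres_class_eq_iff: "pres_class P p = pres_class P p' \<longleftrightarrow> p - p' \<in> Idl\<^bsub>free_algebra\<^esub> P"
proof -
  have "p \<in> Idl\<^bsub>free_algebra\<^esub> P +>\<^bsub>free_algebra\<^esub> p' \<longleftrightarrow> p + - p' \<in> Idl\<^bsub>free_algebra\<^esub> P"
    using I.a_rcos_module[of p' p] by simp
  then show ?thesis
    using I.a_repr_independence'[of p p'] I.a_rcos_self[of p] unfolding pres_class_def by auto
qed

lemma presented_algebra_simps:
  shows "carrier (presented_algebra P) = range (pres_class P)"
    and "pres_class P p \<otimes>\<^bsub>presented_algebra P\<^esub> pres_class P p' = pres_class P (p * p')"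
    and "pres_class P p \<oplus>\<^bsub>presented_algebra P\<^esub> pres_class P p' = pres_class P (p + p')"
    and "\<one>\<^bsub>presented_algebra P\<^esub> = pres_class P 1"
    and "\<zero>\<^bsub>presented_algebra P\<^esub> = pres_class P 0"
  using I.rcoset_mult_add[of p p'] I.a_rcos_sum[of p p'] I.a_rcos_const[OF I.zero_closed]
  by (auto simp: presented_algebra_def pres_class_def FactRing_def A_RCOSETS_def')

lemma pres_class_uminus: "\<ominus>\<^bsub>presented_algebra P\<^esub> pres_class P p = pres_class P (- p)"
proof -
  interpret A: ring "presented_algebra P" by (rule ring_presented_algebra)
  show ?thesis by (rule A.minus_equality) (simp_all add: presented_algebra_simps)
qed

lemma mem_pres_class: "c \<in> pres_class P p \<Longrightarrow> pres_class P c = pres_class P p"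
  using I.a_repr_independence'[of c p] by (simp add: pres_class_def)

end

section \<open>Modules over the quantized symplectic oscillator algebra\<close>

abbreviation "lE \<equiv> letter (Uq_gen Gen_E)"
abbreviation "lF \<equiv> letter (Uq_gen Gen_F)"
abbreviation "lK \<equiv> letter (Uq_gen Gen_K)"
abbreviation "lK' \<equiv> letter (Uq_gen Gen_K_inv)"
abbreviation "lX \<equiv> letter Gen_X"
abbreviation "lY \<equiv> letter Gen_Y"

locale osc_params =
  fixes q :: "'k::field" and C0 :: "(uq_gen, 'k) pres_elt"
  assumes q_nonzero: "q \<noteq> 0"
    and q_not_root: "\<forall>n::nat. n > 0 \<longrightarrow> q ^ n \<noteq> 1"
begin

abbreviation A where "A \<equiv> osc_algebra q C0"
abbreviation "cls \<equiv> pres_class (osc_relations q C0)"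
abbreviation "I \<equiv> Idl\<^bsub>free_algebra\<^esub> (osc_relations q C0)"

lemma ring_A: "ring A"
  unfolding osc_algebra_def by (rule ring_presented_algebra)

lemmas A_simps = presented_algebra_simps[of "osc_relations q C0", folded osc_algebra_def]

lemma A_uminus: "\<ominus>\<^bsub>A\<^esub> cls p = cls (- p)"
  unfolding osc_algebra_def by (rule pres_class_uminus)

lemma osc_relation_members:
  shows "lK * lK' - 1 \<in> osc_relations q C0"
    and "lK' * lK - 1 \<in> osc_relations q C0"
    and "lK * lE * lK' - const (q ^ 2) * lE \<in> osc_relations q C0"
    and "lK * lF * lK' - const (inverse (q ^ 2)) * lF \<in> osc_relations q C0"
    and "lE * lF - lF * lE - const (inverse (q - inverse q)) * (lK - lK') \<in> osc_relations q C0"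
    and "lE * lX - const q * lX * lE \<in> osc_relations q C0"
    and "lE * lY - (lX + const (inverse q) * lY * lE) \<in> osc_relations q C0"
    and "lF * lX - (lY * lK' + lX * lF) \<in> osc_relations q C0"
    and "lF * lY - lY * lF \<in> osc_relations q C0"
    and "lK * lX * lK' - const q * lX \<in> osc_relations q C0"
    and "lK * lY * lK' - const (inverse q) * lY \<in> osc_relations q C0"
    and "c \<in> C0 \<Longrightarrow> const q * lY * lX - lX * lY - free_map Uq_gen c \<in> osc_relations q C0"
  unfolding osc_relations_def Let_def uq_relations_def const_one[symmetric]
  by (simp_all add: free_map_minus free_map_mult free_map_letter free_map_const del: const_one) blast

end

locale osc_module = osc_params q C0 + left_module "osc_algebra q C0" M
  for q :: "'k::field" and C0 and M :: "('k osc_elt, 'm) module"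
begin

text \<open>Elements of the free algebra act through their classes. Calculating with representatives
  makes the algebra relations ordinary rewrite rules.\<close>

definition act :: "(osc_gen, 'k) free_elt \<Rightarrow> 'm \<Rightarrow> 'm" where
  "act p x = cls p \<odot>\<^bsub>M\<^esub> x"

abbreviation sc :: "'k \<Rightarrow> 'm \<Rightarrow> 'm" where "sc c \<equiv> act (const c)"

lemma cls_closed [simp]: "cls p \<in> carrier A"
  by (simp add: A_simps)

lemma act_closed [simp]: "x \<in> carrier M \<Longrightarrow> act p x \<in> carrier M"
  by (simp add: act_def smult_closed)

lemma act_add: "x \<in> carrier M \<Longrightarrow> act (p + p') x = act p x \<oplus>\<^bsub>M\<^esub> act p' x"
  by (simp add: act_def smult_l_distr flip: A_simps)

lemma act_mult: "x \<in> carrier M \<Longrightarrow> act (p * p') x = act p (act p' x)"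
  by (simp add: act_def smult_assoc flip: A_simps)

lemma act_1 [simp]: "x \<in> carrier M \<Longrightarrow> act 1 x = x"
  by (simp add: act_def smult_one flip: A_simps)

lemma act_0 [simp]: "x \<in> carrier M \<Longrightarrow> act 0 x = \<zero>\<^bsub>M\<^esub>"
  by (simp add: act_def smult_zero_left flip: A_simps)

lemma act_uminus: "x \<in> carrier M \<Longrightarrow> act (- p) x = \<ominus>\<^bsub>M\<^esub> act p x"
  using act_add[of x "- p" p] by (simp add: M.minus_equality)

lemma act_minus: "x \<in> carrier M \<Longrightarrow> act (p - p') x = act p x \<ominus>\<^bsub>M\<^esub> act p' x"
  using act_add[of x p "- p'"] by (simp add: act_uminus M.minus_eq)

lemma act_plus_right: "x \<in> carrier M \<Longrightarrow> y \<in> carrier M \<Longrightarrow> act p (x \<oplus>\<^bsub>M\<^esub> y) = act p x \<oplus>\<^bsub>M\<^esub> act p y"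
  by (simp add: act_def smult_r_distr)

lemma act_zero_right [simp]: "act p \<zero>\<^bsub>M\<^esub> = \<zero>\<^bsub>M\<^esub>"
  by (simp add: act_def smult_zero_right)

lemma act_neg_right: "x \<in> carrier M \<Longrightarrow> act p (\<ominus>\<^bsub>M\<^esub> x) = \<ominus>\<^bsub>M\<^esub> act p x"
  using act_plus_right[of "\<ominus>\<^bsub>M\<^esub> x" x p] by (simp add: M.l_neg M.minus_equality)

lemma act_minus_right: "x \<in> carrier M \<Longrightarrow> y \<in> carrier M \<Longrightarrow> act p (x \<ominus>\<^bsub>M\<^esub> y) = act p x \<ominus>\<^bsub>M\<^esub> act p y"
  by (simp add: M.minus_eq act_plus_right act_neg_right)

lemma act_cong: "p - p' \<in> I \<Longrightarrow> act p = act p'"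
  by (simp add: act_def fun_eq_iff pres_class_eq_iff[THEN iffD2])

lemma act_relation: "p - p' \<in> osc_relations q C0 \<Longrightarrow> act p = act p'"
  by (rule act_cong, rule genideal_generator)

lemma sc_sc: "x \<in> carrier M \<Longrightarrow> sc a (sc b x) = sc (a * b) x"
  by (simp add: const_mult act_mult)

lemma sc_add: "x \<in> carrier M \<Longrightarrow> sc (a + b) x = sc a x \<oplus>\<^bsub>M\<^esub> sc b x"
  by (simp add: const_add act_add)

lemma sc_uminus: "x \<in> carrier M \<Longrightarrow> sc (- a) x = \<ominus>\<^bsub>M\<^esub> sc a x"
  by (simp add: const_minus act_uminus)

lemma act_letter_sc: "x \<in> carrier M \<Longrightarrow> act (letter g) (sc c x) = sc c (act (letter g) x)"
  by (simp add: const_commute flip: act_mult)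

lemma act_sc: "x \<in> carrier M \<Longrightarrow> act p (sc c x) = sc c (act p x)"
  by (simp add: const_commute flip: act_mult)

lemma K_Kinv [simp]: "x \<in> carrier M \<Longrightarrow> act lK (act lK' x) = x"
  using fun_cong[OF act_relation[OF osc_relation_members(1)], of x] by (simp add: act_mult)

lemma Kinv_K [simp]: "x \<in> carrier M \<Longrightarrow> act lK' (act lK x) = x"
  using fun_cong[OF act_relation[OF osc_relation_members(2)], of x] by (simp add: act_mult)

lemma K_commute:
  assumes "lK * letter g * lK' - const c * letter g \<in> osc_relations q C0" and "x \<in> carrier M"
  shows "act lK (act (letter g) x) = sc c (act (letter g) (act lK x))"
  using fun_cong[OF act_relation[OF assms(1)], of "act lK x"] assms(2) by (simp add: act_mult)

lemma Kinv_commute: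
  assumes r: "lK * letter g * lK' - const c * letter g \<in> osc_relations q C0" and x: "x \<in> carrier M"
    and c: "c \<noteq> 0"
  shows "act lK' (act (letter g) x) = sc (inverse c) (act (letter g) (act lK' x))"
proof -
  have "act lK' (act lK (act (letter g) (act lK' x))) = act lK' (sc c (act (letter g) x))"
    using K_commute[OF r, of "act lK' x"] x by simp
  then have "act (letter g) (act lK' x) = sc c (act lK' (act (letter g) x))"
    using x by (simp add: act_letter_sc)
  then show ?thesis using x c by (simp add: sc_sc)
qed

lemmas K_past = K_commute[OF osc_relation_members(3)] K_commute[OF osc_relation_members(4)]
  K_commute[OF osc_relation_members(10)] K_commute[OF osc_relation_members(11)]

lemma Kinv_past:
  assumes "x \<in> carrier M"
  shows "act lK' (act lE x) = sc (inverse (q ^ 2)) (act lE (act lK' x))"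
    and "act lK' (act lF x) = sc (q ^ 2) (act lF (act lK' x))"
    and "act lK' (act lX x) = sc (inverse q) (act lX (act lK' x))"
    and "act lK' (act lY x) = sc q (act lY (act lK' x))"
  using Kinv_commute[OF osc_relation_members(3) assms] Kinv_commute[OF osc_relation_members(4) assms]
    Kinv_commute[OF osc_relation_members(10) assms] Kinv_commute[OF osc_relation_members(11) assms]
  by (simp_all add: q_nonzero)

abbreviation "hq \<equiv> inverse (q - inverse q)"

lemma E_F:
  assumes "x \<in> carrier M"
  shows "act lE (act lF x) = act lF (act lE x) \<oplus>\<^bsub>M\<^esub> sc hq (act lK x \<ominus>\<^bsub>M\<^esub> act lK' x)"
proof -
  have "lE * lF - (lF * lE + const hq * (lK - lK')) \<in> osc_relations q C0"
    using osc_relation_members(5) by (simp add: algebra_simps)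
  from fun_cong[OF act_relation[OF this], of x] assms show ?thesis
    by (simp add: act_mult act_add act_minus)
qed

lemma E_X: "x \<in> carrier M \<Longrightarrow> act lE (act lX x) = sc q (act lX (act lE x))"
  using fun_cong[OF act_relation[OF osc_relation_members(6)], of x] by (simp add: act_mult)

lemma E_Y: "x \<in> carrier M \<Longrightarrow> act lE (act lY x) = act lX x \<oplus>\<^bsub>M\<^esub> sc (inverse q) (act lY (act lE x))"
  using fun_cong[OF act_relation[OF osc_relation_members(7)], of x] by (simp add: act_mult act_add)

lemma F_X: "x \<in> carrier M \<Longrightarrow> act lF (act lX x) = act lY (act lK' x) \<oplus>\<^bsub>M\<^esub> act lX (act lF x)"
  using fun_cong[OF act_relation[OF osc_relation_members(8)], of x] by (simp add: act_mult act_add)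

lemma F_Y: "x \<in> carrier M \<Longrightarrow> act lF (act lY x) = act lY (act lF x)"
  using fun_cong[OF act_relation[OF osc_relation_members(9)], of x] by (simp add: act_mult)

lemma X_Y:
  assumes "x \<in> carrier M" "c \<in> C0"
  shows "act lX (act lY x) = sc q (act lY (act lX x)) \<ominus>\<^bsub>M\<^esub> act (free_map Uq_gen c) x"
proof -
  have "- 1 * (const q * lY * lX - lX * lY - free_map Uq_gen c) \<in> I"
    by (intro genideal_mult_left genideal_generator osc_relation_members(12) assms(2))
  then have "lX * lY - (const q * lY * lX - free_map Uq_gen c) \<in> I" by (simp add: algebra_simps)
  from fun_cong[OF act_cong[OF this], of x] assms show ?thesis by (simp add: act_mult act_minus)
qed

end

lemma (in ring) left_module_regular: "left_module R (regular_module R)"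
proof (rule left_module.intro)
  show "abelian_group (regular_module R)"
  proof (rule abelian_groupI)
    fix x assume "x \<in> carrier (regular_module R)"
    then show "\<exists>y\<in>carrier (regular_module R). y \<oplus>\<^bsub>regular_module R\<^esub> x = \<zero>\<^bsub>regular_module R\<^esub>"
      by (intro bexI[of _ "\<ominus> x"]) (simp_all add: regular_module_def l_neg)
  qed (simp_all add: regular_module_def a_ac)
qed (use ring_axioms in \<open>simp_all add: regular_module_def l_distr r_distr m_assoc left_module_axioms_def\<close>)

sublocale osc_params \<subseteq> reg: osc_module q C0 "regular_module (osc_algebra q C0)"
  by (intro osc_module.intro osc_params_axioms ring.left_module_regular ring_A)

context osc_params
begin

lemma reg_carrier: "carrier (regular_module A) = range cls"
  by (simp add: regular_module_def A_simps)

lemma reg_act: "reg.act p (cls p') = cls (p * p')"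
  unfolding reg.act_def by (simp add: regular_module_def A_simps)

text \<open>Identities between elements of the algebra are proved by letting both sides act on the regular
  module, where the commutation rules rewrite iterated actions of the generators.\<close>

lemma mem_I_by_action:
  assumes "\<And>x. x \<in> carrier (regular_module A) \<Longrightarrow> reg.act p x = reg.act p' x"
  shows "p - p' \<in> I"
  using assms[of "cls 1"] by (simp add: reg_carrier reg_act flip: pres_class_eq_iff)

end

section \<open>The weight-zero part of the quantum group\<close>

text \<open>Representatives of the subalgebra of all elements of the quantum group that commute with \<open>K\<close>,
  see \<open>weight_zero_if_commutes_K\<close>.\<close>

inductive_set weight_zero :: "(osc_gen, 'k::field) free_elt set" where
  const: "const c \<in> weight_zero"
| K: "lK \<in> weight_zero"
| Kinv: "lK' \<in> weight_zero"
| FE: "lF * lE \<in> weight_zero"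
| add: "u \<in> weight_zero \<Longrightarrow> v \<in> weight_zero \<Longrightarrow> u + v \<in> weight_zero"
| mult: "u \<in> weight_zero \<Longrightarrow> v \<in> weight_zero \<Longrightarrow> u * v \<in> weight_zero"

lemma weight_zero_minus: "u \<in> weight_zero \<Longrightarrow> v \<in> weight_zero \<Longrightarrow> u - v \<in> weight_zero"
  using weight_zero.add[of u "const (- 1) * v"] weight_zero.mult[OF weight_zero.const[of "- 1"], of v]
  by (simp add: const_minus)

fun uq_degree :: "uq_gen \<Rightarrow> int" where
  "uq_degree Gen_E = 1" | "uq_degree Gen_F = - 1" | "uq_degree Gen_K = 0" | "uq_degree Gen_K_inv = 0"

fun gen_degree :: "osc_gen \<Rightarrow> int" where
  "gen_degree (Uq_gen g) = 2 * uq_degree g" | "gen_degree Gen_X = 1" | "gen_degree Gen_Y = - 1"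

text \<open>The standard vector of degree \<open>d\<close>: a power of \<open>E\<close> for \<open>d \<ge> 0\<close> and a power of \<open>F\<close> for
  \<open>d \<le> 0\<close>.\<close>

definition epow :: "int \<Rightarrow> (osc_gen, 'k::field) free_elt" where
  "epow d = (if d \<ge> 0 then lE ^ nat d else lF ^ nat (- d))"

lemma epow_simps:
  shows "d \<ge> 0 \<Longrightarrow> epow (d + 1) = lE * epow d"
    and "d < 0 \<Longrightarrow> epow d = lF * epow (d + 1)"
    and "d \<le> 0 \<Longrightarrow> epow (d - 1) = lF * epow d"
    and "d > 0 \<Longrightarrow> epow d = lE * epow (d - 1)"
    and "epow 0 = 1"
proof -
  show "epow d = lF * epow (d + 1)" if "d < 0"
  proof -
    have "nat (- d) = Suc (nat (- (d + 1)))" using that by simp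
    then show ?thesis using that by (cases "d = - 1") (simp_all add: epow_def)
  qed
  show "epow (d - 1) = lF * epow d" if "d \<le> 0"
  proof -
    have "nat (- (d - 1)) = Suc (nat (- d))" using that by simp
    then show ?thesis using that by (cases "d = 0") (simp_all add: epow_def)
  qed
  show "epow (d + 1) = lE * epow d" if "d \<ge> 0"
    using that by (simp add: epow_def nat_add_distrib)
  show "epow d = lE * epow (d - 1)" if "d > 0"
  proof -
    have "nat d = Suc (nat (d - 1))" using that by simp
    then show ?thesis using that by (simp add: epow_def)
  qed
  show "epow 0 = 1" by (simp add: epow_def)
qed

lemma (in osc_module) K_word:
  assumes x: "x \<in> carrier M"
  shows "act lK (act (Poly_Mapping.single (Word gs) c) x) =
    sc (q powi (\<Sum>g\<leftarrow>gs. gen_degree g)) (act (Poly_Mapping.single (Word gs) c) (act lK x))"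
proof (induction gs)
  case Nil
  then show ?case using x by (simp add: single_Nil act_letter_sc)
next
  case (Cons g gs)
  let ?p = "Poly_Mapping.single (Word gs) c" and ?d = "\<Sum>g\<leftarrow>gs. gen_degree g"
  have "act lK (act (letter g) y) = sc (q powi gen_degree g) (act (letter g) (act lK y))"
    if "y \<in> carrier M" for y
  proof (cases g)
    case (Uq_gen h)
    then show ?thesis using that by (cases h) (simp_all add: K_past power_int_minus)
  qed (use that in \<open>simp_all add: K_past power_int_minus\<close>)
  then have "act lK (act (letter g * ?p) x) = sc (q powi gen_degree g) (act (letter g) (act lK (act ?p x)))"
    using x by (simp add: act_mult)
  also have "\<dots> = sc (q powi gen_degree g * q powi ?d) (act (letter g) (act ?p (act lK x)))"
    using x by (simp add: Cons.IH act_letter_sc sc_sc)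
  also have "q powi gen_degree g * q powi ?d = q powi (gen_degree g + ?d)"
    using q_nonzero by (simp add: power_int_add)
  finally show ?case using x by (simp add: single_Cons act_mult)
qed

context osc_params
begin

lemma q_powi_inj: "q powi a = q powi b \<longleftrightarrow> a = b"
proof
  have *: "a = b" if "a \<le> b" "q powi a = q powi b" for a b
  proof (rule ccontr)
    assume "a \<noteq> b"
    have "q powi b = q powi a * q powi (b - a)" using q_nonzero by (simp flip: power_int_add)
    then have "q powi (b - a) = 1" using that q_nonzero by simp
    then have "q ^ nat (b - a) = 1" using that by (simp add: power_int_def)
    then show False using q_not_root that \<open>a \<noteq> b\<close> by simp
  qed
  assume "q powi a = q powi b"
  then show "a = b" using *[of a b] *[of b a] by (cases "a \<le> b") auto
qed simp

abbreviation "RM \<equiv> regular_module A"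

text \<open>Moving \<open>E\<close> past \<open>F E\<close> produces \<open>E F\<close>, which differs from \<open>F E\<close> by a polynomial in \<open>K\<close> and
  its inverse; so \<open>E\<close> can be moved to the right of the whole subalgebra.\<close>

lemma shift_E:
  "u \<in> weight_zero \<Longrightarrow> \<exists>u'\<in>weight_zero. \<forall>x\<in>carrier RM. reg.act lE (reg.act u x) = reg.act u' (reg.act lE x)"
proof (induction rule: weight_zero.induct)
  case (const c)
  show ?case by (intro bexI[OF _ weight_zero.const[of c]]) (simp add: reg.act_letter_sc)
next
  case K
  show ?case
    by (rule bexI[of _ "const (inverse (q ^ 2)) * lK"])
      (simp_all add: reg.act_mult reg.K_past reg.sc_sc q_nonzero weight_zero.intros)
next
  case Kinv
  show ?case
    by (rule bexI[of _ "const (q ^ 2) * lK'"])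
      (simp_all add: reg.act_mult reg.Kinv_past reg.sc_sc q_nonzero weight_zero.intros)
next
  case FE
  show ?case
    by (rule bexI[of _ "lF * lE + const (inverse (q - inverse q)) * (lK - lK')"])
      (simp_all add: reg.act_mult reg.act_add reg.act_minus reg.E_F weight_zero.intros weight_zero_minus)
next
  case (add u v)
  then obtain u' v' where "u' \<in> weight_zero" "v' \<in> weight_zero"
    "\<forall>x\<in>carrier RM. reg.act lE (reg.act u x) = reg.act u' (reg.act lE x)"
    "\<forall>x\<in>carrier RM. reg.act lE (reg.act v x) = reg.act v' (reg.act lE x)" by blast
  then show ?case
    by (intro bexI[of _ "u' + v'"]) (simp_all add: reg.act_add reg.act_plus_right weight_zero.add)
next
  case (mult u v)
  then obtain u' v' where "u' \<in> weight_zero" "v' \<in> weight_zero"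
    "\<forall>x\<in>carrier RM. reg.act lE (reg.act u x) = reg.act u' (reg.act lE x)"
    "\<forall>x\<in>carrier RM. reg.act lE (reg.act v x) = reg.act v' (reg.act lE x)" by blast
  then show ?case
    by (intro bexI[of _ "u' * v'"]) (simp_all add: reg.act_mult weight_zero.mult)
qed

text \<open>Replacing \<open>F E\<close> in \<open>F (F E)\<close> by \<open>E F\<close> costs a combination of \<open>F K\<close> and of \<open>F\<close> times the inverse
  of \<open>K\<close>; moving these to the left of \<open>F\<close> brings in the powers of \<open>q\<close> of the witness.\<close>

lemma shift_F:
  "u \<in> weight_zero \<Longrightarrow> \<exists>u'\<in>weight_zero. \<forall>x\<in>carrier RM. reg.act lF (reg.act u x) = reg.act u' (reg.act lF x)"
proof (induction rule: weight_zero.induct)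
  case (const c)
  show ?case by (intro bexI[OF _ weight_zero.const[of c]]) (simp add: reg.act_letter_sc)
next
  case K
  show ?case
    by (rule bexI[of _ "const (q ^ 2) * lK"])
      (simp_all add: reg.act_mult reg.K_past reg.sc_sc q_nonzero weight_zero.intros)
next
  case Kinv
  show ?case
    by (rule bexI[of _ "const (inverse (q ^ 2)) * lK'"])
      (simp_all add: reg.act_mult reg.Kinv_past reg.sc_sc q_nonzero weight_zero.intros)
next
  case FE
  let ?h = "inverse (q - inverse q)"
  let ?u = "lF * lE - const ?h * (const (q ^ 2) * lK - const (inverse (q ^ 2)) * lK')"
  have "reg.act lF (reg.act (lF * lE) x) = reg.act ?u (reg.act lF x)" if x: "x \<in> carrier RM" for x
  proof -
    let ?b = "reg.sc ?h (reg.act lF (reg.act lK x) \<ominus>\<^bsub>RM\<^esub> reg.act lF (reg.act lK' x))"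
    have "reg.act ?u (reg.act lF x) = reg.act lF (reg.act lE (reg.act lF x)) \<ominus>\<^bsub>RM\<^esub> ?b"
      using x by (simp add: reg.act_mult reg.act_minus reg.K_past reg.Kinv_past reg.sc_sc q_nonzero)
    also have "reg.act lF (reg.act lE (reg.act lF x)) = reg.act lF (reg.act lF (reg.act lE x)) \<oplus>\<^bsub>RM\<^esub> ?b"
      using x by (simp add: reg.E_F reg.act_plus_right reg.act_letter_sc reg.act_minus_right)
    also have "(reg.act lF (reg.act lF (reg.act lE x)) \<oplus>\<^bsub>RM\<^esub> ?b) \<ominus>\<^bsub>RM\<^esub> ?b = reg.act lF (reg.act lF (reg.act lE x))"
      using x by (simp add: reg.M.minus_eq reg.M.a_assoc reg.M.r_neg)
    finally show ?thesis using x by (simp add: reg.act_mult)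
  qed
  moreover have "?u \<in> weight_zero" by (intro weight_zero_minus weight_zero.intros)
  ultimately show ?case by blast
next
  case (add u v)
  then obtain u' v' where "u' \<in> weight_zero" "v' \<in> weight_zero"
    "\<forall>x\<in>carrier RM. reg.act lF (reg.act u x) = reg.act u' (reg.act lF x)"
    "\<forall>x\<in>carrier RM. reg.act lF (reg.act v x) = reg.act v' (reg.act lF x)" by blast
  then show ?case
    by (intro bexI[of _ "u' + v'"]) (simp_all add: reg.act_add reg.act_plus_right weight_zero.add)
next
  case (mult u v)
  then obtain u' v' where "u' \<in> weight_zero" "v' \<in> weight_zero"
    "\<forall>x\<in>carrier RM. reg.act lF (reg.act u x) = reg.act u' (reg.act lF x)"
    "\<forall>x\<in>carrier RM. reg.act lF (reg.act v x) = reg.act v' (reg.act lF x)" by blast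
  then show ?case
    by (intro bexI[of _ "u' * v'"]) (simp_all add: reg.act_mult weight_zero.mult)
qed

lemma weight_zero_commute_generators:
  assumes "u \<in> weight_zero" "x \<in> carrier RM"
  shows "reg.act lK (reg.act u x) = reg.act u (reg.act lK x)"
    and "reg.act lK' (reg.act u x) = reg.act u (reg.act lK' x)"
    and "reg.act lF (reg.act lE (reg.act u x)) = reg.act u (reg.act lF (reg.act lE x))"
  using assms
  by (induction arbitrary: x rule: weight_zero.induct)
    (simp_all add: reg.act_letter_sc reg.act_mult reg.act_add reg.act_plus_right
      reg.K_past reg.Kinv_past reg.sc_sc q_nonzero)

text \<open>The three generators commute with each other, because \<open>K\<close> scales \<open>E\<close> and \<open>F\<close> by inverse
  factors.\<close>

lemma weight_zero_commute:
  assumes u: "u \<in> weight_zero" and v: "v \<in> weight_zero" and x: "x \<in> carrier RM"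
  shows "reg.act v (reg.act u x) = reg.act u (reg.act v x)"
  using v x
  by (induction arbitrary: x rule: weight_zero.induct)
    (simp_all add: reg.act_sc reg.act_mult reg.act_add reg.act_plus_right
      weight_zero_commute_generators[OF u])

text \<open>By induction on the word: a new letter \<open>E\<close> or \<open>F\<close> is moved past the polynomial \<open>u\<close>, and then
  either lengthens the power of the same letter or meets a power of the other one, where
  \<open>E F\<close> and \<open>F E\<close> are absorbed into the polynomial.\<close>

lemma word_normal_form:
  "\<exists>u\<in>weight_zero. \<forall>x\<in>carrier RM. reg.act (Poly_Mapping.single (Word (map Uq_gen gs)) 1) x =
     reg.act u (reg.act (epow (\<Sum>g\<leftarrow>gs. uq_degree g)) x)"
proof (induction gs)
  case Nil
  then show ?case by (intro bexI[of _ 1]) (simp_all add: single_Nil epow_simps weight_zero.const[of 1, simplified])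
next
  case (Cons g gs)
  let ?h = "inverse (q - inverse q)"
  define d where "d = (\<Sum>g\<leftarrow>gs. uq_degree g)"
  obtain u where u: "u \<in> weight_zero"
    "\<forall>x\<in>carrier RM. reg.act (Poly_Mapping.single (Word (map Uq_gen gs)) 1) x = reg.act u (reg.act (epow d) x)"
    using Cons.IH unfolding d_def by blast
  have *: ?case if v: "v \<in> weight_zero" "\<And>x. x \<in> carrier RM \<Longrightarrow>
    reg.act (letter (Uq_gen g)) (reg.act u (reg.act (epow d) x)) = reg.act v (reg.act (epow (uq_degree g + d)) x)" for v
    using v u(2) by (intro bexI[of _ v]) (simp_all add: single_Cons reg.act_mult d_def)
  show ?case
  proof (cases g)
    case Gen_E
    obtain u' where u': "u' \<in> weight_zero" "\<forall>x\<in>carrier RM. reg.act lE (reg.act u x) = reg.act u' (reg.act lE x)"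
      using shift_E[OF u(1)] by blast
    show ?thesis
    proof (cases "d \<ge> 0")
      case True
      then show ?thesis using u' Gen_E by (intro *[of u']) (simp_all add: epow_simps reg.act_mult add.commute[of 1])
    next
      case False
      then show ?thesis using u' Gen_E
        by (intro *[of "u' * (lF * lE + const ?h * (lK - lK'))"])
          (simp_all add: epow_simps(2)[of d] reg.act_mult reg.act_add reg.act_minus reg.E_F add.commute[of 1]
            weight_zero.intros weight_zero_minus)
    qed
  next
    case Gen_F
    obtain u' where u': "u' \<in> weight_zero" "\<forall>x\<in>carrier RM. reg.act lF (reg.act u x) = reg.act u' (reg.act lF x)"
      using shift_F[OF u(1)] by blast
    show ?thesis
    proof (cases "d \<le> 0")
      case True
      then show ?thesis using u' Gen_F by (intro *[of u']) (simp_all add: epow_simps(3) reg.act_mult)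
    next
      case False
      then show ?thesis using u' Gen_F
        by (intro *[of "u' * (lF * lE)"])
          (simp_all add: epow_simps(4)[of d] reg.act_mult weight_zero.intros)
    qed
  next
    case Gen_K
    then show ?thesis using u by (intro *[of "lK * u"]) (simp_all add: reg.act_mult weight_zero.intros)
  next
    case Gen_K_inv
    then show ?thesis using u by (intro *[of "lK' * u"]) (simp_all add: reg.act_mult weight_zero.intros)
  qed
qed

lemma I_minus: "p \<in> I \<Longrightarrow> p' \<in> I \<Longrightarrow> p - p' \<in> I"
  using genideal_add[of p _ "- 1 * p'"] genideal_mult_left[of p' _ "- 1"] by simp

lemma I_sum: "(\<And>w. w \<in> W \<Longrightarrow> g w \<in> I) \<Longrightarrow> sum g W \<in> I"
  by (induction W rule: infinite_finite_induct) (simp_all add: genideal_zero genideal_add)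

lemma I_const_cancel: "a \<noteq> 0 \<Longrightarrow> const a * p \<in> I \<Longrightarrow> p \<in> I"
  using genideal_mult_left[of "const a * p" _ "const (inverse a)"]
  by (simp add: mult.assoc[symmetric] const_mult[symmetric])

lemma eigenvector_scale:
  "lK * (const b * z) - const a * (const b * z) * lK = const b * (lK * z - const a * z * lK)"
proof -
  have "lK * (const b * z) = const b * (lK * z)" by (simp only: mult.assoc[symmetric] const_commute[of b lK])
  moreover have "const a * (const b * z) = const b * (const a * z)"
    by (simp only: mult.assoc[symmetric] const_commute[of a "const b"])
  ultimately show ?thesis by (simp add: right_diff_distrib mult.assoc)
qed

text \<open>Conjugation by \<open>K\<close> has different eigenvalues \<open>e d\<close> on the \<open>z d\<close>. Subtracting \<open>e a\<close> times the
  sum from the conjugated sum eliminates the summand \<open>z a\<close> and rescales the others by nonzero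
  factors.\<close>

lemma eigenvector_components:
  assumes "finite D" "inj_on e D"
    and "\<And>d. d \<in> D \<Longrightarrow> lK * z d - const (e d) * z d * lK \<in> I" and "sum z D \<in> I"
  shows "\<forall>d\<in>D. z d \<in> I"
  using assms
proof (induction D arbitrary: z)
  case (insert a D)
  define y where "y d = const (e d - e a) * z d" for d
  have Kz: "lK * z d - const (e d) * z d * lK \<in> I" if "d \<in> insert a D" for d
    using insert.prems(2)[OF that] .
  have "\<forall>d\<in>D. y d \<in> I"
  proof (rule insert.IH)
    show "inj_on e D" using insert.prems by simp
    show "lK * y d - const (e d) * y d * lK \<in> I" if "d \<in> D" for d
    proof -
      have "lK * y d - const (e d) * y d * lK = const (e d - e a) * (lK * z d - const (e d) * z d * lK)"
        unfolding y_def by (rule eigenvector_scale)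
      then show ?thesis using Kz[of d] that by (simp add: genideal_mult_left)
    qed
    let ?s = "sum z (insert a D)"
    have *: "lK * z d - const (e a) * z d * lK
      = (lK * z d - const (e d) * z d * lK) + const (e d - e a) * z d * lK" for d
      by (simp add: const_diff left_diff_distrib)
    have "lK * ?s - const (e a) * ?s * lK = (\<Sum>d\<in>insert a D. lK * z d - const (e a) * z d * lK)"
      by (simp only: sum_distrib_left sum_distrib_right sum_subtractf)
    also have "\<dots> = (\<Sum>d\<in>insert a D. (lK * z d - const (e d) * z d * lK) + const (e d - e a) * z d * lK)"
      by (simp only: *)
    also have "\<dots> = (\<Sum>d\<in>insert a D. lK * z d - const (e d) * z d * lK) + sum y D * lK"
      using insert.hyps by (simp add: sum.distrib y_def sum_distrib_right)
    finally have "sum y D * lK = (lK * ?s - const (e a) * ?s * lK) - (\<Sum>d\<in>insert a D. lK * z d - const (e d) * z d * lK)"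
      by (simp add: algebra_simps)
    also have "\<dots> \<in> I"
      by (intro I_minus[OF I_minus[OF genideal_mult_left[OF insert.prems(3)]
          genideal_mult_right[OF genideal_mult_left[OF insert.prems(3)]]]] I_sum Kz)
    finally have "sum y D * lK * lK' \<in> I" by (rule genideal_mult_right)
    moreover have "sum y D * (lK * lK' - 1) \<in> I"
      by (intro genideal_mult_left genideal_generator osc_relation_members)
    ultimately have "sum y D * lK * lK' - sum y D * (lK * lK' - 1) \<in> I" by (rule I_minus)
    then show "sum y D \<in> I" by (simp add: algebra_simps)
  qed
  moreover have "e d - e a \<noteq> 0" if "d \<in> D" for d using inj_onD[OF insert.prems(1), of d a] insert.hyps that by auto
  ultimately have zD: "\<forall>d\<in>D. z d \<in> I" unfolding y_def using I_const_cancel by blast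
  then have "sum z (insert a D) - sum z D \<in> I" using zD by (intro I_minus[OF insert.prems(3)] I_sum) blast
  then have "z a \<in> I" using insert.hyps by simp
  then show ?case using zD by simp
qed simp

lemma free_map_uq_ideal:
  assumes "p \<in> Idl\<^bsub>free_algebra\<^esub> (uq_relations q)" shows "free_map Uq_gen p \<in> I"
proof -
  have "Idl\<^bsub>free_algebra\<^esub> (uq_relations q) \<subseteq> {p. free_map Uq_gen p \<in> I}"
  proof (rule genideal_least)
    show "uq_relations q \<subseteq> {p. free_map Uq_gen p \<in> I}"
      by (auto simp: osc_relations_def Let_def intro: genideal_generator)
    show "0 \<in> {p. free_map Uq_gen p \<in> I}"
      using genideal_zero free_map_const[of Uq_gen "0 :: 'k"] by simp
  qed (simp_all add: free_map_add free_map_mult genideal_add genideal_mult_left genideal_mult_right)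
  then show ?thesis using assms by blast
qed

text \<open>\<open>C0'\<close> is a class of the presented algebra, so its elements \<open>c\<close> are the representatives of a
  central element.\<close>

lemma central_commutes_K:
  assumes C0: "C0' \<in> ring_center (uq_sl2 q)" and c: "c \<in> C0'"
  shows "lK * free_map Uq_gen c - free_map Uq_gen c * lK \<in> I"
proof -
  let ?P = "uq_relations q"
  note simps = presented_algebra_simps[of ?P, folded uq_sl2_def]
  have cen: "C0' \<in> carrier (uq_sl2 q)" "\<And>x. x \<in> carrier (uq_sl2 q) \<Longrightarrow> C0' \<otimes>\<^bsub>uq_sl2 q\<^esub> x = x \<otimes>\<^bsub>uq_sl2 q\<^esub> C0'"
    using C0 by (auto simp: ring_center_def)
  then obtain p where p: "C0' = pres_class ?P p" by (auto simp: simps)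
  then have "C0' = pres_class ?P c" using mem_pres_class[of c ?P p] c by simp
  then have "pres_class ?P (letter Gen_K * c) = pres_class ?P (c * letter Gen_K)"
    using cen(2)[of "pres_class ?P (letter Gen_K)"] by (simp add: simps)
  from free_map_uq_ideal[OF pres_class_eq_iff[THEN iffD1, OF this]]
  show ?thesis by (simp add: free_map_minus free_map_mult free_map_letter)
qed

lemma sum_weight_zero:
  assumes "finite W" "\<And>w. w \<in> W \<Longrightarrow> \<exists>u\<in>weight_zero. g w - u \<in> I"
  shows "\<exists>u\<in>weight_zero. sum g W - u \<in> I"
  using assms
proof (induction W)
  case empty
  then show ?case by (intro bexI[of _ 0]) (use weight_zero.const[of 0] in \<open>simp_all add: genideal_zero\<close>)
next
  case (insert w W)
  then obtain u v where uv: "u \<in> weight_zero" "v \<in> weight_zero" "g w - u \<in> I" "sum g W - v \<in> I" by blast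
  have "g w + sum g W - (u + v) \<in> I" using genideal_add[OF uv(3,4)] by (simp add: algebra_simps)
  then have "sum g (insert w W) - (u + v) \<in> I" using insert.hyps by simp
  then show ?case using weight_zero.add[OF uv(1,2)] by blast
qed

text \<open>An element \<open>c\<close> of the quantum group is a sum of parts of degrees \<open>d\<close>, on which conjugation by
  \<open>K\<close> acts as \<open>q\<close> to the power \<open>2 d\<close>. These factors are distinct, as \<open>q\<close> is not a root of unity.
  If \<open>c\<close> commutes with \<open>K\<close>, only the part of degree 0 survives, and by the normal form of words
  that part is a polynomial in \<open>F E\<close>, \<open>K\<close> and the inverse of \<open>K\<close>.\<close>

lemma weight_zero_if_commutes_K:
  assumes c: "lK * free_map Uq_gen c - free_map Uq_gen c * lK \<in> I"
  shows "\<exists>u\<in>weight_zero. free_map Uq_gen c - u \<in> I"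
proof -
  define z where "z = free_map Uq_gen c"
  define deg where "deg w = (case w of Word gs \<Rightarrow> \<Sum>g\<leftarrow>gs. uq_degree g)" for w
  define g :: "_ \<Rightarrow> (osc_gen, 'k) free_elt" where "g w = Poly_Mapping.single (map_word Uq_gen w) (Poly_Mapping.lookup c w)" for w
  define D where "D = deg ` Poly_Mapping.keys c"
  define zd where "zd d = (\<Sum>w\<in>{w \<in> Poly_Mapping.keys c. deg w = d}. g w)" for d
  define e where "e d = q powi (2 * d)" for d :: int
  have finD: "finite D" by (simp add: D_def)
  have z: "z = sum zd D"
    unfolding z_def zd_def D_def free_map_def g_def[symmetric] by (rule sum.image_gen) simp
  have Kg: "lK * g w - const (e (deg w)) * g w * lK \<in> I" for w
  proof (rule mem_I_by_action)
    fix x assume x: "x \<in> carrier RM"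
    obtain gs where w: "w = Word gs" by (cases w)
    have "(\<Sum>h\<leftarrow>map Uq_gen gs. gen_degree h) = 2 * deg w"
      unfolding w deg_def by (induction gs) simp_all
    then show "reg.act (lK * g w) x = reg.act (const (e (deg w)) * g w * lK) x"
      using reg.K_word[OF x, of "map Uq_gen gs" "Poly_Mapping.lookup c w"] x
      by (simp add: w g_def e_def reg.act_mult)
  qed
  have Kz: "lK * zd d - const (e d) * zd d * lK \<in> I" for d
  proof -
    have "lK * zd d - const (e d) * zd d * lK
      = (\<Sum>w\<in>{w \<in> Poly_Mapping.keys c. deg w = d}. lK * g w - const (e (deg w)) * g w * lK)"
      unfolding zd_def by (simp add: sum_distrib_left sum_distrib_right sum_subtractf)
    also have "\<dots> \<in> I" by (rule I_sum) (rule Kg)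
    finally show ?thesis .
  qed
  define y where "y d = const (e d - 1) * zd d" for d
  have "\<forall>d\<in>D. y d \<in> I"
  proof (rule eigenvector_components[OF finD])
    show "inj_on e D" by (simp add: inj_on_def e_def q_powi_inj)
    show "lK * y d - const (e d) * y d * lK \<in> I" for d
    proof -
      have "lK * y d - const (e d) * y d * lK = const (e d - 1) * (lK * zd d - const (e d) * zd d * lK)"
        unfolding y_def by (rule eigenvector_scale)
      then show ?thesis using Kz[of d] by (simp add: genideal_mult_left)
    qed
    have *: "(lK * zd d - zd d * lK) - (lK * zd d - const (e d) * zd d * lK) = y d * lK" for d
      by (simp add: y_def const_diff left_diff_distrib)
    \<comment> \<open>The factor \<open>e d - 1\<close> in \<open>y\<close> measures by how much the part of degree \<open>d\<close> fails to commute
      with \<open>K\<close>.\<close>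
    have "sum y D * lK = (\<Sum>d\<in>D. (lK * zd d - zd d * lK) - (lK * zd d - const (e d) * zd d * lK))"
      by (simp only: * sum_distrib_right)
    also have "\<dots> = (\<Sum>d\<in>D. lK * zd d - zd d * lK) - (\<Sum>d\<in>D. lK * zd d - const (e d) * zd d * lK)"
      by (rule sum_subtractf)
    finally have eq: "sum y D * lK
      = (\<Sum>d\<in>D. lK * zd d - zd d * lK) - (\<Sum>d\<in>D. lK * zd d - const (e d) * zd d * lK)" .
    have "(\<Sum>d\<in>D. lK * zd d - zd d * lK) = lK * z - z * lK"
      unfolding z by (simp only: sum_subtractf sum_distrib_left sum_distrib_right)
    then have "sum y D * lK \<in> I"
      unfolding eq using c by (intro I_minus[OF _ I_sum[OF Kz]]) (simp add: z_def)
    then have "sum y D * lK * lK' \<in> I" by (rule genideal_mult_right)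
    moreover have "sum y D * (lK * lK' - 1) \<in> I"
      by (intro genideal_mult_left genideal_generator osc_relation_members)
    ultimately have "sum y D * lK * lK' - sum y D * (lK * lK' - 1) \<in> I" by (rule I_minus)
    then show "sum y D \<in> I" by (simp add: algebra_simps)
  qed
  moreover have "e d - 1 \<noteq> 0" if "d \<noteq> 0" for d
    using q_powi_inj[of "2 * d" 0] that by (simp add: e_def)
  ultimately have "zd d \<in> I" if "d \<in> D" "d \<noteq> 0" for d
    using that I_const_cancel unfolding y_def by blast
  then have "sum zd (D - {0}) \<in> I" by (intro I_sum) blast
  moreover have "z - zd 0 = sum zd (D - {0})"
  proof (cases "0 \<in> D")
    case True
    then show ?thesis using finD by (simp add: z sum_diff1)
  next
    case False
    then have "zd 0 = 0" by (auto simp: zd_def D_def intro!: sum.neutral)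
    then show ?thesis using False by (simp add: z)
  qed
  ultimately have z0: "z - zd 0 \<in> I" by simp
  have "\<exists>u\<in>weight_zero. zd 0 - u \<in> I"
    unfolding zd_def
  proof (rule sum_weight_zero)
    fix w assume "w \<in> {w \<in> Poly_Mapping.keys c. deg w = 0}"
    then obtain gs where w: "w = Word gs" "(\<Sum>g\<leftarrow>gs. uq_degree g) = 0"
      by (cases w) (auto simp: deg_def)
    obtain u where u: "u \<in> weight_zero"
      "\<forall>x\<in>carrier RM. reg.act (Poly_Mapping.single (Word (map Uq_gen gs)) 1) x = reg.act u x"
      using word_normal_form[of gs] w(2) by (auto simp: epow_simps)
    have gw: "g w = const (Poly_Mapping.lookup c w) * Poly_Mapping.single (Word (map Uq_gen gs)) 1"
      by (simp add: g_def w const_mult_single)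
    have "g w - const (Poly_Mapping.lookup c w) * u \<in> I"
      unfolding gw by (rule mem_I_by_action) (simp add: reg.act_mult u(2))
    then show "\<exists>u\<in>weight_zero. g w - u \<in> I"
      using weight_zero.mult[OF weight_zero.const u(1)] by blast
  qed simp
  then obtain u where u: "u \<in> weight_zero" "zd 0 - u \<in> I" by blast
  have "z - u = (z - zd 0) + (zd 0 - u)" by simp
  then show ?thesis using u genideal_add[OF z0 u(2)] by (auto simp: z_def)
qed

end

section \<open>The anti-involution\<close>

text \<open>The factors \<open>K\<close> and the signs in the images of \<open>E\<close> and \<open>F\<close> are dictated by the relations
  \<open>E Y = X + q\<^sup>-\<^sup>1 Y E\<close> and \<open>F X = Y K\<^sup>-\<^sup>1 + X F\<close>, which have to be exchanged when \<open>X\<close> and \<open>Y\<close> are.\<close>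

fun iota_gen :: "osc_gen \<Rightarrow> (osc_gen, 'k::field) free_elt" where
  "iota_gen (Uq_gen Gen_E) = - (lF * lK)"
| "iota_gen (Uq_gen Gen_F) = - (lK' * lE)"
| "iota_gen (Uq_gen Gen_K) = lK"
| "iota_gen (Uq_gen Gen_K_inv) = lK'"
| "iota_gen Gen_X = lY"
| "iota_gen Gen_Y = lX"

definition iota :: "(osc_gen, 'k::field) free_elt \<Rightarrow> (osc_gen, 'k) free_elt" where
  "iota = linear_extension (\<lambda>w. case w of Word gs \<Rightarrow> prod_list (map iota_gen (rev gs)))"

lemma iota_add: "iota (p + p') = iota p + iota p'"
  by (simp add: iota_def linear_extension_add)

lemma iota_mult: "iota (p * p') = iota p' * iota p"
  unfolding iota_def
proof (rule linear_extension_mult_rev)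
  fix v w :: "osc_gen word"
  show "(case v + w of Word gs \<Rightarrow> prod_list (map iota_gen (rev gs))) =
    (case w of Word gs \<Rightarrow> prod_list (map iota_gen (rev gs))) * (case v of Word gs \<Rightarrow> prod_list (map iota_gen (rev gs)))"
    by (cases v; cases w) simp
qed

lemma iota_const [simp]: "iota (const c) = const c"
  unfolding iota_def by (rule linear_extension_const) (simp add: zero_word_def)

lemma iota_1 [simp]: "iota 1 = 1" and iota_0 [simp]: "iota 0 = 0"
  using iota_const[of 1] iota_const[of 0] by simp_all

lemma iota_letter [simp]: "iota (letter g) = iota_gen g"
  by (simp add: iota_def letter_def linear_extension_single)

lemma iota_minus: "iota (p - p') = iota p - iota p'"
  using iota_add[of "p - p'" p'] by (simp add: algebra_simps)

lemma iota_uminus: "iota (- p) = - iota p"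
  using iota_minus[of 0 p] by simp

context osc_params
begin

text \<open>On the generators \<open>F E\<close>, \<open>K\<close> and the inverse of \<open>K\<close> this is immediate, and on products the
  reversal of factors is harmless since the subalgebra is commutative.\<close>

lemma iota_weight_zero:
  assumes "u \<in> weight_zero" "x \<in> carrier RM"
  shows "reg.act (iota u) x = reg.act u x"
  using assms
proof (induction arbitrary: x rule: weight_zero.induct)
  case (mult u v)
  then show ?case by (simp add: iota_mult reg.act_mult weight_zero_commute)
qed (simp_all add: iota_add iota_mult reg.act_add reg.act_mult reg.act_uminus reg.act_neg_right)

lemmas reg_rules = iota_mult iota_add reg.act_mult reg.act_add reg.act_minus reg.act_uminus reg.act_neg_right
  reg.act_plus_right reg.act_minus_right reg.K_past reg.Kinv_past reg.sc_sc reg.act_letter_sc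
  reg.E_X reg.E_Y reg.F_X reg.F_Y reg.M.minus_add_cancel

lemma q_cancel: "inverse q * (q * a) = a" "q * (inverse q * a) = a"
  using q_nonzero by (simp_all flip: mult.assoc)

lemma iota_relations:
  shows "iota (lK * lK' - 1) \<in> I"
    and "iota (lK' * lK - 1) \<in> I"
    and "iota (lK * lE * lK' - const (q ^ 2) * lE) \<in> I"
    and "iota (lK * lF * lK' - const (inverse (q ^ 2)) * lF) \<in> I"
    and "iota (lE * lF - lF * lE - const (inverse (q - inverse q)) * (lK - lK')) \<in> I"
    and "iota (lE * lX - const q * lX * lE) \<in> I"
    and "iota (lE * lY - (lX + const (inverse q) * lY * lE)) \<in> I"
    and "iota (lF * lX - (lY * lK' + lX * lF)) \<in> I"
    and "iota (lF * lY - lY * lF) \<in> I"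
    and "iota (lK * lX * lK' - const q * lX) \<in> I"
    and "iota (lK * lY * lK' - const (inverse q) * lY) \<in> I"
proof -
  let ?h = "const (inverse (q - inverse q)) * (lK - lK')"
  have "iota (lE * lF) - iota (lF * lE + ?h) \<in> I"
    by (rule mem_I_by_action) (simp add: reg_rules iota_minus reg.E_F q_nonzero)
  then show "iota (lE * lF - lF * lE - ?h) \<in> I" by (simp add: iota_minus iota_add diff_diff_eq)
  show "iota (lE * lY - (lX + const (inverse q) * lY * lE)) \<in> I"
    unfolding iota_minus
  proof (rule mem_I_by_action)
    fix x assume x: "x \<in> carrier RM"
    show "reg.act (iota (lE * lY)) x = reg.act (iota (lX + const (inverse q) * lY * lE)) x"
      using x by (simp add: reg_rules q_nonzero reg.M.minus_add_cancel)
  qed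
qed (unfold iota_minus, (rule mem_I_by_action; simp add: reg_rules q_nonzero q_cancel)+)

text \<open>The ideal for the empty set in place of \<open>C0\<close> contains all relations except
  \<open>q Y X - X Y = C0\<close>.\<close>

lemma iota_ideal_no_C0:
  assumes "p \<in> Idl\<^bsub>free_algebra\<^esub> (osc_relations q {})" shows "iota p \<in> I"
proof -
  have "Idl\<^bsub>free_algebra\<^esub> (osc_relations q {}) \<subseteq> {p. iota p \<in> I}"
  proof (rule genideal_least)
    show "osc_relations q {} \<subseteq> {p. iota p \<in> I}"
      using iota_relations unfolding osc_relations_def Let_def uq_relations_def const_one[symmetric]
      by (simp add: free_map_minus free_map_mult free_map_letter free_map_const del: const_one)
  qed (simp_all add: iota_add iota_mult genideal_zero genideal_add genideal_mult_left genideal_mult_right)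
  then show ?thesis using assms by blast
qed

lemma ideal_no_C0: "Idl\<^bsub>free_algebra\<^esub> (osc_relations q {}) \<subseteq> I"
proof (rule genideal_least)
  show "osc_relations q {} \<subseteq> I" using genideal_generator[of _ "osc_relations q C0"]
    by (auto simp: osc_relations_def Let_def)
qed (simp_all add: genideal_zero genideal_add genideal_mult_left genideal_mult_right)

end

locale osc_central = osc_params q C0
  for q :: "'k::field" and C0 :: "(uq_gen, 'k) pres_elt" +
  assumes C0_central: "C0 \<in> ring_center (uq_sl2 q)"
begin

interpretation no_C0: osc_params q "{}"
  using q_nonzero q_not_root by unfold_locales

text \<open>It matters that the congruence holds modulo the smaller ideal: \<open>iota\<close> is already known to
  respect that one, and can therefore be applied to it in the next proof without circularity.\<close>

lemma C0_weight_zero: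
  assumes "c \<in> C0"
  shows "\<exists>u\<in>weight_zero. free_map Uq_gen c - u \<in> Idl\<^bsub>free_algebra\<^esub> (osc_relations q {})"
  by (rule no_C0.weight_zero_if_commutes_K[OF no_C0.central_commutes_K[OF C0_central assms]])

lemma iota_C0: 
  assumes "c \<in> C0" shows "iota (free_map Uq_gen c) - free_map Uq_gen c \<in> I"
proof -
  let ?z = "free_map Uq_gen c"
  obtain u where u: "u \<in> weight_zero" "?z - u \<in> Idl\<^bsub>free_algebra\<^esub> (osc_relations q {})"
    using C0_weight_zero[OF assms] by blast
  have a: "iota u - u \<in> I" by (rule mem_I_by_action) (rule iota_weight_zero[OF u(1)])
  have b: "iota (?z - u) \<in> I" by (rule iota_ideal_no_C0[OF u(2)])
  have "?z - u \<in> I" using u(2) ideal_no_C0 by blast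
  from I_minus[OF genideal_add[OF b a] this] show ?thesis by (simp add: iota_minus)
qed

lemma iota_ideal:
  assumes "p \<in> I" shows "iota p \<in> I"
proof -
  have "I \<subseteq> {p. iota p \<in> I}"
  proof (rule genideal_least)
    show "osc_relations q C0 \<subseteq> {p. iota p \<in> I}"
    proof
      fix r assume r: "r \<in> osc_relations q C0"
      show "r \<in> {p. iota p \<in> I}"
      proof (cases "r \<in> osc_relations q {}")
        case True
        then show ?thesis using iota_ideal_no_C0[OF genideal_generator] by blast
      next
        case False
        then obtain c where c: "c \<in> C0" "r = const q * lY * lX - lX * lY - free_map Uq_gen c"
          using r by (auto simp: osc_relations_def Let_def)
        have "iota r = r - (iota (free_map Uq_gen c) - free_map Uq_gen c)"
          unfolding c(2) by (simp add: iota_minus iota_mult const_commute mult.assoc)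
        then show ?thesis using I_minus[OF genideal_generator[OF r] iota_C0[OF c(1)]] by simp
      qed
    qed
  qed (simp_all add: iota_add iota_mult genideal_zero genideal_add genideal_mult_left genideal_mult_right)
  then show ?thesis using assms by blast
qed

lemma iota_iota: "iota (iota p) - p \<in> I"
proof (induction p rule: free_induct)
  case (letter g p)
  have "iota (iota (letter g)) - letter g \<in> I"
  proof (cases g)
    case (Uq_gen h)
    then show ?thesis
      by (cases h; intro mem_I_by_action) (simp_all add: reg_rules iota_uminus q_nonzero)
  qed (simp_all add: genideal_zero)
  then have "(iota (iota (letter g)) - letter g) * iota (iota p) + letter g * (iota (iota p) - p) \<in> I"
    using letter by (intro genideal_add genideal_mult_left genideal_mult_right)
  then show ?case by (simp add: iota_mult algebra_simps)
next
  case (add p p')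
  then show ?case using genideal_add[OF add] by (simp add: iota_add algebra_simps)
qed (simp add: genideal_zero)

end

section \<open>Weights\<close>

context osc_module
begin

lemma submodule_act: "submodule H A M \<Longrightarrow> x \<in> H \<Longrightarrow> act p x \<in> H"
  unfolding act_def by (rule submodule_smult) simp_all

lemma submodule_by_letters:
  assumes H: "H \<subseteq> carrier M" "\<zero>\<^bsub>M\<^esub> \<in> H" "\<And>x y. x \<in> H \<Longrightarrow> y \<in> H \<Longrightarrow> x \<oplus>\<^bsub>M\<^esub> y \<in> H"
    and sc: "\<And>c x. x \<in> H \<Longrightarrow> sc c x \<in> H" and letter: "\<And>g x. x \<in> H \<Longrightarrow> act (letter g) x \<in> H"
  shows "submodule H A M"
proof -
  have "act p x \<in> H" if x: "x \<in> H" for p x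
  proof -
    have "x \<in> carrier M" using H(1) x by (rule subsetD)
    then show ?thesis
      by (induction p rule: free_induct) (simp_all add: act_mult act_add H(3) sc letter x)
  qed
  then show ?thesis using H by (simp add: submodule_iff A_simps act_def[symmetric])
qed

lemma ground_eq: "osc_ground q C0 = A\<lparr>carrier := range (\<lambda>c. cls (const c))\<rparr>"
  by (simp add: osc_ground_def osc_scalar_def[abs_def])

lemma subring_ground: "subring (range (\<lambda>c. cls (const c))) A"
proof (rule ring.subringI[OF ring_A])
  show "h \<in> range (\<lambda>c. cls (const c)) \<Longrightarrow> \<ominus>\<^bsub>A\<^esub> h \<in> range (\<lambda>c. cls (const c))" for h
    by (auto simp: A_uminus simp flip: const_minus)
  show "\<one>\<^bsub>A\<^esub> \<in> range (\<lambda>c. cls (const c))" by (simp add: A_simps flip: const_one)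
qed (auto simp: A_simps simp flip: const_mult const_add)

end

sublocale osc_module \<subseteq> G: left_module "osc_ground q C0" M
  unfolding ground_eq by (rule left_module_subring[OF subring_ground])

context osc_module
begin

abbreviation "gsub H \<equiv> submodule H (osc_ground q C0) M"
abbreviation "gspan S \<equiv> submodule_span (osc_ground q C0) M S"
abbreviation "Wt r \<equiv> weight_space q C0 M r"

lemma gsub_iff:
  "gsub H \<longleftrightarrow> H \<subseteq> carrier M \<and> \<zero>\<^bsub>M\<^esub> \<in> H \<and> (\<forall>x\<in>H. \<forall>y\<in>H. x \<oplus>\<^bsub>M\<^esub> y \<in> H) \<and> (\<forall>c. \<forall>x\<in>H. sc c x \<in> H)"
  unfolding G.submodule_iff by (simp add: ground_eq act_def)

lemma gsubI:
  assumes "H \<subseteq> carrier M" "\<zero>\<^bsub>M\<^esub> \<in> H" "\<And>x y. x \<in> H \<Longrightarrow> y \<in> H \<Longrightarrow> x \<oplus>\<^bsub>M\<^esub> y \<in> H" "\<And>c x. x \<in> H \<Longrightarrow> sc c x \<in> H"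
  shows "gsub H"
  using assms by (simp add: gsub_iff)

lemma gsub_sc: "gsub H \<Longrightarrow> x \<in> H \<Longrightarrow> sc c x \<in> H"
  by (simp add: gsub_iff)

lemma gsub_if_submodule: "submodule H A M \<Longrightarrow> gsub H"
  by (intro gsubI subsetI) (auto intro: submodule_act submodule_add submodule_zero submodule_subset)

lemma Wt_iff: "x \<in> Wt r \<longleftrightarrow> x \<in> carrier M \<and> act lK x = sc r x"
  by (simp add: weight_space_def osc_gen_def osc_scalar_def act_def)

lemma Wt_carrier: "x \<in> Wt r \<Longrightarrow> x \<in> carrier M"
  by (simp add: Wt_iff)

lemma gsub_Wt: "gsub (Wt r)"
  by (rule gsubI) (auto simp: Wt_iff act_plus_right act_letter_sc sc_sc mult.commute)

lemma Wt_zero_trivial: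
  assumes "x \<in> Wt 0" shows "x = \<zero>\<^bsub>M\<^esub>"
proof -
  have x: "x \<in> carrier M" "act lK x = sc 0 x" using assms by (simp_all add: Wt_iff)
  have "act lK' (act lK x) = act lK' \<zero>\<^bsub>M\<^esub>" using x by simp
  then show ?thesis using x(1) by simp
qed

lemma act_word_Wt:
  assumes "x \<in> Wt r" shows "act (Poly_Mapping.single (Word gs) c) x \<in> Wt (q powi (\<Sum>g\<leftarrow>gs. gen_degree g) * r)"
  using assms K_word[of x gs c] act_sc[of x "Poly_Mapping.single (Word gs) c" r] by (simp add: Wt_iff sc_sc)

lemma act_letter_Wt: "x \<in> Wt r \<Longrightarrow> act (letter g) x \<in> Wt (q powi gen_degree g * r)"
  using act_word_Wt[of x r "[g]" 1] by (simp add: letter_def)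

lemma act_finsum: "finite \<Lambda> \<Longrightarrow> f \<in> \<Lambda> \<rightarrow> carrier M \<Longrightarrow> act p (finsum M f \<Lambda>) = finsum M (\<lambda>s. act p (f s)) \<Lambda>"
proof (induction \<Lambda> rule: finite_induct)
  case (insert a \<Lambda>)
  moreover have "(\<lambda>s. act p (f s)) \<in> \<Lambda> \<rightarrow> carrier M" "f \<in> \<Lambda> \<rightarrow> carrier M" "f a \<in> carrier M"
    using insert by (auto simp: Pi_iff)
  ultimately show ?case by (simp add: act_plus_right)
qed simp

lemma gsub_finsum:
  assumes H: "gsub H" shows "finite \<Lambda> \<Longrightarrow> (\<And>s. s \<in> \<Lambda> \<Longrightarrow> f s \<in> H) \<Longrightarrow> finsum M f \<Lambda> \<in> H"
proof (induction \<Lambda> rule: finite_induct)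
  case empty
  then show ?case using G.submodule_zero[OF H] by simp
next
  case (insert a \<Lambda>)
  moreover have "f \<in> \<Lambda> \<rightarrow> carrier M" "f a \<in> carrier M" using insert.prems G.submodule_subset[OF H] by auto
  ultimately show ?case using G.submodule_add[OF H] by simp
qed

text \<open>By induction on the number of summands: \<open>K - a\<close> annihilates the component of weight \<open>a\<close> and
  multiplies the others by nonzero scalars.\<close>

lemma weight_components:
  assumes H: "gsub H" and KH: "\<And>x. x \<in> H \<Longrightarrow> act lK x \<in> H"
  shows "finite \<Lambda> \<Longrightarrow> (\<And>s. s \<in> \<Lambda> \<Longrightarrow> f s \<in> Wt s) \<Longrightarrow> finsum M f \<Lambda> \<in> H \<Longrightarrow> s \<in> \<Lambda> \<Longrightarrow> f s \<in> H"
proof (induction \<Lambda> arbitrary: f s rule: finite_induct)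
  case (insert a \<Lambda>)
  have fc: "f s \<in> carrier M" if "s \<in> insert a \<Lambda>" for s using insert.prems(1)[OF that] by (rule Wt_carrier)
  have f: "f \<in> \<Lambda> \<rightarrow> carrier M" "f a \<in> carrier M" "f \<in> insert a \<Lambda> \<rightarrow> carrier M" using fc by auto
  have act: "act (lK - const a) x = sc (s - a) x" if "x \<in> Wt s" for x s
    using that by (simp add: Wt_iff act_minus const_diff)
  have y: "sc (s - a) (f s) \<in> H" if "s \<in> \<Lambda>" for s
  proof (rule insert.IH[OF _ _ that])
    show "sc (s - a) (f s) \<in> Wt s" if "s \<in> \<Lambda>" for s
      using insert.prems(1) that gsub_sc[OF gsub_Wt] by blast
    have "finsum M (\<lambda>s. sc (s - a) (f s)) (insert a \<Lambda>) = finsum M (\<lambda>s. act (lK - const a) (f s)) (insert a \<Lambda>)"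
      using insert.prems(1) fc by (intro M.finsum_cong') (auto simp: act[OF insert.prems(1)])
    also have "\<dots> = act (lK - const a) (finsum M f (insert a \<Lambda>))"
      using insert.hyps f by (intro act_finsum[symmetric]) auto
    also have "\<dots> \<in> H"
    proof -
      have "finsum M f (insert a \<Lambda>) \<in> carrier M" using G.submodule_subset[OF H insert.prems(2)] .
      then show ?thesis
        using G.submodule_minus[OF H KH[OF insert.prems(2)] gsub_sc[OF H insert.prems(2)]]
        by (simp only: act_minus)
    qed
    finally show "finsum M (\<lambda>s. sc (s - a) (f s)) \<Lambda> \<in> H"
      using insert.hyps f fc by (subst (asm) M.finsum_insert) auto
  qed
  have fs: "f s \<in> H" if "s \<in> \<Lambda>" for s
  proof -
    have "s - a \<noteq> 0" using that insert.hyps by auto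
    then have "f s = sc (inverse (s - a)) (sc (s - a) (f s))" using fc that by (simp add: sc_sc)
    then show ?thesis using gsub_sc[OF H y[OF that]] by metis
  qed
  have "finsum M f \<Lambda> \<in> H" by (rule gsub_finsum[OF H insert.hyps(1) fs])
  then have "finsum M f (insert a \<Lambda>) \<ominus>\<^bsub>M\<^esub> finsum M f \<Lambda> \<in> H" using insert.prems(2) by (intro G.submodule_minus[OF H])
  moreover have "finsum M f (insert a \<Lambda>) \<ominus>\<^bsub>M\<^esub> finsum M f \<Lambda> = f a"
    using insert.hyps f by (simp add: M.minus_eq M.a_assoc M.r_neg)
  ultimately have "f a \<in> H" by simp
  then show ?case using fs insert.prems(3) by blast
qed simp

text \<open>A decomposition into weight vectors is a function on all scalars, zero outside the finite set
  \<open>\<Lambda>\<close>, so that equality of decompositions is equality of functions.\<close>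

definition weight_sum :: "('k \<Rightarrow> 'm) \<Rightarrow> 'k set \<Rightarrow> 'm \<Rightarrow> bool" where
  "weight_sum f \<Lambda> x \<longleftrightarrow> finite \<Lambda> \<and> (\<forall>s. f s \<in> Wt s) \<and> (\<forall>s. s \<notin> \<Lambda> \<longrightarrow> f s = \<zero>\<^bsub>M\<^esub>) \<and> x = finsum M f \<Lambda>"

lemma weight_sum_extend:
  assumes "weight_sum f \<Lambda> x" "\<Lambda> \<subseteq> \<Lambda>'" "finite \<Lambda>'" shows "weight_sum f \<Lambda>' x"
proof -
  have "f \<in> UNIV \<rightarrow> carrier M" using assms(1) Wt_carrier by (auto simp: weight_sum_def)
  then have "finsum M f \<Lambda> = finsum M f \<Lambda>'"
    using assms by (intro M.add.finprod_mono_neutral_cong_left) (auto simp: weight_sum_def)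
  then show ?thesis using assms by (auto simp: weight_sum_def)
qed

lemma weight_sum_add:
  assumes "weight_sum f \<Lambda> x" "weight_sum g \<Lambda>' y"
  shows "weight_sum (\<lambda>s. f s \<oplus>\<^bsub>M\<^esub> g s) (\<Lambda> \<union> \<Lambda>') (x \<oplus>\<^bsub>M\<^esub> y)"
proof -
  have fin: "finite (\<Lambda> \<union> \<Lambda>')" using assms by (simp add: weight_sum_def)
  have a: "weight_sum f (\<Lambda> \<union> \<Lambda>') x" by (rule weight_sum_extend[OF assms(1) _ fin]) simp
  have b: "weight_sum g (\<Lambda> \<union> \<Lambda>') y" by (rule weight_sum_extend[OF assms(2) _ fin]) simp
  have "f s \<in> carrier M" "g s \<in> carrier M" for s
    using assms Wt_carrier unfolding weight_sum_def by blast+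
  then have "f \<in> \<Lambda> \<union> \<Lambda>' \<rightarrow> carrier M" "g \<in> \<Lambda> \<union> \<Lambda>' \<rightarrow> carrier M" by auto
  then have "finsum M (\<lambda>s. f s \<oplus>\<^bsub>M\<^esub> g s) (\<Lambda> \<union> \<Lambda>') = x \<oplus>\<^bsub>M\<^esub> y"
    using a b by (simp add: weight_sum_def M.finsum_addf)
  then show ?thesis
    using a b G.submodule_add[OF gsub_Wt] by (simp add: weight_sum_def)
qed

lemma weight_sum_sc:
  assumes "weight_sum f \<Lambda> x" shows "weight_sum (\<lambda>s. sc c (f s)) \<Lambda> (sc c x)"
proof -
  have "f \<in> \<Lambda> \<rightarrow> carrier M" using assms Wt_carrier by (auto simp: weight_sum_def)
  then show ?thesis using assms gsub_sc[OF gsub_Wt] by (simp add: weight_sum_def act_finsum)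
qed

lemma weight_sum_weight_vector: "x \<in> Wt r \<Longrightarrow> weight_sum (\<lambda>s. if s = r then x else \<zero>\<^bsub>M\<^esub>) {r} x"
  using G.submodule_zero[OF gsub_Wt] Wt_carrier[of x r] by (simp add: weight_sum_def)

lemma weight_sum_zero: "weight_sum (\<lambda>s. \<zero>\<^bsub>M\<^esub>) {} \<zero>\<^bsub>M\<^esub>"
  using G.submodule_zero[OF gsub_Wt] by (simp add: weight_sum_def)

lemma weight_sum_unique:
  assumes "weight_sum f \<Lambda> x" "weight_sum g \<Lambda>' x" shows "f = g"
proof
  fix s
  have xc: "x \<in> carrier M" using assms(1) Wt_carrier by (auto simp: weight_sum_def intro!: M.finsum_closed)
  have fc: "f s \<in> carrier M" "g s \<in> carrier M" using assms Wt_carrier by (auto simp: weight_sum_def)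
  let ?h = "\<lambda>s. f s \<oplus>\<^bsub>M\<^esub> sc (- 1) (g s)"
  have h: "weight_sum ?h (\<Lambda> \<union> \<Lambda>') (x \<oplus>\<^bsub>M\<^esub> sc (- 1) x)"
    by (rule weight_sum_add[OF assms(1) weight_sum_sc[OF assms(2)]])
  have "x \<oplus>\<^bsub>M\<^esub> sc (- 1) x = \<zero>\<^bsub>M\<^esub>" using xc by (simp add: sc_uminus M.r_neg)
  then have fs: "finsum M ?h (\<Lambda> \<union> \<Lambda>') = \<zero>\<^bsub>M\<^esub>" "finite (\<Lambda> \<union> \<Lambda>')" "\<And>s. ?h s \<in> Wt s"
    "\<And>s. s \<notin> \<Lambda> \<union> \<Lambda>' \<Longrightarrow> ?h s = \<zero>\<^bsub>M\<^esub>"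
    using h by (simp_all add: weight_sum_def)
  have "?h s \<in> {\<zero>\<^bsub>M\<^esub>}"
  proof (cases "s \<in> \<Lambda> \<union> \<Lambda>'")
    case True
    show ?thesis
      by (rule weight_components[OF G.submodule_trivial _ fs(2) _ _ True]) (use fs in simp_all)
  qed (use fs(4) in simp)
  then have "f s \<ominus>\<^bsub>M\<^esub> g s = \<zero>\<^bsub>M\<^esub>" using fc by (simp add: sc_uminus M.minus_eq)
  then show "f s = g s" using fc by (simp add: minus_eq_zero_iff)
qed

end

locale weight_module = osc_module q C0 M
  for q :: "'k::field" and C0 and M :: "('k osc_elt, 'm) module" +
  assumes weight_span: "submodule_span (osc_ground q C0) M (\<Union>r. weight_space q C0 M r) = carrier M"
begin

definition pr :: "'k \<Rightarrow> 'm \<Rightarrow> 'm" where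
  "pr r x = (THE f. \<exists>\<Lambda>. weight_sum f \<Lambda> x) r"

lemma pr_eq: "weight_sum f \<Lambda> x \<Longrightarrow> pr r x = f r"
  unfolding pr_def by (rule arg_cong[of _ f "\<lambda>f. f r"], rule the_equality) (blast intro: weight_sum_unique)+

lemma weight_sum_exists:
  assumes "x \<in> carrier M" shows "\<exists>f \<Lambda>. weight_sum f \<Lambda> x"
proof -
  let ?H = "{x. \<exists>f \<Lambda>. weight_sum f \<Lambda> x}"
  have "gsub ?H"
  proof (rule gsubI)
    show "?H \<subseteq> carrier M" using Wt_carrier by (auto simp: weight_sum_def intro!: M.finsum_closed)
    show "\<zero>\<^bsub>M\<^esub> \<in> ?H" using weight_sum_zero by blast
    show "x \<oplus>\<^bsub>M\<^esub> y \<in> ?H" if "x \<in> ?H" "y \<in> ?H" for x y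
      using that by (elim CollectE exE) (blast intro: weight_sum_add)
    show "sc c x \<in> ?H" if "x \<in> ?H" for c x
      using that by (elim CollectE exE) (blast intro: weight_sum_sc)
  qed
  moreover have "(\<Union>r. Wt r) \<subseteq> ?H" using weight_sum_weight_vector by blast
  ultimately have "gspan (\<Union>r. Wt r) \<subseteq> ?H" by (rule G.submodule_span_minimal)
  then show ?thesis using assms weight_span by blast
qed

lemma weight_sum_pr: "x \<in> carrier M \<Longrightarrow> \<exists>\<Lambda>. weight_sum (\<lambda>r. pr r x) \<Lambda> x"
proof -
  assume "x \<in> carrier M"
  then obtain f \<Lambda> where f: "weight_sum f \<Lambda> x" using weight_sum_exists by blast
  have "weight_sum (\<lambda>r. pr r x) \<Lambda> x" unfolding pr_eq[OF f] by (rule f)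
  then show ?thesis by (rule exI)
qed

lemma pr_Wt: "x \<in> carrier M \<Longrightarrow> pr r x \<in> Wt r"
  using weight_sum_pr[of x] by (auto simp: weight_sum_def)

lemma pr_carrier: "x \<in> carrier M \<Longrightarrow> pr r x \<in> carrier M"
  using pr_Wt Wt_carrier by blast

lemma pr_add: "x \<in> carrier M \<Longrightarrow> y \<in> carrier M \<Longrightarrow> pr r (x \<oplus>\<^bsub>M\<^esub> y) = pr r x \<oplus>\<^bsub>M\<^esub> pr r y"
  using weight_sum_pr[of x] weight_sum_pr[of y] pr_eq[OF weight_sum_add] by blast

lemma pr_sc: "x \<in> carrier M \<Longrightarrow> pr r (sc c x) = sc c (pr r x)"
  using weight_sum_pr[of x] pr_eq[OF weight_sum_sc] by blast

lemma pr_weight: "x \<in> Wt s \<Longrightarrow> pr r x = (if r = s then x else \<zero>\<^bsub>M\<^esub>)"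
  using pr_eq[OF weight_sum_weight_vector] by simp

lemma pr_zero [simp]: "pr r \<zero>\<^bsub>M\<^esub> = \<zero>\<^bsub>M\<^esub>"
  using pr_eq[OF weight_sum_zero] .

lemma pr_gsub:
  assumes H: "gsub H" "\<And>x. x \<in> H \<Longrightarrow> act lK x \<in> H" and x: "x \<in> H" shows "pr r x \<in> H"
proof -
  obtain \<Lambda> where L: "weight_sum (\<lambda>r. pr r x) \<Lambda> x"
    using weight_sum_pr G.submodule_subset[OF H(1) x] by blast
  show ?thesis
  proof (cases "r \<in> \<Lambda>")
    case True
    show ?thesis
      using L x True by (intro weight_components[OF H, of \<Lambda> "\<lambda>r. pr r x" r]) (simp_all add: weight_sum_def)
  next
    case False
    then show ?thesis using L G.submodule_zero[OF H(1)] by (simp add: weight_sum_def)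
  qed
qed

lemma pr_submodule: "submodule H A M \<Longrightarrow> x \<in> H \<Longrightarrow> pr r x \<in> H"
  by (intro pr_gsub gsub_if_submodule submodule_act)

lemma mem_if_pr_mem: 
  assumes "gsub H" "x \<in> carrier M" "\<And>r. pr r x \<in> H" shows "x \<in> H"
proof -
  obtain \<Lambda> where "weight_sum (\<lambda>r. pr r x) \<Lambda> x" using weight_sum_pr assms(2) by blast
  then show ?thesis using gsub_finsum[OF assms(1), of \<Lambda> "\<lambda>r. pr r x"] assms(3) by (simp add: weight_sum_def)
qed

text \<open>Submodules are stable under the projections to weight spaces, which can be applied to any
  decomposition of the vector.\<close>

lemma weight_vector_in_sum:
  assumes "submodule H A M" "submodule N A M" "x \<in> Wt r" "x \<in> H <+>\<^bsub>M\<^esub> N"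
  obtains h n where "h \<in> H" "h \<in> Wt r" "n \<in> N" "n \<in> Wt r" "x = h \<oplus>\<^bsub>M\<^esub> n"
proof -
  obtain h n where hn: "h \<in> H" "n \<in> N" "x = h \<oplus>\<^bsub>M\<^esub> n" using assms(4) by (auto simp: set_add_iff)
  have c: "h \<in> carrier M" "n \<in> carrier M" using hn assms submodule_subset by blast+
  have "x = pr r h \<oplus>\<^bsub>M\<^esub> pr r n"
    using pr_weight[OF assms(3), of r] pr_add[OF c, of r] by (simp add: hn(3))
  then show thesis using that[of "pr r h" "pr r n"] pr_submodule assms(1,2) hn(1,2) pr_Wt c by blast
qed

end

section \<open>Triangular decomposition modulo a submodule\<close>

lemma pres_class_self: "p \<in> pres_class P p"
proof -
  interpret I: ideal "Idl\<^bsub>free_algebra\<^esub> P" free_algebra by (rule ideal_relations)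
  show ?thesis using I.a_rcos_self[of p] by (simp add: pres_class_def)
qed

lemma (in osc_central) C0_nonempty: "C0 \<noteq> {}"
proof -
  have "C0 \<in> carrier (presented_algebra (uq_relations q))"
    using C0_central by (simp add: ring_center_def uq_sl2_def)
  then show ?thesis using pres_class_self[of _ "uq_relations q"] by (auto simp: presented_algebra_simps)
qed

locale osc_central_module = osc_module q C0 M + osc_central q C0
  for q :: "'k::field" and C0 and M :: "('k osc_elt, 'm) module"
begin

text \<open>For \<open>n \<ge> 0\<close> these are the combinations of words in \<open>F\<close> and \<open>Y\<close> of total degree \<open>- n\<close> applied to
  \<open>w\<close>, up to elements of \<open>N\<close>. Levels are integers, and \<open>N\<close> belongs to all of them, so that below
  level 0 nothing but \<open>N\<close> is left. The rule that \<open>E\<close> and \<open>X\<close> lower the level by 2 and 1 then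
  covers the vector \<open>w\<close> itself, which they map into \<open>N\<close>.\<close>

inductive descends :: "'m set \<Rightarrow> 'm \<Rightarrow> int \<Rightarrow> 'm \<Rightarrow> bool" for N w where
  base: "x \<in> N \<Longrightarrow> descends N w n x"
| gen: "descends N w 0 w"
| F: "descends N w n x \<Longrightarrow> descends N w (n + 2) (act lF x)"
| Y: "descends N w n x \<Longrightarrow> descends N w (n + 1) (act lY x)"
| add: "descends N w n x \<Longrightarrow> descends N w n y \<Longrightarrow> descends N w n (x \<oplus>\<^bsub>M\<^esub> y)"
| sc: "descends N w n x \<Longrightarrow> descends N w n (sc c x)"

context
  fixes N w r
  assumes N: "submodule N A M" and w: "w \<in> Wt r" and Ew: "act lE w \<in> N" and Xw: "act lX w \<in> N"
begin

lemma descends_carrier: "descends N w n x \<Longrightarrow> x \<in> carrier M"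
  by (induction rule: descends.induct) (use submodule_subset[OF N] Wt_carrier[OF w] in auto)

lemma descends_negative: "descends N w n x \<Longrightarrow> n < 0 \<Longrightarrow> x \<in> N"
  by (induction rule: descends.induct) (auto intro: submodule_act[OF N] submodule_add[OF N])

lemma descends_minus: "descends N w n x \<Longrightarrow> descends N w n y \<Longrightarrow> descends N w n (x \<ominus>\<^bsub>M\<^esub> y)"
  using descends.add[of N w n x "sc (- 1) y"] descends.sc[of N w n y "- 1"] descends_carrier[of n y]
  by (simp add: sc_uminus M.minus_eq)

lemma descends_weight_zero:
  assumes u: "u \<in> weight_zero"
    and n: "\<And>x. descends N w n x \<Longrightarrow> descends N w (n - 2) (act lE x) \<and> descends N w n (act lK x) \<and> descends N w n (act lK' x)"
    and x: "descends N w n x"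
  shows "descends N w n (act u x)"
  using u x
proof (induction arbitrary: x rule: weight_zero.induct)
  case FE
  then show ?case using descends.F[of N w "n - 2" "act lE x"] n[of x] descends_carrier[of n x] by (simp add: act_mult)
next
  case (add u v)
  then show ?case using descends_carrier[of n x] by (simp add: act_add descends.add)
next
  case (mult u v)
  then show ?case using descends_carrier[of n x] by (simp add: act_mult)
qed (use n descends.sc in auto)

text \<open>This replaces the triangular decomposition of the algebra. Moving \<open>X\<close> past \<open>Y\<close> produces the
  action of \<open>C0\<close>, a polynomial in \<open>F E\<close>, \<open>K\<close> and the inverse of \<open>K\<close>, on a vector whose
  level is smaller by one. Stability of that level under \<open>E\<close> and \<open>K\<close> is what the outer
  induction on the level provides; the inner induction is on the generation of the vector.\<close>

lemma descends_stable:
  "descends N w n x \<Longrightarrow> descends N w (n - 2) (act lE x) \<and> descends N w (n - 1) (act lX x) \<and>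
     descends N w n (act lK x) \<and> descends N w n (act lK' x)"
proof -
  have *: "descends N w n x \<Longrightarrow> n \<le> int k \<Longrightarrow> descends N w (n - 2) (act lE x) \<and> descends N w (n - 1) (act lX x) \<and>
     descends N w n (act lK x) \<and> descends N w n (act lK' x)" for k
  proof (induction k arbitrary: n x rule: less_induct)
    case (less k)
    show ?case
      using less.prems
    proof (induction rule: descends.induct)
      case (base x n)
      then show ?case using submodule_act[OF N] by (intro conjI descends.base)
    next
      case gen
      have wc: "w \<in> carrier M" "act lK w = sc r w" using w by (simp_all add: Wt_iff)
      have "act lK' (act lK w) = act lK' (sc r w)" by (simp only: wc(2))
      then have "w = sc r (act lK' w)" using wc(1) by (simp add: act_letter_sc)
      then have "sc (inverse r) w = sc (inverse r) (sc r (act lK' w))" by (rule arg_cong)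
      then have "act lK' w = sc (inverse r) w" if "r \<noteq> 0" using wc(1) that by (simp add: sc_sc)
      \<comment> \<open>\<open>K\<close> is invertible, so there are no weight vectors of weight 0 other than zero.\<close>
      moreover have "act lK' w = sc 0 w" if "r = 0"
      proof -
        have "w = \<zero>\<^bsub>M\<^esub>" using Wt_zero_trivial w that by blast
        then show ?thesis by simp
      qed
      ultimately have "\<exists>c. act lK' w = sc c w" by blast
      then show ?case using Ew Xw w descends.gen[of N w] 
        by (auto simp: Wt_iff intro: descends.base descends.sc)
    next
      case (F n x)
      then have xc: "x \<in> carrier M" and IH: "descends N w (n - 2) (act lE x)" "descends N w (n - 1) (act lX x)"
        "descends N w n (act lK x)" "descends N w n (act lK' x)" using descends_carrier by auto
      have "descends N w n (act lF (act lE x))" using descends.F[OF IH(1)] by simp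
      moreover have "descends N w (n + 1) (act lF (act lX x))" using descends.F[OF IH(2)] by (simp add: add.commute)
      moreover have "act lX (act lF x) = act lF (act lX x) \<ominus>\<^bsub>M\<^esub> act lY (act lK' x)"
        using xc F_X[OF xc] by (simp add: M.minus_eq M.a_ac M.r_neg M.r_neg1 M.r_neg2)
      ultimately have "descends N w (n + 1) (act lX (act lF x))" "descends N w n (act lF (act lE x))"
        using descends_minus descends.Y[OF IH(4)] by simp_all
      then show ?case
        using xc IH descends.F[OF IH(3)] descends.F[OF IH(4)] descends.Y[OF IH(4)] descends.intros(5,6) descends_minus
        by (simp add: E_F K_past Kinv_past add.commute[of 1 n])
    next
      case (Y n x)
      then have xc: "x \<in> carrier M" and IH: "descends N w (n - 2) (act lE x)" "descends N w (n - 1) (act lX x)"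
        "descends N w n (act lK x)" "descends N w n (act lK' x)" using descends_carrier by auto
      \<comment> \<open>The level \<open>n\<close> of \<open>x\<close> is one less than the present level, so the outer induction applies.\<close>
      have z: "descends N w n (act (free_map Uq_gen c) x)" if c: "c \<in> C0" for c
      proof -
        obtain u where u: "u \<in> weight_zero" "free_map Uq_gen c - u \<in> I"
          using C0_weight_zero[OF c] ideal_no_C0 by blast
        have "descends N w n (act u x)"
        proof (cases "n < 0")
          case True
          then show ?thesis using descends_negative Y.hyps submodule_act[OF N] by (blast intro: descends.base)
        next
          case False
          have "descends N w (n - 2) (act lE y) \<and> descends N w n (act lK y) \<and> descends N w n (act lK' y)"
            if "descends N w n y" for y
            using less.IH[of "nat n" n y] that False Y.prems by auto
          then show ?thesis using Y.hyps by (intro descends_weight_zero[OF u(1)])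
        qed
        then show ?thesis using act_cong[OF u(2)] by simp
      qed
      obtain c where c: "c \<in> C0" using C0_nonempty by blast
      have "descends N w (n - 1) (act lY (act lE x))" using descends.Y[OF IH(1)] by simp
      moreover have "descends N w n (act lY (act lX x))" using descends.Y[OF IH(2)] by simp
      ultimately show ?case
        using xc IH z[OF c] descends.Y[OF IH(3)] descends.Y[OF IH(4)] descends.intros(5,6) descends_minus
        by (simp add: E_Y X_Y[OF _ c] K_past Kinv_past)
    next
      case (add n x y)
      then show ?case using descends_carrier by (simp add: act_plus_right descends.add)
    next
      case (sc n x c)
      then show ?case using descends_carrier by (simp add: act_letter_sc descends.sc)
    qed
  qed
  show "descends N w n x \<Longrightarrow> ?thesis" using *[of "nat n"] by simp
qed

lemma descends_weight:
  "descends N w n x \<Longrightarrow> \<exists>y\<in>N. \<exists>z\<in>Wt (q powi (- n) * r). x = y \<oplus>\<^bsub>M\<^esub> z \<and> (n = 0 \<longrightarrow> (\<exists>c. z = sc c w))"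
proof (induction rule: descends.induct)
  case (base x n)
  then show ?case using submodule_subset[OF N] G.submodule_zero[OF gsub_Wt] Wt_carrier[OF w]
    by (intro bexI[of _ x] bexI[of _ "\<zero>\<^bsub>M\<^esub>"] conjI impI exI[of _ 0]) auto
next
  case gen
  show ?case using w Wt_carrier[OF w] submodule_zero[OF N]
    by (intro bexI[of _ "\<zero>\<^bsub>M\<^esub>"] bexI[of _ w] conjI impI exI[of _ 1]) auto
next
  case (F n x)
  show ?case
  proof (cases "n < 0")
    case True
    then have x: "act lF x \<in> N" using F.hyps by (intro submodule_act[OF N] descends_negative)
    then show ?thesis using submodule_subset[OF N x] G.submodule_zero[OF gsub_Wt] Wt_carrier[OF w]
      by (intro bexI[of _ "act lF x"] bexI[of _ "\<zero>\<^bsub>M\<^esub>"] conjI impI exI[of _ 0]) auto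
  next
    case False
    obtain y z where yz: "y \<in> N" "z \<in> Wt (q powi (- n) * r)" "x = y \<oplus>\<^bsub>M\<^esub> z" using F.IH by blast
    have n2: "- (n + 2) = - 2 + - n" by simp
    have "act lF z \<in> Wt (q powi (- 2) * (q powi (- n) * r))"
      using act_letter_Wt[OF yz(2), of "Uq_gen Gen_F"] by simp
    then have "act lF z \<in> Wt (q powi (- (n + 2)) * r)"
      by (simp only: n2 power_int_add[OF disjI1[OF q_nonzero]] mult.assoc)
    moreover have "act lF x = act lF y \<oplus>\<^bsub>M\<^esub> act lF z"
      using yz submodule_subset[OF N] Wt_carrier by (simp add: act_plus_right)
    ultimately show ?thesis using False submodule_act[OF N yz(1)] by fastforce
  qed
next
  case (Y n x)
  show ?case
  proof (cases "n < 0")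
    case True
    then have x: "act lY x \<in> N" using Y.hyps by (intro submodule_act[OF N] descends_negative)
    then show ?thesis using submodule_subset[OF N x] G.submodule_zero[OF gsub_Wt] Wt_carrier[OF w]
      by (intro bexI[of _ "act lY x"] bexI[of _ "\<zero>\<^bsub>M\<^esub>"] conjI impI exI[of _ 0]) auto
  next
    case False
    obtain y z where yz: "y \<in> N" "z \<in> Wt (q powi (- n) * r)" "x = y \<oplus>\<^bsub>M\<^esub> z" using Y.IH by blast
    have n1: "- (n + 1) = - 1 + - n" by simp
    have "act lY z \<in> Wt (q powi (- 1) * (q powi (- n) * r))"
      using act_letter_Wt[OF yz(2), of Gen_Y] by (simp only: gen_degree.simps)
    then have "act lY z \<in> Wt (q powi (- (n + 1)) * r)"
      by (simp only: n1 power_int_add[OF disjI1[OF q_nonzero]] mult.assoc)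
    moreover have "act lY x = act lY y \<oplus>\<^bsub>M\<^esub> act lY z"
      using yz submodule_subset[OF N] Wt_carrier by (simp add: act_plus_right)
    ultimately show ?thesis using False submodule_act[OF N yz(1)] by fastforce
  qed
next
  case (add n x y)
  then obtain a b c d where ab: "a \<in> N" "b \<in> Wt (q powi (- n) * r)" "x = a \<oplus>\<^bsub>M\<^esub> b" "n = 0 \<longrightarrow> (\<exists>c. b = sc c w)"
    and cd: "c \<in> N" "d \<in> Wt (q powi (- n) * r)" "y = c \<oplus>\<^bsub>M\<^esub> d" "n = 0 \<longrightarrow> (\<exists>c. d = sc c w)" by meson
  have "x \<oplus>\<^bsub>M\<^esub> y = (a \<oplus>\<^bsub>M\<^esub> c) \<oplus>\<^bsub>M\<^esub> (b \<oplus>\<^bsub>M\<^esub> d)"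
    using ab cd submodule_subset[OF N] Wt_carrier by (simp add: M.a_ac)
  moreover have "n = 0 \<longrightarrow> (\<exists>c. b \<oplus>\<^bsub>M\<^esub> d = sc c w)"
    using ab(4) cd(4) sc_add[OF Wt_carrier[OF w]] by metis
  ultimately show ?case
    using submodule_add[OF N ab(1) cd(1)] G.submodule_add[OF gsub_Wt ab(2) cd(2)] by blast
next
  case (sc n x c)
  then obtain a b where ab: "a \<in> N" "b \<in> Wt (q powi (- n) * r)" "x = a \<oplus>\<^bsub>M\<^esub> b" "n = 0 \<longrightarrow> (\<exists>c. b = sc c w)" by meson
  have "sc c x = sc c a \<oplus>\<^bsub>M\<^esub> sc c b"
    using ab submodule_subset[OF N] Wt_carrier by (simp add: act_plus_right)
  moreover have "n = 0 \<longrightarrow> (\<exists>d. sc c b = sc d w)" using ab(4) sc_sc[OF Wt_carrier[OF w]] by metis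
  ultimately show ?case using submodule_act[OF N ab(1)] gsub_sc[OF gsub_Wt ab(2)] by blast
qed

lemma submodule_gspan_descends: "submodule (gspan {x. \<exists>n. descends N w n x}) A M"
proof -
  let ?D = "{x. \<exists>n. descends N w n x}"
  have D: "?D \<subseteq> carrier M" using descends_carrier by blast
  note sp = G.submodule_span_submodule[OF D]
  have "act (letter g) x \<in> gspan ?D" if "x \<in> gspan ?D" for g x
  proof -
    let ?H = "{x \<in> carrier M. act (letter g) x \<in> gspan ?D}"
    have "gsub ?H"
      using G.submodule_zero[OF sp] G.submodule_add[OF sp] gsub_sc[OF sp]
      by (intro gsubI) (auto simp: act_plus_right act_letter_sc)
    moreover have "?D \<subseteq> ?H"
    proof
      fix x assume "x \<in> ?D"
      then obtain n where n: "descends N w n x" by blast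
      have "\<exists>m. descends N w m (act (letter g) x)"
      proof (cases g)
        case (Uq_gen h)
        then show ?thesis using descends_stable[OF n] descends.F[OF n] by (cases h) blast+
      qed (use descends_stable[OF n] descends.Y[OF n] in blast)+
      then show "x \<in> ?H" using G.subset_submodule_span[of ?D] descends_carrier[OF n] by blast
    qed
    ultimately have "gspan ?D \<subseteq> ?H" by (rule G.submodule_span_minimal)
    then show ?thesis using that by blast
  qed
  then show ?thesis
    using G.submodule_subset[OF sp] G.submodule_zero[OF sp] G.submodule_add[OF sp] gsub_sc[OF sp]
    by (intro submodule_by_letters) blast+
qed

lemma act_in_gspan_descends: "act p w \<in> gspan {x. \<exists>n. descends N w n x}"
  using G.subset_submodule_span[of "{x. \<exists>n. descends N w n x}"] descends.gen
  by (intro submodule_act[OF submodule_gspan_descends]) blast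

end

end

locale osc_central_weight_module = weight_module q C0 M + osc_central_module q C0 M
  for q :: "'k::field" and C0 and M :: "('k osc_elt, 'm) module"
begin

context
  fixes N w r
  assumes N: "submodule N A M" and w: "w \<in> Wt r" and Ew: "act lE w \<in> N" and Xw: "act lX w \<in> N"
begin

lemma pr_cyclic:
  assumes "\<And>n::nat. \<mu> \<noteq> q powi (- int n) * r" shows "pr \<mu> (act p w) \<in> N"
proof -
  let ?H = "{x \<in> carrier M. pr \<mu> x \<in> N}"
  have "gsub ?H"
    using submodule_zero[OF N] submodule_add[OF N] submodule_act[OF N]
    by (intro gsubI) (auto simp: pr_add pr_sc)
  moreover have "{x. \<exists>n. descends N w n x} \<subseteq> ?H"
  proof
    fix x assume "x \<in> {x. \<exists>n. descends N w n x}"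
    then obtain n where n: "descends N w n x" by blast
    note xc = descends_carrier[OF N w Ew Xw n]
    show "x \<in> ?H"
    proof (cases "n < 0")
      case True
      then show ?thesis using descends_negative[OF N w Ew Xw n] pr_submodule[OF N] xc by simp
    next
      case False
      obtain y z where yz: "y \<in> N" "z \<in> Wt (q powi (- n) * r)" "x = y \<oplus>\<^bsub>M\<^esub> z"
        using descends_weight[OF N w Ew Xw n] by blast
      have "pr \<mu> z = \<zero>\<^bsub>M\<^esub>" using pr_weight[OF yz(2), of \<mu>] assms[of "nat n"] False by simp
      then have "pr \<mu> x = pr \<mu> y"
        using yz submodule_subset[OF N] Wt_carrier pr_carrier by (simp add: pr_add)
      then show ?thesis using pr_submodule[OF N yz(1)] xc by simp
    qed
  qed
  ultimately have "gspan {x. \<exists>n. descends N w n x} \<subseteq> ?H" by (rule G.submodule_span_minimal)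
  then show ?thesis using act_in_gspan_descends[OF N w Ew Xw] by blast
qed

text \<open>Only the empty word in \<open>F\<close> and \<open>Y\<close> contributes to the highest weight.\<close>

lemma pr_cyclic_top:
  assumes r: "r \<noteq> 0" shows "\<exists>c. pr r (act p w) \<ominus>\<^bsub>M\<^esub> sc c w \<in> N"
proof -
  have wc: "w \<in> carrier M" using w by (rule Wt_carrier)
  let ?H = "{x \<in> carrier M. \<exists>c. pr r x \<ominus>\<^bsub>M\<^esub> sc c w \<in> N}"
  have "gsub ?H"
  proof (rule gsubI)
    have "pr r \<zero>\<^bsub>M\<^esub> \<ominus>\<^bsub>M\<^esub> sc 0 w = \<zero>\<^bsub>M\<^esub>" using wc by (simp add: minus_eq_zero_iff)
    then show "\<zero>\<^bsub>M\<^esub> \<in> ?H" using submodule_zero[OF N] by (auto intro!: exI[of _ 0])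
  next
    fix x y assume "x \<in> ?H" "y \<in> ?H"
    then obtain a b where ab: "pr r x \<ominus>\<^bsub>M\<^esub> sc a w \<in> N" "pr r y \<ominus>\<^bsub>M\<^esub> sc b w \<in> N"
      and c: "x \<in> carrier M" "y \<in> carrier M" by blast
    have "pr r (x \<oplus>\<^bsub>M\<^esub> y) \<ominus>\<^bsub>M\<^esub> sc (a + b) w = (pr r x \<ominus>\<^bsub>M\<^esub> sc a w) \<oplus>\<^bsub>M\<^esub> (pr r y \<ominus>\<^bsub>M\<^esub> sc b w)"
      using c wc pr_carrier by (simp add: pr_add sc_add M.minus_eq M.minus_add M.a_ac)
    then have "pr r (x \<oplus>\<^bsub>M\<^esub> y) \<ominus>\<^bsub>M\<^esub> sc (a + b) w \<in> N" using submodule_add[OF N ab] by simp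
    then show "x \<oplus>\<^bsub>M\<^esub> y \<in> ?H" using M.a_closed[OF c] by blast
  next
    fix d x assume "x \<in> ?H"
    then obtain a where a: "pr r x \<ominus>\<^bsub>M\<^esub> sc a w \<in> N" and c: "x \<in> carrier M" by blast
    have "pr r (sc d x) \<ominus>\<^bsub>M\<^esub> sc (d * a) w = sc d (pr r x \<ominus>\<^bsub>M\<^esub> sc a w)"
      using c wc pr_carrier by (simp add: pr_sc act_minus_right sc_sc)
    then have "pr r (sc d x) \<ominus>\<^bsub>M\<^esub> sc (d * a) w \<in> N" using submodule_act[OF N a, of "const d"] by simp
    then show "sc d x \<in> ?H" using act_closed[OF c] by blast
  qed blast
  moreover have "{x. \<exists>n. descends N w n x} \<subseteq> ?H"
  proof
    fix x assume "x \<in> {x. \<exists>n. descends N w n x}"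
    then obtain n where n: "descends N w n x" by blast
    note xc = descends_carrier[OF N w Ew Xw n]
    obtain y z where yz: "y \<in> N" "z \<in> Wt (q powi (- n) * r)" "x = y \<oplus>\<^bsub>M\<^esub> z" "n = 0 \<longrightarrow> (\<exists>c. z = sc c w)"
      using descends_weight[OF N w Ew Xw n] by blast
    have "q powi (- n) * r = r \<longleftrightarrow> n = 0" using q_powi_inj[of "- n" 0] r by simp
    then have "\<exists>c. pr r z = sc c w"
      using pr_weight[OF yz(2), of r] yz(4) act_0[OF wc] const_zero by (metis minus_zero mult_1 power_int_0_right)
    then obtain c where c: "pr r z = sc c w" by blast
    have "pr r x \<ominus>\<^bsub>M\<^esub> sc c w = pr r y"
      using yz(1-3) submodule_subset[OF N] Wt_carrier pr_carrier wc c by (simp add: pr_add M.minus_eq M.a_assoc M.r_neg)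
    then have "pr r x \<ominus>\<^bsub>M\<^esub> sc c w \<in> N" using pr_submodule[OF N yz(1)] by simp
    then show "x \<in> ?H" using xc by blast
  qed
  ultimately have "gspan {x. \<exists>n. descends N w n x} \<subseteq> ?H" by (rule G.submodule_span_minimal)
  then show ?thesis using act_in_gspan_descends[OF N w Ew Xw] by blast
qed

end

end

section \<open>Linear algebra in finite dimensional subspaces\<close>

context osc_module
begin

lemma gspan_insert_iff:
  assumes "s \<in> carrier M" "S \<subseteq> carrier M"
  shows "x \<in> gspan (insert s S) \<longleftrightarrow> (\<exists>c. \<exists>y\<in>gspan S. x = sc c s \<oplus>\<^bsub>M\<^esub> y)"
  unfolding G.submodule_span_insert[OF assms] G.set_add_iff by (auto simp: ground_eq act_def)

lemma gspan_empty: "gspan {} = {\<zero>\<^bsub>M\<^esub>}"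
  using G.submodule_span_minimal[OF G.submodule_trivial, of "{}"]
    G.submodule_zero[OF G.submodule_span_submodule, of "{}"] by auto

lemma gspan_subset_carrier: "S \<subseteq> carrier M \<Longrightarrow> gspan S \<subseteq> carrier M"
  using G.submodule_subset[OF G.submodule_span_submodule] by blast

lemma sc_diff_inverse:
  assumes "s \<in> carrier M" "y \<in> carrier M" "z \<in> carrier M" "c \<noteq> 0"
  shows "(sc d s \<oplus>\<^bsub>M\<^esub> z) \<ominus>\<^bsub>M\<^esub> sc (d / c) (sc c s \<oplus>\<^bsub>M\<^esub> y) = z \<ominus>\<^bsub>M\<^esub> sc (d / c) y"
proof -
  have "sc (d / c) (sc c s \<oplus>\<^bsub>M\<^esub> y) = sc d s \<oplus>\<^bsub>M\<^esub> sc (d / c) y"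
    using assms by (simp add: act_plus_right sc_sc)
  then show ?thesis
    using assms by (simp add: M.minus_eq M.minus_add M.a_ac M.r_neg1 M.r_neg2)
qed

lemma finite_spanning_subspace:
  assumes "finite S" "S \<subseteq> carrier M" "gsub H" "H \<subseteq> gspan S"
  shows "\<exists>T. finite T \<and> T \<subseteq> H \<and> gspan T = H"
  using assms
proof (induction S arbitrary: H rule: finite_induct)
  case empty
  then have "H = {\<zero>\<^bsub>M\<^esub>}" using G.submodule_zero gspan_empty by blast
  then show ?case using gspan_empty by blast
next
  case (insert s S)
  have s: "s \<in> carrier M" and S: "S \<subseteq> carrier M" using insert.prems by auto
  note sp = G.submodule_span_submodule[OF S] and H = insert.prems(2)
  show ?case
  proof (cases "H \<subseteq> gspan S")
    case True
    then show ?thesis using insert.IH[OF S H] by blast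
  next
    case False
    then obtain h where h: "h \<in> H" "h \<notin> gspan S" by blast
    then obtain c y where hcy: "y \<in> gspan S" "h = sc c s \<oplus>\<^bsub>M\<^esub> y"
      using insert.prems(3) gspan_insert_iff[OF s S] by blast
    have yc: "y \<in> carrier M" using hcy(1) gspan_subset_carrier[OF S] by blast
    have hc: "h \<in> carrier M" by (rule G.submodule_subset[OF H h(1)])
    have c: "c \<noteq> 0" using h hcy yc s by auto
    obtain T where T: "finite T" "T \<subseteq> H \<inter> gspan S" "gspan T = H \<inter> gspan S"
      using insert.IH[OF S G.submodule_Int[OF H sp]] by blast
    have Tc: "T \<subseteq> carrier M" using T(2) G.submodule_subset[OF H] by blast
    have "gspan (insert h T) = H"
    proof
      show "gspan (insert h T) \<subseteq> H" using h T by (intro G.submodule_span_minimal[OF H]) blast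
      show "H \<subseteq> gspan (insert h T)"
      proof
        fix x assume x: "x \<in> H"
        then obtain d z where xdz: "z \<in> gspan S" "x = sc d s \<oplus>\<^bsub>M\<^esub> z"
          using insert.prems(3) gspan_insert_iff[OF s S] by blast
        have zc: "z \<in> carrier M" using xdz(1) gspan_subset_carrier[OF S] by blast
        let ?u = "x \<ominus>\<^bsub>M\<^esub> sc (d / c) h"
        have "?u = z \<ominus>\<^bsub>M\<^esub> sc (d / c) y" using sc_diff_inverse[OF s yc zc c] hcy xdz by simp
        then have "?u \<in> gspan S" using G.submodule_minus[OF sp xdz(1) gsub_sc[OF sp hcy(1)]] by simp
        moreover have "?u \<in> H" using G.submodule_minus[OF H x gsub_sc[OF H h(1)]] .
        ultimately have "?u \<in> gspan T" using T(3) by blast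
        moreover have "x = sc (d / c) h \<oplus>\<^bsub>M\<^esub> ?u"
          using G.submodule_subset[OF H x] hc by (simp add: M.minus_eq M.a_ac M.r_neg)
        ultimately show "x \<in> gspan (insert h T)" using gspan_insert_iff[OF hc Tc] by blast
      qed
    qed
    then show ?thesis using T h by (intro exI[of _ "insert h T"]) blast
  qed
qed

text \<open>If a vector were not in the span of \<open>S\<close> modulo the common kernel of the functionals in \<open>D\<close>, then
  some functional in \<open>D\<close> would separate it from \<open>S\<close>. The induction splits off one \<open>s \<in> S\<close> with the
  help of a functional \<open>d0\<close> that vanishes on the rest of \<open>S\<close> but not on \<open>s\<close>. Functionals are
  considered on a subspace \<open>V\<close> only, where they are linear.\<close>

lemma functionals_separate:
  assumes V: "gsub V"
    and D: "\<And>d e c. d \<in> D \<Longrightarrow> e \<in> D \<Longrightarrow> (\<lambda>x. d x - c * e x) \<in> D"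
    and lin: "\<And>d x y. d \<in> D \<Longrightarrow> x \<in> V \<Longrightarrow> y \<in> V \<Longrightarrow> d (x \<oplus>\<^bsub>M\<^esub> y) = d x + d y"
    and hom: "\<And>d x c. d \<in> D \<Longrightarrow> x \<in> V \<Longrightarrow> d (sc c x) = c * (d x :: 'k)"
  shows "finite S \<Longrightarrow> S \<subseteq> V \<Longrightarrow> v \<in> V \<Longrightarrow> (\<And>d. d \<in> D \<Longrightarrow> (\<forall>s\<in>S. d s = 0) \<Longrightarrow> d v = 0) \<Longrightarrow>
    \<exists>y\<in>gspan S. \<exists>x\<in>V. (\<forall>d\<in>D. d x = 0) \<and> v = x \<oplus>\<^bsub>M\<^esub> y"
proof (induction S arbitrary: v rule: finite_induct)
  case empty
  then show ?case using G.submodule_subset[OF V] gspan_empty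
    by (intro bexI[of _ "\<zero>\<^bsub>M\<^esub>"] bexI[of _ v]) auto
next
  case (insert s S)
  have s: "s \<in> V" and S: "S \<subseteq> V" using insert.prems by auto
  have Sc: "S \<subseteq> carrier M" "s \<in> carrier M" "v \<in> carrier M"
    using s S insert.prems(2) G.submodule_subset[OF V] by auto
  show ?case
  proof (cases "\<forall>d\<in>D. (\<forall>s\<in>S. d s = 0) \<longrightarrow> d s = 0")
    case True
    then obtain y x where "y \<in> gspan S" "x \<in> V" "\<forall>d\<in>D. d x = 0" "v = x \<oplus>\<^bsub>M\<^esub> y"
      using insert.IH[OF S insert.prems(2)] insert.prems(3) by blast
    moreover have "gspan S \<subseteq> gspan (insert s S)" by (rule G.submodule_span_mono) blast
    ultimately show ?thesis by blast
  next
    case False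
    then obtain d0 where d0: "d0 \<in> D" "\<forall>t\<in>S. d0 t = 0" "d0 s \<noteq> 0" by blast
    let ?c = "d0 v / d0 s"
    let ?u = "v \<oplus>\<^bsub>M\<^esub> sc (- ?c) s"
    have u: "?u \<in> V" using G.submodule_add[OF V insert.prems(2) gsub_sc[OF V s]] .
    have "e ?u = 0" if e: "e \<in> D" "\<forall>t\<in>S. e t = 0" for e
    proof -
      have "e v - (e s / d0 s) * d0 v = 0"
        using insert.prems(3)[OF D[OF e(1) d0(1), of "e s / d0 s"]] e(2) d0(2,3) by simp
      then show ?thesis using lin[OF e(1) insert.prems(2) gsub_sc[OF V s]] hom[OF e(1) s] by simp
    qed
    then obtain y x where yx: "y \<in> gspan S" "x \<in> V" "\<forall>d\<in>D. d x = 0" "?u = x \<oplus>\<^bsub>M\<^esub> y"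
      using insert.IH[OF S u] by blast
    have c: "x \<in> carrier M" "y \<in> carrier M"
      using yx gspan_subset_carrier[OF Sc(1)] G.submodule_subset[OF V] by blast+
    have "v = ?u \<oplus>\<^bsub>M\<^esub> sc ?c s"
      using Sc by (simp only: sc_uminus) (simp add: M.a_assoc M.l_neg)
    then have "v = x \<oplus>\<^bsub>M\<^esub> (sc ?c s \<oplus>\<^bsub>M\<^esub> y)" unfolding yx(4) using c Sc by (simp add: M.a_ac)
    moreover have "sc ?c s \<oplus>\<^bsub>M\<^esub> y \<in> gspan (insert s S)" using gspan_insert_iff[OF Sc(2,1)] yx(1) by blast
    ultimately show ?thesis using yx(2,3) by blast
  qed
qed

text \<open>The coefficient of \<open>g\<close> modulo \<open>V\<close> is unique where it exists. Nothing is said about the value at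
  vectors outside the span of \<open>g\<close> and \<open>V\<close>.\<close>

lemma coefficient_functional:
  assumes V: "gsub V" and g: "g \<in> carrier M" "g \<notin> V"
  shows "\<exists>\<phi> :: 'm \<Rightarrow> 'k. \<forall>x c. x \<in> carrier M \<longrightarrow> x \<ominus>\<^bsub>M\<^esub> sc c g \<in> V \<longrightarrow> \<phi> x = c"
proof -
  have uniq: "a = b" if "x \<in> carrier M" "x \<ominus>\<^bsub>M\<^esub> sc a g \<in> V" "x \<ominus>\<^bsub>M\<^esub> sc b g \<in> V" for a b x
  proof (rule ccontr)
    assume ab: "a \<noteq> b"
    have "(x \<ominus>\<^bsub>M\<^esub> sc b g) \<ominus>\<^bsub>M\<^esub> (x \<ominus>\<^bsub>M\<^esub> sc a g) = sc a g \<ominus>\<^bsub>M\<^esub> sc b g"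
      using that(1) g by (simp add: M.minus_eq M.minus_add M.a_ac M.r_neg1 M.r_neg2)
    also have "\<dots> = sc (a - b) g" using g by (simp add: const_diff act_minus)
    finally have "sc (a - b) g \<in> V" using G.submodule_minus[OF V that(3,2)] by simp
    then have "sc (inverse (a - b)) (sc (a - b) g) \<in> V" by (rule gsub_sc[OF V])
    then show False using ab g by (simp add: sc_sc)
  qed
  show ?thesis
  proof (intro exI allI impI)
    fix x c assume x: "x \<in> carrier M" "x \<ominus>\<^bsub>M\<^esub> sc c g \<in> V"
    show "(THE c. x \<ominus>\<^bsub>M\<^esub> sc c g \<in> V) = c"
      by (rule the_equality[where P = "\<lambda>c. x \<ominus>\<^bsub>M\<^esub> sc c g \<in> V"], rule x(2), rule uniq[OF x(1) _ x(2)])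
  qed
qed

end

section \<open>Linkage and lifting of highest weight vectors\<close>

context osc_params
begin

definition left_ideal :: "(osc_gen, 'k) free_elt set \<Rightarrow> bool" where
  "left_ideal J \<longleftrightarrow> 0 \<in> J \<and> (\<forall>a\<in>J. \<forall>b\<in>J. a + b \<in> J) \<and> (\<forall>p. \<forall>a\<in>J. p * a \<in> J)"

text \<open>Some quotient of \<open>Z(s)\<close> contains a highest weight vector of weight \<open>r\<close>. The quotient is given
  by the left ideal \<open>J\<close> of the free algebra that annihilates its generator, and the
  vector by its representative \<open>a\<close>.\<close>

definition singular_link :: "'k \<Rightarrow> 'k \<Rightarrow> bool" where
  "singular_link s r \<longleftrightarrow> (\<exists>J a. left_ideal J \<and> I \<subseteq> J \<and> {lE, lX, lK - const s} \<subseteq> J \<and>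
     a \<notin> J \<and> {lE * a, lX * a, (lK - const r) * a} \<subseteq> J)"

end

context osc_module
begin

definition cyc :: "'m \<Rightarrow> 'm set" where "cyc w = range (\<lambda>p. act p w)"

lemma submodule_cyc: "w \<in> carrier M \<Longrightarrow> submodule (cyc w) A M"
  using submodule_cyclic[of w] by (simp add: cyc_def A_simps image_image act_def)

lemma act_mem_cyc: "act p w \<in> cyc w"
  by (simp add: cyc_def)

lemma mem_cyc: "w \<in> carrier M \<Longrightarrow> w \<in> cyc w"
  using act_mem_cyc[of 1 w] by simp

lemma cyc_minimal: "submodule H A M \<Longrightarrow> w \<in> H \<Longrightarrow> cyc w \<subseteq> H"
  by (auto simp: cyc_def submodule_act)

end

context weight_module
begin

lemma pr_homogeneous:
  assumes b: "\<And>\<mu> x. x \<in> Wt \<mu> \<Longrightarrow> act b x \<in> Wt (t * \<mu>)" and t: "t \<noteq> 0" and x: "x \<in> carrier M"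
  shows "pr (t * \<mu>) (act b x) = act b (pr \<mu> x)"
proof -
  let ?H = "{x \<in> carrier M. pr (t * \<mu>) (act b x) = act b (pr \<mu> x)}"
  have "gsub ?H"
    by (intro gsubI) (auto simp: act_plus_right pr_add pr_carrier act_sc pr_sc)
  moreover have "(\<Union>r. Wt r) \<subseteq> ?H"
    using pr_weight[OF b] t by (auto simp: pr_weight Wt_carrier)
  ultimately have "gspan (\<Union>r. Wt r) \<subseteq> ?H" by (rule G.submodule_span_minimal)
  then show ?thesis using x weight_span by blast
qed

lemma pr_letter:
  "x \<in> carrier M \<Longrightarrow> pr (q powi gen_degree g * \<mu>) (act (letter g) x) = act (letter g) (pr \<mu> x)"
  by (rule pr_homogeneous[OF act_letter_Wt]) (simp_all add: q_nonzero)

lemma weight_unique: "x \<in> Wt a \<Longrightarrow> x \<in> Wt b \<Longrightarrow> x \<noteq> \<zero>\<^bsub>M\<^esub> \<Longrightarrow> a = b"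
  using pr_weight[of x a a] pr_weight[of x b a] by (auto split: if_splits)

end

context osc_central_weight_module
begin

lemma iota_homogeneous:
  assumes d: "lK * d - const t * d * lK \<in> I" and t: "t \<noteq> 0" and x: "x \<in> Wt \<mu>"
  shows "act (iota d) x \<in> Wt (inverse t * \<mu>)"
proof -
  have xc: "x \<in> carrier M" "act lK x = sc \<mu> x" using x by (simp_all add: Wt_iff)
  have "iota d * lK - lK * (iota d * const t) \<in> I"
    using iota_ideal[OF d] by (simp add: iota_minus iota_mult)
  from fun_cong[OF act_cong[OF this], of x]
  have "sc \<mu> (act (iota d) x) = sc t (act lK (act (iota d) x))"
    using xc by (simp add: act_mult act_sc[of _ "iota d"] act_letter_sc)
  then have "sc (inverse t) (sc \<mu> (act (iota d) x)) = sc (inverse t) (sc t (act lK (act (iota d) x)))"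
    by (rule arg_cong)
  then show ?thesis using t xc by (simp add: Wt_iff sc_sc)
qed

text \<open>The dual of \<open>N\<close> is a module through \<open>iota\<close>, with \<open>(a \<Phi>) x = \<Phi> (iota a x)\<close>. In it \<open>\<Phi>\<close> is a
  highest weight vector of weight \<open>s\<close>: it lives on the weight space of \<open>s\<close>, and it vanishes on
  the images of \<open>F\<close> and \<open>Y\<close>, that is, of \<open>iota E\<close> and \<open>iota X\<close>. Its annihilator is the left
  ideal \<open>J\<close> of the link. The condition \<open>sep\<close> says that \<open>v\<close> is not, up to elements of \<open>L\<close>,
  in the largest submodule on which \<open>\<Phi>\<close> vanishes. So among the functionals \<open>a \<Phi>\<close> of weight \<open>r\<close>
  there is one that vanishes on \<open>L\<close> but not at \<open>v\<close>. It is singular, because \<open>F\<close> and \<open>Y\<close> map \<open>N\<close>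
  into \<open>L\<close> as far as the weight \<open>r\<close> is concerned.\<close>

lemma pairing_link:
  fixes \<Phi> :: "'m \<Rightarrow> 'k"
  assumes N: "submodule N A M" and L: "submodule L A M" and LN: "L \<subseteq> N"
    and v: "v \<in> N" "v \<in> Wt r" and s: "s = q powi j * r"
    and \<Phi>_add: "\<And>x y. x \<in> N \<Longrightarrow> y \<in> N \<Longrightarrow> \<Phi> (x \<oplus>\<^bsub>M\<^esub> y) = \<Phi> x + \<Phi> y"
    and \<Phi>_sc: "\<And>c x. x \<in> N \<Longrightarrow> \<Phi> (sc c x) = c * \<Phi> x"
    and \<Phi>_pr: "\<And>x. x \<in> N \<Longrightarrow> \<Phi> x = \<Phi> (pr s x)"
    and \<Phi>_F: "\<And>x. x \<in> N \<Longrightarrow> \<Phi> (act lF x) = 0" and \<Phi>_Y: "\<And>x. x \<in> N \<Longrightarrow> \<Phi> (act lY x) = 0"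
    and L_F: "\<And>x. x \<in> N \<Longrightarrow> pr r (act lF x) \<in> L" and L_Y: "\<And>x. x \<in> N \<Longrightarrow> pr r (act lY x) \<in> L"
    and fin: "finite S" "gspan S = L \<inter> Wt r"
    and sep: "\<And>x y. x \<in> N \<Longrightarrow> y \<in> L \<Longrightarrow> v = x \<oplus>\<^bsub>M\<^esub> y \<Longrightarrow> \<exists>p. \<Phi> (act p x) \<noteq> 0"
  shows "singular_link s r"
proof -
  define t where "t = q powi (- j)"
  have t: "t \<noteq> 0" "inverse t = q powi j" using q_nonzero by (simp_all add: t_def power_int_minus)
  define hom where "hom = {d. lK * d - const t * d * lK \<in> I}"
  note Nc = submodule_subset[OF N] and N_act = submodule_act[OF N]
  have \<Phi>_0: "\<Phi> \<zero>\<^bsub>M\<^esub> = 0" using \<Phi>_sc[OF submodule_zero[OF N], of 0] by simp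
  have \<Phi>_minus: "\<Phi> (x \<ominus>\<^bsub>M\<^esub> y) = \<Phi> x - \<Phi> y" if "x \<in> N" "y \<in> N" for x y
    using \<Phi>_add[OF that(1) N_act[OF that(2), of "const (- 1)"]] \<Phi>_sc[OF that(2), of "- 1"] Nc[OF that(2)]
    by (simp add: sc_uminus M.minus_eq)
  have S: "S \<subseteq> L \<inter> Wt r" using G.subset_submodule_span[of S] fin(2) by simp
  define V where "V = N \<inter> Wt r"
  have V: "gsub V" unfolding V_def by (rule G.submodule_Int[OF gsub_if_submodule[OF N] gsub_Wt])
  have VN: "x \<in> N" if "x \<in> V" for x using that by (simp add: V_def)
  have SV: "S \<subseteq> V" using S LN by (auto simp: V_def)
  have vV: "v \<in> V" using v by (simp add: V_def)
  have iota_hom: "act (iota d) x \<in> Wt (q powi j * \<mu>)" if "d \<in> hom" "x \<in> Wt \<mu>" for d x \<mu>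
    using iota_homogeneous[OF _ t(1) that(2), of d] that(1) t(2) by (simp add: hom_def)
  \<comment> \<open>Elements of \<open>hom\<close> turn functionals of weight \<open>s\<close> into functionals of weight \<open>r\<close>.\<close>
  have "\<exists>a\<in>hom. (\<forall>x\<in>S. \<Phi> (act (iota a) x) = 0) \<and> \<Phi> (act (iota a) v) \<noteq> 0"
  proof (rule ccontr)
    assume contra: "\<not> ?thesis"
    define D where "D = {f. \<exists>d\<in>hom. \<forall>x\<in>V. f x = \<Phi> (act (iota d) x)}"
    have "\<exists>y\<in>gspan S. \<exists>x\<in>V. (\<forall>d\<in>D. d x = 0) \<and> v = x \<oplus>\<^bsub>M\<^esub> y"
    proof (rule functionals_separate[OF V _ _ _ fin(1) SV vV])
      fix f g c assume "f \<in> D" "g \<in> D"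
      then obtain d e where de: "d \<in> hom" "e \<in> hom" "\<forall>x\<in>V. f x = \<Phi> (act (iota d) x)" "\<forall>x\<in>V. g x = \<Phi> (act (iota e) x)"
        by (auto simp: D_def)
      have "lK * (d - const c * e) - const t * (d - const c * e) * lK
        = (lK * d - const t * d * lK) - (lK * (const c * e) - const t * (const c * e) * lK)"
        by (simp add: algebra_simps)
      also have "\<dots> \<in> I"
        unfolding eigenvector_scale
        by (rule I_minus[OF _ genideal_mult_left]) (use de(1,2) in \<open>simp_all add: hom_def\<close>)
      finally have "d - const c * e \<in> hom" by (simp add: hom_def)
      moreover have "f x - c * g x = \<Phi> (act (iota (d - const c * e)) x)" if x: "x \<in> V" for x
      proof -
        have "act (iota (d - const c * e)) x = act (iota d) x \<ominus>\<^bsub>M\<^esub> sc c (act (iota e) x)"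
          using Nc[OF VN[OF x]] by (simp add: iota_minus iota_mult act_minus act_mult act_sc[of _ "iota e"])
        then show ?thesis
          using de(3,4) x \<Phi>_minus[OF N_act[OF VN[OF x]] N_act[OF N_act[OF VN[OF x]]]] \<Phi>_sc[OF N_act[OF VN[OF x]]]
          by simp
      qed
      ultimately show "(\<lambda>x. f x - c * g x) \<in> D" unfolding D_def by blast
    next
      fix f x y assume "f \<in> D" "x \<in> V" "y \<in> V"
      then show "f (x \<oplus>\<^bsub>M\<^esub> y) = f x + f y"
        using G.submodule_add[OF V] Nc VN N_act by (auto simp: D_def act_plus_right \<Phi>_add)
    next
      fix f x c assume "f \<in> D" "x \<in> V"
      then show "f (sc c x) = c * f x"
        using gsub_sc[OF V] Nc VN N_act by (auto simp: D_def act_sc \<Phi>_sc)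
    next
      fix f assume "f \<in> D" "\<forall>s\<in>S. f s = 0"
      then show "f v = 0" using contra SV vV by (auto simp: D_def subset_iff)
    qed
    then obtain x y where xy: "y \<in> gspan S" "x \<in> V" "\<And>d. d \<in> D \<Longrightarrow> d x = 0" "v = x \<oplus>\<^bsub>M\<^esub> y" by blast
    have xN: "x \<in> N" "x \<in> Wt r" using xy(2) by (simp_all add: V_def)
    \<comment> \<open>Words of degree \<open>- j\<close> give members of \<open>D\<close>; all others move \<open>x\<close> to a weight space on which the
      functional is zero.\<close>
    have "\<Phi> (act (iota p) x) = 0" for p
    proof (induction p rule: free_induct_single)
      case (single w c)
      obtain gs where w: "w = Word gs" by (cases w)
      define e where "e = (\<Sum>g\<leftarrow>gs. gen_degree g)"
      let ?w = "Poly_Mapping.single (Word gs) c"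
      have Kw: "lK * ?w - const (q powi e) * ?w * lK \<in> I"
        by (rule mem_I_by_action) (simp add: reg.act_mult reg.K_word e_def)
      show ?case
      proof (cases "e = - j")
        case True
        then have "(\<lambda>x. \<Phi> (act (iota ?w) x)) \<in> D" using Kw by (auto simp: D_def hom_def t_def)
        then show ?thesis using xy(3) w by blast
      next
        case False
        have z: "act (iota ?w) x \<in> Wt (q powi (- e) * r)"
          using iota_homogeneous[OF Kw _ xN(2)] q_nonzero by (simp add: power_int_minus)
        have "r \<noteq> 0 \<Longrightarrow> q powi (- e) * r \<noteq> s" using False q_powi_inj[of "- e" j] by (auto simp: s)
        moreover have "r = 0 \<Longrightarrow> act (iota ?w) x = \<zero>\<^bsub>M\<^esub>" using Wt_zero_trivial z by simp
        ultimately have "pr s (act (iota ?w) x) = \<zero>\<^bsub>M\<^esub>" using pr_weight[OF z, of s] by (auto)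
        then show ?thesis using \<Phi>_pr[OF N_act[OF xN(1), of "iota ?w"]] \<Phi>_0 w by simp
      qed
    next
      case (add p p')
      then show ?case using \<Phi>_add[OF N_act[OF xN(1)] N_act[OF xN(1)]] Nc[OF xN(1)] by (simp add: iota_add act_add)
    qed
    then have "\<Phi> (act p x) = 0" for p
      using act_cong[OF iota_iota[of p]] by metis
    moreover have "y \<in> L" using xy(1) fin(2) by simp
    ultimately show False using sep[OF xN(1) _ xy(4)] by blast
  qed
  then obtain a where a: "a \<in> hom" "\<And>x. x \<in> S \<Longrightarrow> \<Phi> (act (iota a) x) = 0" "\<Phi> (act (iota a) v) \<noteq> 0" by blast
  have aL: "\<Phi> (act (iota a) x) = 0" if "x \<in> N" "pr r x \<in> L" for x
  proof -
    have xc: "x \<in> carrier M" by (rule Nc[OF that(1)])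
    let ?H = "{x \<in> N. \<Phi> (act (iota a) x) = 0}"
    have "gsub ?H"
      using Nc submodule_zero[OF N] submodule_add[OF N] N_act
      by (intro gsubI) (auto simp: \<Phi>_0 act_plus_right \<Phi>_add act_sc \<Phi>_sc)
    moreover have "S \<subseteq> ?H" using a(2) S LN by blast
    ultimately have "gspan S \<subseteq> ?H" by (rule G.submodule_span_minimal)
    then have "\<Phi> (act (iota a) (pr r x)) = 0" using fin(2) that(2) pr_Wt[OF xc] by blast
    moreover have "pr s (act (iota a) x) = act (iota a) (pr r x)"
      unfolding s by (rule pr_homogeneous[OF iota_hom[OF a(1)] _ xc]) (simp_all add: q_nonzero)
    ultimately show ?thesis using \<Phi>_pr[OF N_act[OF that(1)]] by simp
  qed
  define J where "J = {b. \<forall>x\<in>N. \<Phi> (act (iota b) x) = 0}"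
  have J: "left_ideal J"
    unfolding left_ideal_def J_def using Nc N_act
    by (auto simp: iota_add iota_mult act_add act_mult \<Phi>_add \<Phi>_0)
  have IJ: "I \<subseteq> J"
  proof
    fix p assume "p \<in> I"
    then have "act (iota p) = act 0" using iota_ideal by (intro act_cong) simp
    then show "p \<in> J" using Nc \<Phi>_0 by (simp add: J_def)
  qed
  have FK: "act (iota lE) x = act lF (act (- lK) x)" if "x \<in> N" for x
    using Nc[OF that] by (simp add: act_uminus act_mult act_neg_right)
  have KsJ: "lK - const s \<in> J"
    unfolding J_def
  proof (intro CollectI ballI)
    fix x assume x: "x \<in> N"
    have xc: "x \<in> carrier M" by (rule Nc[OF x])
    have "pr s (act lK x) = act lK (pr s x)" using pr_letter[OF xc, of "Uq_gen Gen_K" s] by simp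
    also have "\<dots> = sc s (pr s x)" using pr_Wt[OF xc, of s] by (simp add: Wt_iff)
    finally have "\<Phi> (act lK x) = s * \<Phi> x"
      using \<Phi>_pr[OF N_act[OF x]] \<Phi>_pr[OF x] \<Phi>_sc[OF pr_submodule[OF N x]] by simp
    then show "\<Phi> (act (iota (lK - const s)) x) = 0"
      using x xc \<Phi>_minus[OF N_act[OF x] N_act[OF x]] by (simp add: iota_minus act_minus \<Phi>_sc)
  qed
  have "lE \<in> J" unfolding J_def using FK \<Phi>_F[OF N_act] by simp
  moreover have "lX \<in> J" unfolding J_def using \<Phi>_Y by simp
  moreover have "a \<notin> J" unfolding J_def using a(3) v(1) by blast
  moreover have "lE * a \<in> J"
    unfolding J_def
  proof (intro CollectI ballI)
    fix x assume x: "x \<in> N"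
    have "act (iota (lE * a)) x = act (iota a) (act lF (act (- lK) x))"
      unfolding iota_mult act_mult[OF Nc[OF x]] FK[OF x] ..
    then show "\<Phi> (act (iota (lE * a)) x) = 0" using aL[OF N_act[OF N_act[OF x]] L_F[OF N_act[OF x]]] by simp
  qed
  moreover have "lX * a \<in> J"
    unfolding J_def using aL[OF N_act L_Y] Nc by (simp add: iota_mult act_mult)
  moreover have "(lK - const r) * a \<in> J"
  proof -
    have "t * s = r" using q_nonzero by (simp add: s t_def power_int_minus)
    then have "const t * a * const s = const r * a"
      by (metis const_commute const_mult mult.assoc)
    then have "(lK - const r) * a = (lK * a - const t * a * lK) + const t * a * (lK - const s)"
      by (simp add: algebra_simps)
    moreover have "lK * a - const t * a * lK \<in> J" using a(1) IJ by (auto simp: hom_def)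
    ultimately show ?thesis using J KsJ by (simp add: left_ideal_def)
  qed
  ultimately show ?thesis
    unfolding singular_link_def using J IJ KsJ by (intro exI[of _ J] exI[of _ a]) simp
qed

text \<open>The statement is proved by induction on the number of vectors in a finite set \<open>G\<close> that spans,
  modulo \<open>Q\<close>, the part of \<open>L = (A v + Q) \<inter> R\<close> in the weights above \<open>r\<close>. If there is nothing above
  \<open>r\<close>, then \<open>v\<close> itself is the lift. Otherwise let \<open>s\<close> be the highest weight in which \<open>L\<close> is
  not contained in \<open>Q\<close>, and let \<open>\<Phi>\<close> be the coefficient of some \<open>g \<in> G\<close> of weight \<open>s\<close>. If
  it is zero on \<open>L\<close>, then \<open>g\<close> may be removed from \<open>G\<close>. If not, then \<open>s\<close> occurs in \<open>R\<close> modulo \<open>Q\<close>,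
  so there is no link from \<open>s\<close> to \<open>r\<close>, and \<open>\<Phi>\<close> cannot satisfy the assumptions of
  \<open>pairing_link\<close>. Hence \<open>v\<close> can be changed by an element of \<open>L\<close> so that \<open>\<Phi>\<close>
  vanishes on the submodule generated by it, and again \<open>g\<close> may be removed.\<close>

lemma lift_singular:
  assumes Q: "submodule Q A M" and R: "submodule R A M" and QR: "Q \<subseteq> R" and r: "r \<noteq> 0"
    and fin_r: "finite S0" "S0 \<subseteq> carrier M" "Wt r \<subseteq> gspan S0"
    and no_link: "\<And>s w. w \<in> R \<Longrightarrow> w \<in> Wt s \<Longrightarrow> w \<notin> Q \<Longrightarrow> act lE w \<in> Q \<Longrightarrow> act lX w \<in> Q \<Longrightarrow>
      \<not> singular_link s r"
  shows "finite G \<Longrightarrow> G \<subseteq> carrier M \<Longrightarrow> v \<in> Wt r \<Longrightarrow> act lE v \<in> R \<Longrightarrow> act lX v \<in> R \<Longrightarrow>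
    (\<And>i x. i > 0 \<Longrightarrow> x \<in> cyc v <+>\<^bsub>M\<^esub> Q \<Longrightarrow> x \<in> R \<Longrightarrow> x \<in> Wt (q powi i * r) \<Longrightarrow>
      x \<in> gspan (G \<inter> Wt (q powi i * r)) <+>\<^bsub>M\<^esub> Q) \<Longrightarrow>
    \<exists>v'\<in>Wt r. v' \<ominus>\<^bsub>M\<^esub> v \<in> R \<and> act lE v' \<in> Q \<and> act lX v' \<in> Q"
proof (induction "card G" arbitrary: G v rule: less_induct)
  case less
  note finG = less.prems(1) and Gc = less.prems(2) and v = less.prems(3) and Ev = less.prems(4)
    and Xv = less.prems(5) and GW = less.prems(6)
  define wt where "wt i = q powi i * r" for i
  have wt_add: "q powi d * wt i = wt (d + i)" for d i
    by (simp add: wt_def power_int_add[OF disjI1[OF q_nonzero]])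
  have wt_inj: "wt i = wt j \<longleftrightarrow> i = j" for i j using r by (simp add: wt_def q_powi_inj)
  have vc: "v \<in> carrier M" using v by (rule Wt_carrier)
  define N where "N = cyc v <+>\<^bsub>M\<^esub> Q"
  have N: "submodule N A M" unfolding N_def by (rule submodule_set_add[OF submodule_cyc[OF vc] Q])
  have vN: "v \<in> N" and QN: "Q \<subseteq> N"
    using subset_set_add[OF submodule_cyc[OF vc] Q] mem_cyc[OF vc] by (auto simp: N_def)
  define L where "L = N \<inter> R"
  have L: "submodule L A M" unfolding L_def by (rule submodule_Int[OF N R])
  have QL: "Q \<subseteq> L" using QN QR by (simp add: L_def)
  note Nc = submodule_subset[OF N]
  have letter_wt: "act (letter g) x \<in> Wt (wt (gen_degree g + i))" if "x \<in> Wt (wt i)" for g x i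
    using act_letter_Wt[OF that, of g] by (simp add: wt_add)
  have pr_letter_wt: "pr (wt (gen_degree g + i)) (act (letter g) x) = act (letter g) (pr (wt i) x)"
    if "x \<in> carrier M" for g x i
    using pr_letter[OF that, of g "wt i"] by (simp add: wt_add)
  have prL: "pr (wt i) x \<in> L" if x: "x \<in> N" and i: "i > 0" for x i
  proof -
    obtain p y where py: "y \<in> Q" "x = act p v \<oplus>\<^bsub>M\<^esub> y"
      using x unfolding N_def set_add_iff cyc_def by blast
    have "wt i \<noteq> q powi (- int n) * r" for n using wt_inj[of i "- int n"] i by (simp add: wt_def)
    then have "pr (wt i) (act p v) \<in> R" by (rule pr_cyclic[OF R v Ev Xv])
    moreover have "pr (wt i) y \<in> R" using pr_submodule[OF Q py(1)] QR by blast
    ultimately have "pr (wt i) x \<in> R"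
      using submodule_add[OF R] vc submodule_subset[OF Q py(1)] by (simp add: py(2) pr_add)
    then show ?thesis using pr_submodule[OF N x] by (simp add: L_def)
  qed
  have GL: "x \<in> gspan (G \<inter> Wt (wt i)) <+>\<^bsub>M\<^esub> Q" if "i > 0" "x \<in> L" "x \<in> Wt (wt i)" for i x
    using GW[of i x] that by (simp add: L_def N_def wt_def)
  \<comment> \<open>The weights above \<open>r\<close> that prevent \<open>v\<close> from being a lift. Each of them needs a nonzero
    vector of \<open>G\<close>, so there are finitely many.\<close>
  define B where "B = {i. i > 0 \<and> \<not> L \<inter> Wt (wt i) \<subseteq> Q}"
  show ?case
  proof (cases "B = {}")
    case True
    have Bz: "x \<in> Q" if "i > 0" "x \<in> N" "x \<in> R" "x \<in> Wt (wt i)" for x i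
      using True that by (auto simp: B_def L_def)
    have "v \<in> Wt (wt 0)" using v by (simp add: wt_def)
    then have "act lE v \<in> Wt (wt 2)" "act lX v \<in> Wt (wt 1)"
      using letter_wt[of v 0 "Uq_gen Gen_E"] letter_wt[of v 0 Gen_X] by simp_all
    then have "act lE v \<in> Q" "act lX v \<in> Q"
      using Bz[of 2] Bz[of 1] Ev Xv submodule_act[OF N vN] by simp_all
    moreover have "v \<ominus>\<^bsub>M\<^esub> v \<in> R" using vc submodule_zero[OF R] by (simp add: M.minus_eq M.r_neg)
    ultimately show ?thesis using v by blast
  next
    case False
    have nz: "\<exists>g. g \<in> G \<inter> Wt (wt i) \<and> g \<noteq> \<zero>\<^bsub>M\<^esub>" if i: "i \<in> B" for i
    proof (rule ccontr)
      assume "\<not> ?thesis"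
      then have "gspan (G \<inter> Wt (wt i)) \<subseteq> {\<zero>\<^bsub>M\<^esub>}"
        by (intro G.submodule_span_minimal G.submodule_trivial) blast
      then have "L \<inter> Wt (wt i) \<subseteq> Q"
        using GL i submodule_subset[OF Q] by (fastforce simp: B_def set_add_iff)
      then show False using i by (simp add: B_def)
    qed
    define f where "f i = (SOME g. g \<in> G \<inter> Wt (wt i) \<and> g \<noteq> \<zero>\<^bsub>M\<^esub>)" for i
    have f: "f i \<in> G" "f i \<in> Wt (wt i)" "f i \<noteq> \<zero>\<^bsub>M\<^esub>" if "i \<in> B" for i
      using someI_ex[OF nz[OF that]] by (simp_all add: f_def)
    have "inj_on f B"
    proof (rule inj_onI)
      fix i j assume ij: "i \<in> B" "j \<in> B" "f i = f j"
      then have "wt i = wt j" using weight_unique[OF f(2)[OF ij(1)], of "wt j"] f[OF ij(1)] f(2)[OF ij(2)] by simp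
      then show "i = j" by (simp add: wt_inj)
    qed
    moreover have "finite (f ` B)" by (rule finite_subset[OF _ finG]) (use f(1) in blast)
    ultimately have finB: "finite B" using finite_imageD by blast
    define j where "j = Max B"
    have jB: "j \<in> B" unfolding j_def using finB False by (rule Max_in)
    have j: "j > 0" using jB by (simp add: B_def)
    have above: "x \<in> Q" if "i > j" "x \<in> L" "x \<in> Wt (wt i)" for i x
    proof -
      have "i \<notin> B" using Max_ge[OF finB, of i] that(1) by (auto simp: j_def)
      then show ?thesis using that j by (auto simp: B_def)
    qed
    define s where "s = wt j"
    define g where "g = f j"
    have g: "g \<in> G" "g \<in> Wt s" "g \<noteq> \<zero>\<^bsub>M\<^esub>" using f[OF jB] by (simp_all add: g_def s_def)
    have gc: "g \<in> carrier M" using g(2) by (rule Wt_carrier)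
    define G' where "G' = G - {g}"
    have G': "finite G'" "G' \<subseteq> carrier M" "card G' < card G"
      using finG Gc g(1) card_Diff1_less[OF finG g(1)] by (auto simp: G'_def)
    have G'_other: "G' \<inter> Wt (wt i) = G \<inter> Wt (wt i)" if "i \<noteq> j" for i
      using weight_unique[OF g(2) _ g(3), of "wt i"] that wt_inj[of j i] by (auto simp: G'_def s_def)
    have G_s: "G \<inter> Wt s = insert g (G' \<inter> Wt s)" using g by (auto simp: G'_def)
    define V where "V = gspan (G' \<inter> Wt s) <+>\<^bsub>M\<^esub> Q"
    have G'c: "G' \<inter> Wt s \<subseteq> carrier M" using G'(2) by blast
    note spG' = G.submodule_span_submodule[OF G'c]
    have V: "gsub V" unfolding V_def by (rule G.submodule_set_add[OF spG' gsub_if_submodule[OF Q]])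
    have QV: "Q \<subseteq> V" unfolding V_def by (rule G.subset_set_add(2)[OF spG' gsub_if_submodule[OF Q]])
    have coeff: "\<exists>c. x \<ominus>\<^bsub>M\<^esub> sc c g \<in> V" if x: "x \<in> L" "x \<in> Wt s" for x
    proof -
      obtain y z where yz: "y \<in> gspan (G \<inter> Wt s)" "z \<in> Q" "x = y \<oplus>\<^bsub>M\<^esub> z"
        using GL[OF j x(1)] x(2) unfolding s_def set_add_iff by blast
      obtain c u where cu: "u \<in> gspan (G' \<inter> Wt s)" "y = sc c g \<oplus>\<^bsub>M\<^esub> u"
        using yz(1) unfolding G_s gspan_insert_iff[OF gc G'c] by blast
      have "u \<in> carrier M" "z \<in> carrier M"
        using G.submodule_subset[OF spG' cu(1)] submodule_subset[OF Q yz(2)] by simp_all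
      then have "x \<ominus>\<^bsub>M\<^esub> sc c g = u \<oplus>\<^bsub>M\<^esub> z"
        using gc by (simp add: yz(3) cu(2) M.minus_eq M.a_ac M.r_neg M.r_neg1 M.r_neg2)
      then show ?thesis using cu(1) yz(2) by (auto simp: V_def set_add_iff)
    qed
    show ?thesis
    proof (cases "L \<inter> Wt s \<subseteq> V")
      case True
      show ?thesis
      proof (rule less.hyps[OF G'(3) G'(1,2) v Ev Xv])
        fix i x assume x: "i > 0" "x \<in> cyc v <+>\<^bsub>M\<^esub> Q" "x \<in> R" "x \<in> Wt (q powi i * r)"
        then have xL: "x \<in> L" "x \<in> Wt (wt i)" by (simp_all add: L_def N_def wt_def)
        show "x \<in> gspan (G' \<inter> Wt (q powi i * r)) <+>\<^bsub>M\<^esub> Q"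
        proof (cases "i = j")
          case True
          then show ?thesis using xL \<open>L \<inter> Wt s \<subseteq> V\<close> by (auto simp: V_def s_def wt_def)
        next
          case False
          then show ?thesis using GL[OF x(1) xL] G'_other[OF False] by (simp add: wt_def)
        qed
      qed
    next
      case False
      then obtain l where l: "l \<in> L" "l \<in> Wt s" "l \<notin> V" by blast
      have lc: "l \<in> carrier M" using l(2) by (rule Wt_carrier)
      have gV: "g \<notin> V"
      proof
        assume gV: "g \<in> V"
        obtain c where c: "l \<ominus>\<^bsub>M\<^esub> sc c g \<in> V" using coeff[OF l(1,2)] by blast
        have eq: "(l \<ominus>\<^bsub>M\<^esub> sc c g) \<oplus>\<^bsub>M\<^esub> sc c g = l" using lc gc by (simp add: M.minus_eq M.a_assoc M.l_neg)
        have "l \<in> V" using G.submodule_add[OF V c gsub_sc[OF V gV, of c]] by (simp only: eq)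
        then show False using l(3) by simp
      qed
      obtain \<phi> :: "'m \<Rightarrow> 'k" where \<phi>: "\<And>x c. x \<in> carrier M \<Longrightarrow> x \<ominus>\<^bsub>M\<^esub> sc c g \<in> V \<Longrightarrow> \<phi> x = c"
        using coefficient_functional[OF V gc gV] by blast
      define \<Phi> where "\<Phi> x = \<phi> (pr s x)" for x
      have prs: "pr s x \<in> L" "pr s x \<in> Wt s" "pr s x \<in> carrier M" if "x \<in> N" for x
        using prL[OF that j] pr_Wt[OF Nc[OF that]] pr_carrier[OF Nc[OF that]] by (simp_all add: s_def)
      have \<Phi>: "\<Phi> x = c" if "x \<in> N" "pr s x \<ominus>\<^bsub>M\<^esub> sc c g \<in> V" for x c
        unfolding \<Phi>_def by (rule \<phi>[OF prs(3)[OF that(1)] that(2)])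
      have \<Phi>_ex: "pr s x \<ominus>\<^bsub>M\<^esub> sc (\<Phi> x) g \<in> V" if x: "x \<in> N" for x
        using coeff[OF prs(1,2)[OF x]] \<Phi>[OF x] by blast
      have \<Phi>_V: "\<Phi> x = 0" if "x \<in> N" "pr s x \<in> V" for x
        using \<Phi>[OF that(1), of 0] that prs(3)[OF that(1)] gc by (simp add: M.minus_zero_right)
      have \<Phi>_add: "\<Phi> (x \<oplus>\<^bsub>M\<^esub> y) = \<Phi> x + \<Phi> y" if xy: "x \<in> N" "y \<in> N" for x y
      proof (rule \<Phi>[OF submodule_add[OF N xy]])
        have "pr s (x \<oplus>\<^bsub>M\<^esub> y) \<ominus>\<^bsub>M\<^esub> sc (\<Phi> x + \<Phi> y) g
          = (pr s x \<ominus>\<^bsub>M\<^esub> sc (\<Phi> x) g) \<oplus>\<^bsub>M\<^esub> (pr s y \<ominus>\<^bsub>M\<^esub> sc (\<Phi> y) g)"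
          using Nc[OF xy(1)] Nc[OF xy(2)] prs(3)[OF xy(1)] prs(3)[OF xy(2)] gc
          by (simp add: pr_add sc_add M.minus_eq M.minus_add M.a_ac)
        then show "pr s (x \<oplus>\<^bsub>M\<^esub> y) \<ominus>\<^bsub>M\<^esub> sc (\<Phi> x + \<Phi> y) g \<in> V"
          using G.submodule_add[OF V \<Phi>_ex[OF xy(1)] \<Phi>_ex[OF xy(2)]] by simp
      qed
      have \<Phi>_sc: "\<Phi> (sc c x) = c * \<Phi> x" if x: "x \<in> N" for c x
      proof (rule \<Phi>[OF submodule_act[OF N x]])
        have "pr s (sc c x) \<ominus>\<^bsub>M\<^esub> sc (c * \<Phi> x) g = sc c (pr s x \<ominus>\<^bsub>M\<^esub> sc (\<Phi> x) g)"
          using Nc[OF x] prs(3)[OF x] gc by (simp add: pr_sc act_minus_right sc_sc)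
        then show "pr s (sc c x) \<ominus>\<^bsub>M\<^esub> sc (c * \<Phi> x) g \<in> V" using gsub_sc[OF V \<Phi>_ex[OF x]] by simp
      qed
      have \<Phi>_pr: "\<Phi> x = \<Phi> (pr s x)" if "x \<in> N" for x
        using pr_weight[OF prs(2)[OF that], of s] by (simp add: \<Phi>_def)
      \<comment> \<open>Lowering generators reach the weight \<open>s\<close> only from higher weights, where \<open>N\<close> is in \<open>Q\<close>.\<close>
      have \<Phi>_letter: "\<Phi> (act (letter h) x) = 0" if x: "x \<in> N" and h: "gen_degree h < 0" for x h
      proof -
        have "pr (wt (j - gen_degree h)) x \<in> Q"
          using above[of "j - gen_degree h"] prL[OF x, of "j - gen_degree h"] h j pr_Wt[OF Nc[OF x]] by simp
        then have "act (letter h) (pr (wt (j - gen_degree h)) x) \<in> V" using submodule_act[OF Q] QV by blast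
        then have "pr s (act (letter h) x) \<in> V"
          using pr_letter_wt[OF Nc[OF x], of h "j - gen_degree h"] by (simp add: s_def)
        then show ?thesis by (rule \<Phi>_V[OF submodule_act[OF N x]])
      qed
      have L_letter: "pr r (act (letter h) x) \<in> L" if x: "x \<in> N" and h: "gen_degree h < 0" for x h
        using pr_letter_wt[OF Nc[OF x], of h "- gen_degree h"] submodule_act[OF L prL[OF x, of "- gen_degree h"]] h
        by (simp add: wt_def)
      \<comment> \<open>For the same reason \<open>E\<close> and \<open>X\<close> map \<open>l\<close> into \<open>Q\<close>.\<close>
      have no: "\<not> singular_link s r"
      proof (rule no_link[OF _ l(2)])
        have "act lE l \<in> Wt (wt (2 + j))" "act lX l \<in> Wt (wt (1 + j))"
          using letter_wt[of l j "Uq_gen Gen_E"] letter_wt[of l j Gen_X] l(2) by (simp_all add: s_def)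
        then show "act lE l \<in> Q" "act lX l \<in> Q"
          using above[of "2 + j"] above[of "1 + j"] submodule_act[OF L l(1)] by simp_all
      qed (use l QV in \<open>auto simp: L_def\<close>)
      \<comment> \<open>The largest submodule of \<open>N\<close> on which the functional vanishes.\<close>
      define N' where "N' = {x \<in> N. \<forall>p. \<Phi> (act p x) = 0}"
      have N': "submodule N' A M"
      proof (rule submodule_by_letters)
        show "N' \<subseteq> carrier M" using Nc by (auto simp: N'_def)
        have "\<Phi> \<zero>\<^bsub>M\<^esub> = 0"
          using \<Phi>_V[OF submodule_zero[OF N]] G.submodule_zero[OF V] by simp
        then show "\<zero>\<^bsub>M\<^esub> \<in> N'" using submodule_zero[OF N] by (simp add: N'_def)
      next
        fix x y assume "x \<in> N'" "y \<in> N'"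
        then show "x \<oplus>\<^bsub>M\<^esub> y \<in> N'"
          using Nc submodule_add[OF N] submodule_act[OF N] by (simp add: N'_def act_plus_right \<Phi>_add)
      next
        fix c x assume "x \<in> N'"
        then show "sc c x \<in> N'"
          using Nc submodule_act[OF N] by (simp add: N'_def flip: act_mult)
      next
        fix h x assume "x \<in> N'"
        then show "act (letter h) x \<in> N'"
          using Nc submodule_act[OF N] by (simp add: N'_def flip: act_mult)
      qed
      have QN': "Q \<subseteq> N'"
      proof
        fix y assume y: "y \<in> Q"
        have "\<Phi> (act p y) = 0" for p
          using \<Phi>_V[of "act p y"] pr_submodule[OF Q submodule_act[OF Q y]] submodule_act[OF Q y] QV QN by blast
        then show "y \<in> N'" using y QN by (auto simp: N'_def)
      qed
      show ?thesis
      proof (cases "v \<in> L <+>\<^bsub>M\<^esub> N'")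
        case True
        then obtain x v' where xv: "x \<in> L" "x \<in> Wt r" "v' \<in> N'" "v' \<in> Wt r" "v = x \<oplus>\<^bsub>M\<^esub> v'"
          using weight_vector_in_sum[OF L N' v] by blast
        have c: "x \<in> carrier M" "v' \<in> carrier M" using xv(2,4) Wt_carrier by blast+
        have xR: "x \<in> R" using xv(1) by (simp add: L_def)
        have v'_eq: "v' = v \<ominus>\<^bsub>M\<^esub> x" using c by (simp add: xv(5) M.minus_eq M.a_ac M.r_neg M.r_neg1 M.r_neg2)
        have actR: "act p v' \<in> R" if "act p v \<in> R" for p
          unfolding v'_eq using submodule_minus[OF R that submodule_act[OF R xR]] vc c by (simp add: act_minus_right)
        have sub: "cyc v' <+>\<^bsub>M\<^esub> Q \<subseteq> N'"
          by (rule set_add_subset[OF N' cyc_minimal[OF N' xv(3)] QN'])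
        \<comment> \<open>The submodule generated by \<open>v'\<close> and \<open>Q\<close> is in \<open>N'\<close>, whose vectors of weight \<open>s\<close> in \<open>R\<close> do not
          involve \<open>g\<close>.\<close>
        have "\<exists>v''\<in>Wt r. v'' \<ominus>\<^bsub>M\<^esub> v' \<in> R \<and> act lE v'' \<in> Q \<and> act lX v'' \<in> Q"
        proof (rule less.hyps[OF G'(3) G'(1,2) xv(4) actR[OF Ev] actR[OF Xv]])
          fix i y assume y: "i > 0" "y \<in> cyc v' <+>\<^bsub>M\<^esub> Q" "y \<in> R" "y \<in> Wt (q powi i * r)"
          have yN': "y \<in> N'" using y(2) sub by blast
          then have yL: "y \<in> L" "y \<in> Wt (wt i)" using y(3,4) by (auto simp: L_def N'_def wt_def)
          show "y \<in> gspan (G' \<inter> Wt (q powi i * r)) <+>\<^bsub>M\<^esub> Q"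
          proof (cases "i = j")
            case True
            have ys: "y \<in> Wt s" and yN: "y \<in> N" using yL True yN' by (simp_all add: s_def N'_def)
            have "\<Phi> (act 1 y) = 0" using yN' unfolding N'_def by blast
            then have "\<Phi> y = 0" using Nc[OF yN] by simp
            moreover have "pr s y = y" using pr_weight[OF ys] by simp
            ultimately have "y \<in> V" using \<Phi>_ex[OF yN] Nc[OF yN] gc by (simp add: M.minus_zero_right)
            then show ?thesis using True by (simp add: V_def s_def wt_def)
          next
            case False
            then show ?thesis using GL[OF y(1) yL] G'_other[OF False] by (simp add: wt_def)
          qed
        qed
        then obtain v'' where v'': "v'' \<in> Wt r" "v'' \<ominus>\<^bsub>M\<^esub> v' \<in> R" "act lE v'' \<in> Q" "act lX v'' \<in> Q" by blast
        have "v'' \<ominus>\<^bsub>M\<^esub> v = (v'' \<ominus>\<^bsub>M\<^esub> v') \<ominus>\<^bsub>M\<^esub> x"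
          using c Wt_carrier[OF v''(1)] by (simp add: xv(5) M.minus_eq M.minus_add M.a_ac)
        then have "v'' \<ominus>\<^bsub>M\<^esub> v \<in> R" using submodule_minus[OF R v''(2) xR] by simp
        then show ?thesis using v'' by blast
      next
        case False
        obtain S where S: "finite S" "gspan S = L \<inter> Wt r"
          using finite_spanning_subspace[OF fin_r(1,2) G.submodule_Int[OF gsub_if_submodule[OF L] gsub_Wt[of r]]]
            fin_r(3) by blast
        have "singular_link s r"
        proof (rule pairing_link[OF N L _ vN v _ \<Phi>_add \<Phi>_sc \<Phi>_pr _ _ _ _ S])
          show "s = q powi j * r" by (simp add: s_def wt_def)
          fix x y assume xy: "x \<in> N" "y \<in> L" "v = x \<oplus>\<^bsub>M\<^esub> y"
          have "x \<notin> N'"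
          proof
            assume "x \<in> N'"
            moreover have "v = y \<oplus>\<^bsub>M\<^esub> x" using xy Nc submodule_subset[OF L] by (simp add: M.a_comm)
            ultimately show False using False xy(2) by (auto simp: set_add_iff)
          qed
          then show "\<exists>p. \<Phi> (act p x) \<noteq> 0" using xy(1) by (simp add: N'_def)
        qed (simp_all add: \<Phi>_letter L_letter, simp add: L_def)
        then show ?thesis using no by simp
      qed
    qed
  qed
qed

end

section \<open>Verma modules and their simple quotients\<close>

context left_module_hom
begin

lemma hom_comp:
  assumes "left_module_hom R N P g" shows "left_module_hom R M P (g \<circ> h)"
proof -
  interpret g: left_module_hom R N P g by (rule assms)
  show ?thesis
    by (intro left_module_hom.intro left_module_hom_axioms.intro dom.left_module_axioms g.cod.left_module_axioms)
      (simp add: module_homs_def hom_closed hom_add hom_smult g.hom_closed g.hom_add g.hom_smult)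
qed

lemma ker_quotient_comp:
  assumes J: "submodule J R M" "ker \<subseteq> J"
  shows "left_module_hom.ker M (quotient_module N (h ` J)) ((\<lambda>x. (h ` J) +>\<^bsub>N\<^esub> x) \<circ> h) = J"
proof -
  let ?Q = "quotient_module N (h ` J)" and ?g = "\<lambda>x. (h ` J) +>\<^bsub>N\<^esub> x"
  note hJ = submodule_image[OF J(1)]
  interpret g: left_module_hom R N ?Q ?g by (rule cod.left_module_hom_quotient[OF hJ])
  interpret gh: left_module_hom R M ?Q "?g \<circ> h" by (rule hom_comp[OF g.left_module_hom_axioms])
  have "x \<in> gh.ker \<longleftrightarrow> x \<in> J" if x: "x \<in> carrier M" for x
  proof -
    have "x \<in> gh.ker \<longleftrightarrow> h x \<in> g.ker" using x hom_closed[OF x] by (simp add: gh.ker_def g.ker_def)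
    also have "\<dots> \<longleftrightarrow> x \<in> J" using cod.ker_quotient[OF hJ] mem_image_iff[OF J x] by simp
    finally show ?thesis .
  qed
  moreover have "gh.ker \<subseteq> carrier M" by (simp add: gh.ker_def)
  ultimately show ?thesis using dom.submodule_subset[OF J(1)] by blast
qed

end

lemma (in osc_params) hom_act:
  assumes "osc_module q C0 P" "osc_module q C0 S" "left_module_hom A P S h" "x \<in> carrier P"
  shows "h (osc_module.act q C0 P p x) = osc_module.act q C0 S p (h x)"
proof -
  interpret P: osc_module q C0 P by fact
  interpret S: osc_module q C0 S by fact
  interpret h: left_module_hom A P S h by fact
  show ?thesis using h.hom_smult assms(4) by (simp add: P.act_def S.act_def)
qed

lemma (in osc_params) osc_moduleI: "left_module A S \<Longrightarrow> osc_module q C0 S"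
  using osc_params_axioms by (simp add: osc_module_def)

lemma (in osc_central_module) weight_module_if_highest_weight:
  assumes "w \<in> Wt r" "act lE w = \<zero>\<^bsub>M\<^esub>" "act lX w = \<zero>\<^bsub>M\<^esub>" "carrier M \<subseteq> cyc w"
  shows "osc_central_weight_module q C0 M"
proof -
  let ?D = "{x. \<exists>n. descends {\<zero>\<^bsub>M\<^esub>} w n x}"
  have w: "submodule {\<zero>\<^bsub>M\<^esub>} A M" "w \<in> Wt r" "act lE w \<in> {\<zero>\<^bsub>M\<^esub>}" "act lX w \<in> {\<zero>\<^bsub>M\<^esub>}"
    using assms submodule_trivial by simp_all
  have "?D \<subseteq> (\<Union>r. Wt r)"
  proof
    fix x assume "x \<in> ?D"
    then obtain n where "descends {\<zero>\<^bsub>M\<^esub>} w n x" by blast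
    from descends_weight[OF w this] obtain z where "z \<in> Wt (q powi (- n) * r)" "x = \<zero>\<^bsub>M\<^esub> \<oplus>\<^bsub>M\<^esub> z" by blast
    then show "x \<in> (\<Union>r. Wt r)" using Wt_carrier by auto
  qed
  then have "gspan ?D \<subseteq> gspan (\<Union>r. Wt r)" by (rule G.submodule_span_mono)
  moreover have "carrier M \<subseteq> gspan ?D"
    using assms(4) act_in_gspan_descends[OF w] by (auto simp: cyc_def)
  moreover have "gspan (\<Union>r. Wt r) \<subseteq> carrier M" using Wt_carrier by (intro gspan_subset_carrier) blast
  ultimately have "gspan (\<Union>r. Wt r) = carrier M" by blast
  then show ?thesis
    by (intro osc_central_weight_module.intro weight_module.intro weight_module_axioms.intro
        osc_module_axioms osc_central_module_axioms)
qed

context osc_central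
begin

lemma osc_central_moduleI: "left_module A S \<Longrightarrow> osc_central_module q C0 S"
  using osc_moduleI osc_central_axioms by (simp add: osc_central_module_def)

abbreviation "Z t \<equiv> verma q C0 t"

lemma verma_ideal_eq:
  "verma_ideal q C0 t = {cls (a * lE + b * lX + c * (lK - const t)) | a b c. True}"
proof -
  have "osc_gen q C0 (Uq_gen Gen_K) \<ominus>\<^bsub>A\<^esub> osc_scalar q C0 t = cls (lK - const t)"
    by (simp add: osc_gen_def osc_scalar_def a_minus_def A_uminus A_simps)
  then show ?thesis
    unfolding verma_ideal_def Let_def
    by (auto simp: A_simps osc_gen_def; metis A_simps(2,3) rangeI)
qed

lemma verma_ideal_generators:
  "cls (p * lE) \<in> verma_ideal q C0 t" "cls (p * lX) \<in> verma_ideal q C0 t" "cls (p * (lK - const t)) \<in> verma_ideal q C0 t"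
proof -
  have "cls (a * lE + b * lX + c * (lK - const t)) \<in> verma_ideal q C0 t" for a b c
    unfolding verma_ideal_eq by blast
  from this[of p 0 0] this[of 0 p 0] this[of 0 0 p]
  show "cls (p * lE) \<in> verma_ideal q C0 t" "cls (p * lX) \<in> verma_ideal q C0 t"
    "cls (p * (lK - const t)) \<in> verma_ideal q C0 t" by simp_all
qed

lemma submodule_verma_ideal: "submodule (verma_ideal q C0 t) A RM"
proof -
  let ?V = "verma_ideal q C0 t"
  have V: "cls (a * lE + b * lX + c * (lK - const t)) \<in> ?V" for a b c unfolding verma_ideal_eq by blast
  have plus: "cls p \<oplus>\<^bsub>RM\<^esub> cls p' = cls (p + p')" for p p' by (simp add: regular_module_def A_simps)
  show ?thesis
  proof (rule reg.submodule_by_letters)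
    show "?V \<subseteq> carrier RM" unfolding verma_ideal_eq reg_carrier by blast
    show "\<zero>\<^bsub>RM\<^esub> \<in> ?V" using V[of 0 0 0] by (simp add: regular_module_def A_simps)
  next
    fix x y assume "x \<in> ?V" "y \<in> ?V"
    then obtain a b c a' b' c' where "x = cls (a * lE + b * lX + c * (lK - const t))"
      "y = cls (a' * lE + b' * lX + c' * (lK - const t))" unfolding verma_ideal_eq by blast
    then have "x \<oplus>\<^bsub>RM\<^esub> y = cls ((a + a') * lE + (b + b') * lX + (c + c') * (lK - const t))"
      by (simp add: plus algebra_simps)
    then show "x \<oplus>\<^bsub>RM\<^esub> y \<in> ?V" using V by simp
  next
    have act: "reg.act p x \<in> ?V" if x: "x \<in> ?V" for p x
    proof -
      obtain a b c where "x = cls (a * lE + b * lX + c * (lK - const t))" using x unfolding verma_ideal_eq by blast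
      then have "reg.act p x = cls ((p * a) * lE + (p * b) * lX + (p * c) * (lK - const t))"
        by (simp add: reg_act distrib_left mult.assoc)
      then show ?thesis using V by simp
    qed
    show "reg.act (const c) x \<in> ?V" "reg.act (letter g) x \<in> ?V" if "x \<in> ?V" for c g x
      by (rule act[OF that])+
  qed
qed

definition to_verma :: "'k \<Rightarrow> 'k osc_elt \<Rightarrow> 'k osc_elt set" where
  "to_verma t x = verma_ideal q C0 t +>\<^bsub>RM\<^esub> x"

lemma to_verma_hom: "left_module_hom A RM (Z t) (to_verma t)"
  unfolding verma_def to_verma_def[abs_def] by (rule reg.left_module_hom_quotient[OF submodule_verma_ideal])

lemma to_verma_ker: "left_module_hom.ker RM (Z t) (to_verma t) = verma_ideal q C0 t"
  unfolding verma_def to_verma_def[abs_def] by (rule reg.ker_quotient[OF submodule_verma_ideal])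

lemma to_verma_surj: "to_verma t ` carrier RM = carrier (Z t)"
  unfolding verma_def to_verma_def[abs_def] by (rule reg.quotient_carrier[OF submodule_verma_ideal, symmetric])

lemma left_module_verma: "left_module A (Z t)"
  unfolding verma_def by (rule reg.left_module_quotient[OF submodule_verma_ideal])

lemma verma_act: "osc_module.act q C0 (Z t) p (to_verma t (cls p')) = to_verma t (cls (p * p'))"
  using hom_act[OF reg.osc_module_axioms osc_moduleI[OF left_module_verma] to_verma_hom, of "cls p'" t p]
  by (simp add: reg_carrier reg_act)

lemma to_verma_zero_iff: "to_verma t (cls p) = \<zero>\<^bsub>Z t\<^esub> \<longleftrightarrow> cls p \<in> verma_ideal q C0 t"
proof -
  interpret h: left_module_hom A RM "Z t" "to_verma t" by (rule to_verma_hom)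
  show ?thesis using to_verma_ker[of t] by (auto simp: h.ker_def reg_carrier)
qed

lemma verma_highest_weight_vector:
  shows "osc_central_weight_module q C0 (Z t)"
    and "to_verma t (cls 1) \<in> weight_space q C0 (Z t) t"
    and "osc_module.act q C0 (Z t) lE (to_verma t (cls 1)) = \<zero>\<^bsub>Z t\<^esub>"
    and "osc_module.act q C0 (Z t) lX (to_verma t (cls 1)) = \<zero>\<^bsub>Z t\<^esub>"
    and "carrier (Z t) = osc_module.cyc q C0 (Z t) (to_verma t (cls 1))"
proof -
  interpret Z: osc_central_module q C0 "Z t" by (rule osc_central_moduleI[OF left_module_verma])
  let ?w = "to_verma t (cls 1)"
  have w: "?w \<in> carrier (Z t)" using to_verma_surj[of t] by (auto simp: reg_carrier)
  have "Z.act (lK - const t) ?w = \<zero>\<^bsub>Z t\<^esub>"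
    using verma_ideal_generators(3)[of 1 t] by (simp add: verma_act to_verma_zero_iff)
  then show W: "?w \<in> weight_space q C0 (Z t) t" using w by (simp add: Z.Wt_iff Z.act_minus Z.minus_eq_zero_iff)
  show E: "Z.act lE ?w = \<zero>\<^bsub>Z t\<^esub>" and X: "Z.act lX ?w = \<zero>\<^bsub>Z t\<^esub>"
    using verma_ideal_generators(1,2)[of 1 t] by (simp_all add: verma_act to_verma_zero_iff)
  show c: "carrier (Z t) = Z.cyc ?w"
    using to_verma_surj[of t] by (auto simp: Z.cyc_def verma_act reg_carrier)
  show "osc_central_weight_module q C0 (Z t)"
    by (rule Z.weight_module_if_highest_weight[OF W E X]) (simp add: c)
qed

text \<open>A vector of weight \<open>t\<close> in \<open>Z(t)\<close> is a multiple of the generator, so a proper submodule contains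
  no such vector except zero, and the generator cannot be a sum of weight vectors from two of
  them.\<close>

lemma verma_sum_proper:
  assumes t: "t \<noteq> 0" and N: "submodule N A (Z t)" "N \<noteq> carrier (Z t)"
    and N': "submodule N' A (Z t)" "N' \<noteq> carrier (Z t)"
  shows "N <+>\<^bsub>Z t\<^esub> N' \<noteq> carrier (Z t)"
proof
  interpret Z: osc_central_weight_module q C0 "Z t" by (rule verma_highest_weight_vector)
  define w where "w = to_verma t (cls 1)"
  note hw = verma_highest_weight_vector[of t, folded w_def]
  have wc: "w \<in> carrier (Z t)" using hw(2) by (rule Z.Wt_carrier)
  have zero: "h = \<zero>\<^bsub>Z t\<^esub>" if "submodule H A (Z t)" "H \<noteq> carrier (Z t)" "h \<in> H" "h \<in> Z.Wt t" for H h
  proof (rule ccontr)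
    assume h0: "h \<noteq> \<zero>\<^bsub>Z t\<^esub>"
    have hc: "h \<in> carrier (Z t)" using that(4) by (rule Z.Wt_carrier)
    then obtain p where "h = Z.act p w" using hw(5) by (auto simp: Z.cyc_def)
    then obtain c where "Z.pr t h \<ominus>\<^bsub>Z t\<^esub> Z.sc c w \<in> {\<zero>\<^bsub>Z t\<^esub>}"
      using Z.pr_cyclic_top[OF Z.submodule_trivial hw(2) _ _ t, of p] hw(3,4) by auto
    then have h: "h = Z.sc c w" using Z.pr_weight[OF that(4), of t] hc wc by (simp add: Z.minus_eq_zero_iff)
    then have "c \<noteq> 0" using h0 wc by auto
    then have "w = Z.sc (inverse c) h" using wc by (simp add: h Z.sc_sc)
    then have "w \<in> H" using Z.submodule_act[OF that(1,3), of "const (inverse c)"] by simp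
    then have "carrier (Z t) \<subseteq> H" unfolding hw(5) by (rule Z.cyc_minimal[OF that(1)])
    then show False using that(1,2) Z.submodule_subset by blast
  qed
  assume "N <+>\<^bsub>Z t\<^esub> N' = carrier (Z t)"
  then have "w \<in> N <+>\<^bsub>Z t\<^esub> N'" using wc by simp
  then obtain h n where hn: "h \<in> N" "h \<in> Z.Wt t" "n \<in> N'" "n \<in> Z.Wt t" "w = h \<oplus>\<^bsub>Z t\<^esub> n"
    using Z.weight_vector_in_sum[OF N(1) N'(1) hw(2)] by blast
  then have "w = \<zero>\<^bsub>Z t\<^esub>" using zero[OF N hn(1,2)] zero[OF N' hn(3,4)] by simp
  then have "w \<in> N" using Z.submodule_zero[OF N(1)] by simp
  then have "carrier (Z t) \<subseteq> N" unfolding hw(5) by (rule Z.cyc_minimal[OF N(1)])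
  then show False using N Z.submodule_subset by blast
qed

text \<open>The simple module is generated by \<open>w\<close> and hence the quotient of \<open>Z(t)\<close> by a maximal submodule
  \<open>N\<close>. Two different maximal submodules would have the sum \<open>Z(t)\<close>, so \<open>N\<close> is the submodule
  that defines \<open>V(t)\<close>.\<close>

lemma simple_module_with_highest_weight:
  assumes S: "simple_module A S" and w: "w \<in> carrier S" "w \<noteq> \<zero>\<^bsub>S\<^esub>"
    and hw: "osc_module.act q C0 S (lK - const t) w = \<zero>\<^bsub>S\<^esub>" "osc_module.act q C0 S lE w = \<zero>\<^bsub>S\<^esub>"
      "osc_module.act q C0 S lX w = \<zero>\<^bsub>S\<^esub>"
  shows "t \<noteq> 0" "module_iso A S (simple_V q C0 t)" "simple_V q C0 t \<in> subquotients A (Z t)"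
    "left_module A (simple_V q C0 t)"
proof -
  have "left_module A S" using S by (simp add: simple_module_def)
  then interpret S: osc_central_module q C0 S by (rule osc_central_moduleI)
  interpret Z: osc_central_weight_module q C0 "Z t" by (rule verma_highest_weight_vector)
  have "w \<in> S.Wt t" using hw(1) w(1) by (simp add: S.Wt_iff S.act_minus S.minus_eq_zero_iff)
  then show t: "t \<noteq> 0" using S.Wt_zero_trivial w(2) by blast
  define f where "f a = a \<odot>\<^bsub>S\<^esub> w" for a
  have f: "left_module_hom A RM S f"
    using w(1) by (intro left_module_hom.intro left_module_hom_axioms.intro reg.left_module_axioms S.left_module_axioms)
      (auto simp: module_homs_def f_def regular_module_def S.smult_closed S.smult_l_distr S.smult_assoc)
  interpret f: left_module_hom A RM S f by (rule f)
  have f_cls: "f (cls p) = S.act p w" for p by (simp add: f_def S.act_def)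
  have fc: "f ` carrier RM = S.cyc w" by (simp add: reg_carrier image_image f_cls S.cyc_def)
  have "S.cyc w \<noteq> {\<zero>\<^bsub>S\<^esub>}" using S.mem_cyc[OF w(1)] w(2) by blast
  then have f_surj: "f ` carrier RM = carrier S"
    using S S.submodule_cyc[OF w(1)] unfolding fc simple_module_def by blast
  interpret p: left_module_hom A RM "Z t" "to_verma t" by (rule to_verma_hom)
  have "verma_ideal q C0 t \<subseteq> f.ker"
    unfolding verma_ideal_eq f.ker_def using w(1) hw
    by (auto simp: reg_carrier f_cls S.act_add S.act_mult)
  then have sub: "p.ker \<subseteq> f.ker" by (simp add: to_verma_ker)
  define N where "N = to_verma t ` f.ker"
  have N: "submodule N A (Z t)" unfolding N_def by (rule p.submodule_image[OF f.submodule_ker])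
  define g where "g x = N +>\<^bsub>Z t\<^esub> x" for x
  let ?V = "quotient_module (Z t) N"
  have g: "left_module_hom A (Z t) ?V g" unfolding g_def[abs_def] by (rule Z.left_module_hom_quotient[OF N])
  have gp: "left_module_hom A RM ?V (g \<circ> to_verma t)" by (rule p.hom_comp[OF g])
  have gp_ker: "left_module_hom.ker RM ?V (g \<circ> to_verma t) = f.ker"
    using p.ker_quotient_comp[OF f.submodule_ker sub] by (simp add: g_def[abs_def] N_def)
  have g_surj: "g ` carrier (Z t) = carrier ?V" unfolding g_def[abs_def] by (rule Z.quotient_carrier[OF N, symmetric])
  then have gp_surj: "(g \<circ> to_verma t) ` carrier RM = carrier ?V" by (simp only: image_comp[symmetric] to_verma_surj)
  have iso: "module_iso A S ?V"
    by (rule module_iso_of_same_ker[OF f gp f_surj gp_surj gp_ker[symmetric]])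
  have simp: "simple_module A ?V"
    using S unfolding f.simple_iff_maximal_ker[OF f_surj] left_module_hom.simple_iff_maximal_ker[OF gp gp_surj] gp_ker .
  have maximal: "H \<noteq> carrier (Z t) \<and> (\<forall>H'. submodule H' A (Z t) \<longrightarrow> H \<subseteq> H' \<longrightarrow> H' = H \<or> H' = carrier (Z t))"
    if H: "submodule H A (Z t)" "simple_module A (quotient_module (Z t) H)" for H
    using left_module_hom.simple_iff_maximal_ker[OF Z.left_module_hom_quotient[OF H(1)] Z.quotient_carrier[OF H(1), symmetric]]
      H(2) Z.ker_quotient[OF H(1)] by simp
  have "(THE N. submodule N A (Z t) \<and> simple_module A (quotient_module (Z t) N)) = N"
  proof (rule the_equality)
    show "submodule N A (Z t) \<and> simple_module A ?V" using N simp by blast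
    fix H assume H: "submodule H A (Z t) \<and> simple_module A (quotient_module (Z t) H)"
    note mH = maximal[OF conjunct1[OF H] conjunct2[OF H]] and mN = maximal[OF N simp]
    have sm: "submodule (H <+>\<^bsub>Z t\<^esub> N) A (Z t)" by (rule Z.submodule_set_add[OF conjunct1[OF H] N])
    note sub = Z.subset_set_add[OF conjunct1[OF H] N]
    have "H <+>\<^bsub>Z t\<^esub> N \<noteq> carrier (Z t)" 
      by (rule verma_sum_proper[OF t conjunct1[OF H] conjunct1[OF mH] N conjunct1[OF mN]])
    then have "H <+>\<^bsub>Z t\<^esub> N = H" "H <+>\<^bsub>Z t\<^esub> N = N"
      using conjunct2[OF mH, rule_format, OF sm sub(1)] conjunct2[OF mN, rule_format, OF sm sub(2)] by simp_all
    then show "H = N" by simp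
  qed
  then have V: "simple_V q C0 t = ?V" by (simp add: simple_V_def)
  show "module_iso A S (simple_V q C0 t)" unfolding V by (rule iso)
  show "left_module A (simple_V q C0 t)" unfolding V by (rule Z.left_module_quotient[OF N])
  have "?V = quotient_module (Z t\<lparr>carrier := carrier (Z t)\<rparr>) N" by simp
  then show "simple_V q C0 t \<in> subquotients A (Z t)"
    unfolding V subquotients_def using N Z.submodule_carrier Z.submodule_subset[OF N] by blast
qed

end

context osc_central_module
begin

text \<open>Within the submodule generated by \<open>w\<close> and \<open>L\<close>, choose \<open>L'\<close> maximal among the submodules that
  contain \<open>L\<close> but not \<open>w\<close>. Every larger submodule contains \<open>w\<close> and \<open>L\<close>, so the quotient by \<open>L'\<close>
  is simple, and the image of \<open>w\<close> is a highest weight vector.\<close>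

lemma simple_subquotient:
  assumes L: "submodule L A M" and w: "w \<in> carrier M" "w \<notin> L"
    and hw: "act (lK - const t) w \<in> L" "act lE w \<in> L" "act lX w \<in> L"
  shows "\<exists>S\<in>subquotients A M. simple_module A S \<and> module_iso A S (simple_V q C0 t)"
    "simple_V q C0 t \<in> subquotients A (verma q C0 t)" "left_module A (simple_V q C0 t)" "t \<noteq> 0"
proof -
  define H where "H = cyc w <+>\<^bsub>M\<^esub> L"
  note cw = submodule_cyc[OF w(1)]
  have H: "submodule H A M" unfolding H_def by (rule submodule_set_add[OF cw L])
  have wH: "w \<in> H" and LH: "L \<subseteq> H" using subset_set_add[OF cw L] mem_cyc[OF w(1)] by (auto simp: H_def)
  define \<F> where "\<F> = {L'. submodule L' A M \<and> L \<subseteq> L' \<and> L' \<subseteq> H \<and> w \<notin> L'}"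
  have "\<exists>L'\<in>\<F>. \<forall>L''\<in>\<F>. L' \<subseteq> L'' \<longrightarrow> L'' = L'"
  proof (rule subset_Zorn_nonempty)
    show "\<F> \<noteq> {}" using L LH w by (auto simp: \<F>_def)
    fix \<C> assume C: "\<C> \<noteq> {}" "subset.chain \<F> \<C>"
    have Csub: "submodule L' A M" "L \<subseteq> L'" "L' \<subseteq> H" "w \<notin> L'" if "L' \<in> \<C>" for L'
      using C(2) that by (auto simp: subset_chain_def \<F>_def)
    have "submodule (\<Union>\<C>) A M"
    proof (rule submodule_by_letters)
      show "\<Union>\<C> \<subseteq> carrier M" using Csub(1) submodule_subset by blast
      show "\<zero>\<^bsub>M\<^esub> \<in> \<Union>\<C>" using C(1) Csub(1) submodule_zero by blast
      fix x y assume "x \<in> \<Union>\<C>" "y \<in> \<Union>\<C>"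
      then obtain U U' where U: "U \<in> \<C>" "U' \<in> \<C>" "x \<in> U" "y \<in> U'" by blast
      then have "U \<subseteq> U' \<or> U' \<subseteq> U" using C(2) by (auto simp: subset_chain_def)
      then show "x \<oplus>\<^bsub>M\<^esub> y \<in> \<Union>\<C>" using U submodule_add[OF Csub(1)] by blast
    qed (use submodule_act[OF Csub(1)] in blast)+
    then show "\<Union>\<C> \<in> \<F>" using C(1) Csub(2,3,4) unfolding \<F>_def by blast
  qed
  then obtain L' where L': "L' \<in> \<F>" "\<And>L''. L'' \<in> \<F> \<Longrightarrow> L' \<subseteq> L'' \<Longrightarrow> L'' = L'" by blast
  have L'': "submodule L' A M" "L \<subseteq> L'" "L' \<subseteq> H" "w \<notin> L'" using L'(1) by (simp_all add: \<F>_def)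
  let ?P = "M\<lparr>carrier := H\<rparr>"
  interpret P: left_module A ?P by (rule left_module_submodule[OF H])
  have L'P: "submodule L' A ?P" using submodule_restrict_iff[OF H] L''(1,3) by simp
  define S where "S = quotient_module ?P L'"
  define h where "h x = L' +>\<^bsub>?P\<^esub> x" for x
  have h: "left_module_hom A ?P S h" unfolding h_def[abs_def] S_def by (rule P.left_module_hom_quotient[OF L'P])
  interpret h: left_module_hom A ?P S h by (rule h)
  have h_ker: "h.ker = L'" unfolding h_def[abs_def] S_def by (rule P.ker_quotient[OF L'P])
  have h_surj: "h ` carrier ?P = carrier S" unfolding h_def[abs_def] S_def by (rule P.quotient_carrier[OF L'P, symmetric])
  have simple: "simple_module A S"
    unfolding h.simple_iff_maximal_ker[OF h_surj] h_ker
  proof (intro conjI allI impI)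
    show "L' \<noteq> carrier ?P" using wH L''(4) by auto
    fix U assume U: "submodule U A ?P" "L' \<subseteq> U"
    have U': "submodule U A M" "U \<subseteq> H" using U(1) submodule_restrict_iff[OF H] by simp_all
    show "U = L' \<or> U = carrier ?P"
    proof (cases "w \<in> U")
      case True
      have "H \<subseteq> U"
        unfolding H_def using cyc_minimal[OF U'(1) True] L''(2) U(2) by (intro set_add_subset[OF U'(1)]) auto
      then show ?thesis using U'(2) by auto
    next
      case False
      then have "U \<in> \<F>" using U' U(2) L''(2) by (auto simp: \<F>_def)
      then show ?thesis using L'(2) U(2) by blast
    qed
  qed
  interpret S: osc_central_module q C0 S
    using osc_central_moduleI h.cod.left_module_axioms by blast
  interpret P': osc_module q C0 ?P by (rule osc_moduleI[OF P.left_module_axioms])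
  have act: "P'.act p x = act p x" for p x by (simp add: P'.act_def act_def)
  have hact: "S.act p (h w) = h (act p w)" for p
    using hom_act[OF P'.osc_module_axioms S.osc_module_axioms h, of w p] wH by (simp add: act)
  have h0: "h x = \<zero>\<^bsub>S\<^esub>" if "x \<in> L" for x using that L''(2) h_ker by (auto simp: h.ker_def)
  have "h w \<noteq> \<zero>\<^bsub>S\<^esub>" using h_ker wH L''(4) by (auto simp: h.ker_def)
  moreover have "h w \<in> carrier S" using h.hom_closed[of w] wH by simp
  ultimately have 1: "t \<noteq> 0" "module_iso A S (simple_V q C0 t)" "simple_V q C0 t \<in> subquotients A (verma q C0 t)"
    "left_module A (simple_V q C0 t)"
    using simple_module_with_highest_weight[OF simple, of "h w" t] hw h0 by (simp_all add: hact)
  have "S \<in> subquotients A M" unfolding subquotients_def S_def using H L''(1,3) by blast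
  then show "\<exists>S\<in>subquotients A M. simple_module A S \<and> module_iso A S (simple_V q C0 t)" using simple 1 by blast
  show "simple_V q C0 t \<in> subquotients A (verma q C0 t)" "left_module A (simple_V q C0 t)" "t \<noteq> 0"
    using 1 by blast+
qed

end

text \<open>The image of the left ideal \<open>J\<close> in \<open>Z(s)\<close> is a submodule modulo which \<open>a\<close> gives a highest weight
  vector of weight \<open>r\<close>.\<close>

lemma (in osc_central) linked_if_singular_link:
  assumes "singular_link s r" shows "linked q C0 s r"
proof -
  obtain J a where J: "left_ideal J" "I \<subseteq> J" "{lE, lX, lK - const s} \<subseteq> J"
    and a: "a \<notin> J" "{lE * a, lX * a, (lK - const r) * a} \<subseteq> J"
    using assms unfolding singular_link_def by blast
  interpret Z: osc_central_module q C0 "Z s" by (rule osc_central_moduleI[OF left_module_verma])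
  interpret p: left_module_hom A RM "Z s" "to_verma s" by (rule to_verma_hom)
  have J_add: "x + y \<in> J" if "x \<in> J" "y \<in> J" for x y using J(1) that by (simp add: left_ideal_def)
  have J_mult: "x * y \<in> J" if "y \<in> J" for x y using J(1) that by (simp add: left_ideal_def)
  have cls_J: "cls b \<in> cls ` J \<longleftrightarrow> b \<in> J" for b
  proof
    assume "cls b \<in> cls ` J"
    then obtain c where "c \<in> J" "b - c \<in> I" by (auto simp: pres_class_eq_iff)
    then have "(b - c) + c \<in> J" using J(2) by (intro J_add) auto
    then show "b \<in> J" by simp
  qed simp
  have cJ: "submodule (cls ` J) A RM"
  proof (rule reg.submodule_by_letters)
    show "cls ` J \<subseteq> carrier RM" by (auto simp: reg_carrier)
    show "\<zero>\<^bsub>RM\<^esub> \<in> cls ` J" using J(1) by (auto simp: regular_module_def A_simps left_ideal_def)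
    show "x \<oplus>\<^bsub>RM\<^esub> y \<in> cls ` J" if "x \<in> cls ` J" "y \<in> cls ` J" for x y
      using that by (auto simp: cls_J J_add regular_module_def A_simps)
  qed (auto simp: reg_act cls_J J_mult)
  have sub: "p.ker \<subseteq> cls ` J"
    unfolding to_verma_ker verma_ideal_eq using J(3) by (auto simp: cls_J intro!: J_add J_mult)
  have mem: "to_verma s (cls b) \<in> to_verma s ` cls ` J \<longleftrightarrow> b \<in> J" for b
    using p.mem_image_iff[OF cJ sub, of "cls b"] by (simp add: reg_carrier cls_J)
  have "to_verma s (cls a) \<in> carrier (Z s)" using p.hom_closed by (simp add: reg_carrier)
  from Z.simple_subquotient(1)[OF p.submodule_image[OF cJ] this, of r] show ?thesis
    using a by (auto simp: linked_def mem verma_act)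
qed

section \<open>Occurrence of highest weights\<close>

context osc_module
begin

lemma B_plus_eq: "osc_B_plus q C0 = A\<lparr>carrier := generate_ring A
  (range (\<lambda>c. cls (const c)) \<union> cls ` letter ` {Uq_gen Gen_E, Gen_X, Uq_gen Gen_K, Uq_gen Gen_K_inv})\<rparr>"
  by (simp add: osc_B_plus_def osc_scalar_def[abs_def] osc_gen_def[abs_def] image_image)

lemma B_plus_subring: "subring (carrier (osc_B_plus q C0)) A"
  unfolding B_plus_eq using ring.generate_ring_is_subring[OF ring_A] by (simp add: A_simps image_subset_iff)

lemma left_module_B_plus: "left_module (osc_B_plus q C0) M"
  using left_module_subring[OF B_plus_subring] by (simp add: B_plus_eq)

lemma B_plus_generators:
  "cls (const c) \<in> carrier (osc_B_plus q C0)"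
  "g \<in> {Uq_gen Gen_E, Gen_X, Uq_gen Gen_K} \<Longrightarrow> cls (letter g) \<in> carrier (osc_B_plus q C0)"
  unfolding B_plus_eq by (auto intro: generate_ring.incl)

lemma B_plus_submodule_if_submodule:
  assumes "submodule H A M" shows "submodule H (osc_B_plus q C0) M"
proof -
  interpret B: left_module "osc_B_plus q C0" M by (rule left_module_B_plus)
  have "carrier (osc_B_plus q C0) \<subseteq> carrier A" by (rule subringE(1)[OF B_plus_subring])
  then show ?thesis using assms by (auto simp: B.submodule_iff submodule_iff)
qed

abbreviation "Bspan m \<equiv> submodule_span (osc_B_plus q C0) M {m}"

lemma Bspan:
  assumes m: "m \<in> carrier M"
  shows "submodule (Bspan m) (osc_B_plus q C0) M" and "gsub (Bspan m)" and "m \<in> Bspan m"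
    and "x \<in> Bspan m \<Longrightarrow> act lE x \<in> Bspan m" and "x \<in> Bspan m \<Longrightarrow> act lX x \<in> Bspan m"
proof -
  interpret B: left_module "osc_B_plus q C0" M by (rule left_module_B_plus)
  show sub: "submodule (Bspan m) (osc_B_plus q C0) M" using m by (intro B.submodule_span_submodule) simp
  show "gsub (Bspan m)"
    using B.submodule_subset[OF sub] B.submodule_zero[OF sub] B.submodule_add[OF sub]
      B.submodule_smult[OF sub B_plus_generators(1)] by (intro gsubI) (auto simp: act_def)
  show "m \<in> Bspan m" using B.subset_submodule_span[of "{m}"] by simp
  show "x \<in> Bspan m \<Longrightarrow> act lE x \<in> Bspan m" "x \<in> Bspan m \<Longrightarrow> act lX x \<in> Bspan m"
    using B.submodule_smult[OF sub B_plus_generators(2)] by (simp_all add: act_def)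
qed

text \<open>For a submodule \<open>H\<close> of a weight module this means that \<open>V(t)\<close> is a subquotient of \<open>H\<close>.\<close>

definition occurs :: "'m set \<Rightarrow> 'k \<Rightarrow> bool" where
  "occurs H t \<longleftrightarrow> (\<exists>L w. submodule L A M \<and> w \<in> H \<and> w \<in> Wt t \<and> w \<notin> L \<and> act lE w \<in> L \<and> act lX w \<in> L)"

lemma occursI:
  "submodule L A M \<Longrightarrow> w \<in> H \<Longrightarrow> w \<in> Wt t \<Longrightarrow> w \<notin> L \<Longrightarrow> act lE w \<in> L \<Longrightarrow> act lX w \<in> L \<Longrightarrow> occurs H t"
  unfolding occurs_def by blast

lemma occurs_mono: "occurs H t \<Longrightarrow> H \<subseteq> H' \<Longrightarrow> occurs H' t"
  unfolding occurs_def by blast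

lemma occurs_zero: "\<not> occurs {\<zero>\<^bsub>M\<^esub>} t"
  unfolding occurs_def using submodule_zero by blast

lemma occurs_nonzero:
  assumes "occurs H t" shows "t \<noteq> 0"
proof
  obtain L w where "submodule L A M" "w \<in> Wt t" "w \<notin> L" using assms unfolding occurs_def by blast
  moreover assume "t = 0"
  ultimately show False using Wt_zero_trivial submodule_zero by blast
qed

text \<open>The largest submodule in which only weights from \<open>\<Theta>\<close> occur; that membership can be tested on
  cyclic submodules rests on \<open>occurs_sum\<close> below.\<close>

definition component :: "'k set \<Rightarrow> 'm set" where
  "component \<Theta> = {m \<in> carrier M. \<forall>t. occurs (cyc m) t \<longrightarrow> t \<in> \<Theta>}"

lemma occurs_component: "occurs (component \<Theta>) t \<Longrightarrow> t \<in> \<Theta>"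
proof -
  assume "occurs (component \<Theta>) t"
  then obtain L w where w: "submodule L A M" "w \<in> component \<Theta>" "w \<in> Wt t" "w \<notin> L" "act lE w \<in> L" "act lX w \<in> L"
    unfolding occurs_def by blast
  have "occurs (cyc w) t" using mem_cyc[OF Wt_carrier[OF w(3)]] w by (intro occursI)
  then show ?thesis using w(2) by (simp add: component_def)
qed

lemma component_carrier: "component \<Theta> \<subseteq> carrier M"
  by (auto simp: component_def)

lemma component_mono: "\<Theta> \<subseteq> \<Theta>' \<Longrightarrow> component \<Theta> \<subseteq> component \<Theta>'"
  by (auto simp: component_def)

end

context weight_module
begin

text \<open>Let \<open>w = h + h'\<close> be singular modulo \<open>L\<close>. If \<open>w\<close> is congruent modulo \<open>L\<close> to an element of \<open>H'\<close>,
  then this element is singular modulo \<open>L\<close>; if not, then \<open>h\<close> is singular modulo \<open>H' + L\<close>.\<close>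

lemma occurs_sum:
  assumes H: "submodule H A M" and H': "submodule H' A M" and o: "occurs (H <+>\<^bsub>M\<^esub> H') t"
  shows "occurs H t \<or> occurs H' t"
proof -
  obtain L w where L: "submodule L A M" and w: "w \<in> H <+>\<^bsub>M\<^esub> H'" "w \<in> Wt t" "w \<notin> L" "act lE w \<in> L" "act lX w \<in> L"
    using o unfolding occurs_def by blast
  obtain h h' where hh: "h \<in> H" "h \<in> Wt t" "h' \<in> H'" "h' \<in> Wt t" "w = h \<oplus>\<^bsub>M\<^esub> h'"
    by (rule weight_vector_in_sum[OF H H' w(2,1)])
  have c: "h \<in> carrier M" "h' \<in> carrier M" using hh(2,4) Wt_carrier by blast+
  show ?thesis
  proof (cases "w \<in> H' <+>\<^bsub>M\<^esub> L")
    case True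
    then obtain k l where kl: "k \<in> H'" "k \<in> Wt t" "l \<in> L" "l \<in> Wt t" "w = k \<oplus>\<^bsub>M\<^esub> l"
      by (rule weight_vector_in_sum[OF H' L w(2)])
    have kc: "k \<in> carrier M" "l \<in> carrier M" using kl(2,4) Wt_carrier by blast+
    have k: "k = w \<ominus>\<^bsub>M\<^esub> l" using kc by (simp add: kl(5) M.minus_eq M.a_assoc M.r_neg)
    have "act p k \<in> L" if "act p w \<in> L" for p
      unfolding k using kc Wt_carrier[OF w(2)] submodule_minus[OF L that submodule_act[OF L kl(3)]]
      by (simp add: act_minus_right)
    moreover have "k \<notin> L" using w(3) kl(3,5) submodule_add[OF L] by blast
    ultimately show ?thesis using occursI[OF L kl(1,2)] w(4,5) by blast
  next
    case False
    have HL: "submodule (H' <+>\<^bsub>M\<^esub> L) A M" by (rule submodule_set_add[OF H' L])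
    note sub = subset_set_add[OF H' L]
    have h: "h = w \<ominus>\<^bsub>M\<^esub> h'" using c by (simp add: hh(5) M.minus_eq M.a_assoc M.r_neg)
    have "act p h \<in> H' <+>\<^bsub>M\<^esub> L" if "act p w \<in> L" for p
    proof -
      have "act p w \<ominus>\<^bsub>M\<^esub> act p h' \<in> H' <+>\<^bsub>M\<^esub> L"
        using that submodule_act[OF H' hh(3), of p] sub by (intro submodule_minus[OF HL]) blast+
      then show ?thesis unfolding h using c Wt_carrier[OF w(2)] by (simp add: act_minus_right)
    qed
    moreover have "h \<notin> H' <+>\<^bsub>M\<^esub> L"
    proof
      assume "h \<in> H' <+>\<^bsub>M\<^esub> L"
      then have "h \<oplus>\<^bsub>M\<^esub> h' \<in> H' <+>\<^bsub>M\<^esub> L" using hh(3) sub by (intro submodule_add[OF HL]) blast+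
      then show False using False hh(5) by simp
    qed
    ultimately show ?thesis using occursI[OF HL hh(1,2)] w(4,5) by blast
  qed
qed

lemma submodule_component: "submodule (component \<Theta>) A M"
proof (rule submodule_by_letters)
  have "cyc \<zero>\<^bsub>M\<^esub> = {\<zero>\<^bsub>M\<^esub>}" by (auto simp: cyc_def)
  then show "\<zero>\<^bsub>M\<^esub> \<in> component \<Theta>" using occurs_zero by (simp add: component_def)
next
  fix x y assume xy: "x \<in> component \<Theta>" "y \<in> component \<Theta>"
  then have c: "x \<in> carrier M" "y \<in> carrier M" using component_carrier by blast+
  note cx = submodule_cyc[OF c(1)] and cy = submodule_cyc[OF c(2)]
  have "x \<oplus>\<^bsub>M\<^esub> y \<in> cyc x <+>\<^bsub>M\<^esub> cyc y" using mem_cyc[OF c(1)] mem_cyc[OF c(2)] by (auto simp: set_add_iff)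
  then have "cyc (x \<oplus>\<^bsub>M\<^esub> y) \<subseteq> cyc x <+>\<^bsub>M\<^esub> cyc y" by (rule cyc_minimal[OF submodule_set_add[OF cx cy]])
  then show "x \<oplus>\<^bsub>M\<^esub> y \<in> component \<Theta>"
    using occurs_sum[OF cx cy] occurs_mono xy c unfolding component_def by blast
next
  have act: "act p x \<in> component \<Theta>" if x: "x \<in> component \<Theta>" for p x
  proof -
    have "x \<in> carrier M" using x component_carrier by blast
    then have "cyc (act p x) \<subseteq> cyc x" by (intro cyc_minimal submodule_cyc act_mem_cyc)
    then have "occurs (cyc (act p x)) t \<Longrightarrow> occurs (cyc x) t" for t using occurs_mono by blast
    then show ?thesis using x by (simp add: component_def)
  qed
  show "x \<in> component \<Theta> \<Longrightarrow> sc c x \<in> component \<Theta>" "x \<in> component \<Theta> \<Longrightarrow> act (letter g) x \<in> component \<Theta>" for c g x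
    by (rule act, assumption)+
qed (rule component_carrier)

lemma finitely_many_weights:
  assumes "finite S" "S \<subseteq> carrier M"
  shows "\<exists>\<Lambda>. finite \<Lambda> \<and> (\<forall>x\<in>gspan S. \<forall>\<mu>. x \<in> Wt \<mu> \<longrightarrow> x \<noteq> \<zero>\<^bsub>M\<^esub> \<longrightarrow> \<mu> \<in> \<Lambda>)"
proof -
  have "\<exists>\<Lambda>. weight_sum (\<lambda>r. pr r s) \<Lambda> s" if "s \<in> S" for s using weight_sum_pr assms(2) that by blast
  then obtain \<Lambda> where \<Lambda>: "\<And>s. s \<in> S \<Longrightarrow> weight_sum (\<lambda>r. pr r s) (\<Lambda> s) s" by metis
  let ?\<Lambda> = "\<Union>s\<in>S. \<Lambda> s"
  let ?H = "{x \<in> carrier M. \<forall>\<mu>. \<mu> \<notin> ?\<Lambda> \<longrightarrow> pr \<mu> x = \<zero>\<^bsub>M\<^esub>}"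
  have "gsub ?H" by (intro gsubI) (auto simp: pr_add pr_sc)
  moreover have "S \<subseteq> ?H" using \<Lambda> assms(2) by (auto simp: weight_sum_def)
  ultimately have "gspan S \<subseteq> ?H" by (rule G.submodule_span_minimal)
  then have "x \<in> ?H" if "x \<in> gspan S" for x using that by blast
  then have "\<mu> \<in> ?\<Lambda>" if "x \<in> gspan S" "x \<in> Wt \<mu>" "x \<noteq> \<zero>\<^bsub>M\<^esub>" for x \<mu>
    using that pr_weight[OF that(2), of \<mu>] by fastforce
  moreover have "finite ?\<Lambda>" using assms(1) \<Lambda> by (auto simp: weight_sum_def)
  ultimately show ?thesis by blast
qed

end

section \<open>Highest weight vectors in category O\<close>

locale osc_O_module = osc_central_weight_module q C0 M
  for q :: "'k::field" and C0 and M :: "('k osc_elt, 'm) module" +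
  assumes weight_finite: "\<And>r. fin_generated (osc_ground q C0) M (weight_space q C0 M r)"
    and B_plus_finite: "\<And>m. m \<in> carrier M \<Longrightarrow>
      fin_generated (osc_ground q C0) M (submodule_span (osc_B_plus q C0) M {m})"
begin

text \<open>For a weight vector \<open>y\<close> in \<open>H\<close> outside \<open>L\<close>, the space \<open>B_+ y\<close> has finitely many weights. Among
  those of the form \<open>q\<^sup>j r\<close> with a vector outside \<open>L\<close>, take the highest: \<open>E\<close> and \<open>X\<close> raise the
  exponent and therefore map that vector into \<open>L\<close>.\<close>

lemma highest_weight_vector_exists:
  assumes H: "submodule H A M" and L: "submodule L A M" and HL: "\<not> H \<subseteq> L"
  shows "\<exists>w r. w \<in> H \<and> w \<in> Wt r \<and> w \<notin> L \<and> act lE w \<in> L \<and> act lX w \<in> L"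
proof -
  obtain m where m: "m \<in> H" "m \<notin> L" using HL by blast
  have mc: "m \<in> carrier M" by (rule submodule_subset[OF H m(1)])
  obtain r where r: "pr r m \<notin> L" using mem_if_pr_mem[OF gsub_if_submodule[OF L] mc] m(2) by blast
  define y where "y = pr r m"
  have y: "y \<in> H" "y \<in> Wt r" "y \<notin> L" using pr_submodule[OF H m(1)] pr_Wt[OF mc] r by (simp_all add: y_def)
  have yc: "y \<in> carrier M" using y(2) by (rule Wt_carrier)
  have r0: "r \<noteq> 0" using Wt_zero_trivial[of y] y(2,3) submodule_zero[OF L] by blast
  let ?W = "Bspan y"
  note W = Bspan[OF yc]
  have WH: "?W \<subseteq> H"
    using left_module.submodule_span_minimal[OF left_module_B_plus B_plus_submodule_if_submodule[OF H]] y(1) by blast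
  obtain S where S: "finite S" "S \<subseteq> ?W" "gspan S = ?W"
    using B_plus_finite[OF yc] unfolding fin_generated_def by blast
  have "S \<subseteq> carrier M" using S(2) G.submodule_subset[OF W(2)] by blast
  then obtain \<Lambda> where \<Lambda>: "finite \<Lambda>" "\<And>x \<mu>. x \<in> ?W \<Longrightarrow> x \<in> Wt \<mu> \<Longrightarrow> x \<noteq> \<zero>\<^bsub>M\<^esub> \<Longrightarrow> \<mu> \<in> \<Lambda>"
    using finitely_many_weights[OF S(1)] S(3) by blast
  define B where "B = {j::nat. \<exists>x\<in>?W. x \<in> Wt (q powi int j * r) \<and> x \<notin> L}"
  have "(\<lambda>j. q powi int j * r) ` B \<subseteq> \<Lambda>"
    using \<Lambda>(2) submodule_zero[OF L] by (auto simp: B_def)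
  moreover have "inj_on (\<lambda>j. q powi int j * r) B"
    using r0 q_powi_inj by (intro inj_onI) (simp only: mult_cancel_right of_nat_eq_iff simp_thms)
  ultimately have finB: "finite B" using \<Lambda>(1) finite_subset finite_imageD by metis
  have "0 \<in> B" using y W(3) by (auto simp: B_def intro!: bexI[of _ y])
  define j where "j = Max B"
  have "j \<in> B" unfolding j_def using finB \<open>0 \<in> B\<close> by (intro Max_in) auto
  then obtain x where x: "x \<in> ?W" "x \<in> Wt (q powi int j * r)" "x \<notin> L" by (auto simp: B_def)
  have above: "z \<in> L" if "z \<in> ?W" "z \<in> Wt (q powi int i * r)" "i > j" for z i
    using Max_ge[OF finB, of i] that by (auto simp: B_def j_def)
  have "q powi 2 * (q powi int j * r) = q powi int (j + 2) * r" "q powi 1 * (q powi int j * r) = q powi int (j + 1) * r"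
    by (simp_all only: mult.assoc[symmetric] power_int_add[OF disjI1[OF q_nonzero], symmetric]) (simp_all add: add.commute)
  then have EX: "act lE x \<in> Wt (q powi int (j + 2) * r)" "act lX x \<in> Wt (q powi int (j + 1) * r)"
    using act_letter_Wt[OF x(2), of "Uq_gen Gen_E"] act_letter_Wt[OF x(2), of Gen_X]
    by (simp_all only: gen_degree.simps uq_degree.simps mult_1_right)
  have "act lE x \<in> L" by (rule above[OF W(4)[OF x(1)] EX(1)]) simp
  moreover have "act lX x \<in> L" by (rule above[OF W(5)[OF x(1)] EX(2)]) simp
  ultimately show ?thesis using x WH by blast
qed

lemma submodule_eq_carrier:
  assumes H: "submodule H A M"
    and step: "\<And>w r. w \<in> Wt r \<Longrightarrow> act lE w \<in> H \<Longrightarrow> act lX w \<in> H \<Longrightarrow> w \<in> H"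
  shows "H = carrier M"
proof (rule ccontr)
  assume "H \<noteq> carrier M"
  then have "\<not> carrier M \<subseteq> H" using submodule_subset[OF H] by blast
  then show False using highest_weight_vector_exists[OF submodule_carrier H] step by blast
qed

lemma component_disjoint:
  assumes "\<Theta> \<inter> \<Theta>' = {}" "x \<in> component \<Theta>" "x \<in> component \<Theta>'" shows "x = \<zero>\<^bsub>M\<^esub>"
proof (rule ccontr)
  assume "x \<noteq> \<zero>\<^bsub>M\<^esub>"
  then have "\<not> component \<Theta> \<inter> component \<Theta>' \<subseteq> {\<zero>\<^bsub>M\<^esub>}" using assms by blast
  from highest_weight_vector_exists[OF submodule_Int[OF submodule_component submodule_component] submodule_trivial this]
  obtain w t where "w \<in> component \<Theta> \<inter> component \<Theta>'" "w \<in> Wt t" "w \<notin> {\<zero>\<^bsub>M\<^esub>}"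
    "act lE w \<in> {\<zero>\<^bsub>M\<^esub>}" "act lX w \<in> {\<zero>\<^bsub>M\<^esub>}" by blast
  then have "occurs (component \<Theta>) t" "occurs (component \<Theta>') t"
    by (auto intro!: occursI[OF submodule_trivial])
  then show False using occurs_component assms(1) by blast
qed

text \<open>Weights are compared within one coset of the powers of \<open>q\<close>, that of \<open>\<kappa>\<close>. The vectors that
  generate submodules with bounded weights form a submodule. It contains every vector \<open>w\<close> that
  is a highest weight vector modulo it, since \<open>w\<close> only adds weights below its own; so it is
  everything.\<close>

lemma weights_bounded:
  assumes m: "m \<in> carrier M" and \<kappa>: "\<kappa> \<noteq> 0"
  shows "\<exists>J::int. \<forall>j>J. \<forall>x\<in>cyc m. x \<in> Wt (q powi j * \<kappa>) \<longrightarrow> x = \<zero>\<^bsub>M\<^esub>"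
proof -
  define bd where "bd H \<longleftrightarrow> (\<exists>J::int. \<forall>j>J. \<forall>x\<in>H. x \<in> Wt (q powi j * \<kappa>) \<longrightarrow> x = \<zero>\<^bsub>M\<^esub>)" for H
  have bd_mono: "bd H'" if "bd H" "H' \<subseteq> H" for H H' using that unfolding bd_def by blast
  have bd_add: "bd (H <+>\<^bsub>M\<^esub> H')" if sub: "submodule H A M" "submodule H' A M" and b: "bd H" "bd H'" for H H'
  proof -
    obtain J J' where J: "\<And>j x. j > J \<Longrightarrow> x \<in> H \<Longrightarrow> x \<in> Wt (q powi j * \<kappa>) \<Longrightarrow> x = \<zero>\<^bsub>M\<^esub>"
      "\<And>j x. j > J' \<Longrightarrow> x \<in> H' \<Longrightarrow> x \<in> Wt (q powi j * \<kappa>) \<Longrightarrow> x = \<zero>\<^bsub>M\<^esub>"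
      using b unfolding bd_def by blast
    have "x = \<zero>\<^bsub>M\<^esub>" if j: "j > max J J'" and x: "x \<in> H <+>\<^bsub>M\<^esub> H'" "x \<in> Wt (q powi j * \<kappa>)" for j x
    proof -
      obtain h h' where hh: "h \<in> H" "h \<in> Wt (q powi j * \<kappa>)" "h' \<in> H'" "h' \<in> Wt (q powi j * \<kappa>)" "x = h \<oplus>\<^bsub>M\<^esub> h'"
        by (rule weight_vector_in_sum[OF sub x(2,1)])
      then show ?thesis using J(1)[OF _ hh(1,2)] J(2)[OF _ hh(3,4)] j by simp
    qed
    then show ?thesis unfolding bd_def by blast
  qed
  let ?H = "{m \<in> carrier M. bd (cyc m)}"
  have H: "submodule ?H A M"
  proof (rule submodule_by_letters)
    have "cyc \<zero>\<^bsub>M\<^esub> = {\<zero>\<^bsub>M\<^esub>}" by (auto simp: cyc_def)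
    then show "\<zero>\<^bsub>M\<^esub> \<in> ?H" by (simp add: bd_def)
  next
    fix x y assume "x \<in> ?H" "y \<in> ?H"
    then have c: "x \<in> carrier M" "y \<in> carrier M" and b: "bd (cyc x)" "bd (cyc y)" by simp_all
    note cx = submodule_cyc[OF c(1)] and cy = submodule_cyc[OF c(2)]
    have "x \<oplus>\<^bsub>M\<^esub> y \<in> cyc x <+>\<^bsub>M\<^esub> cyc y" using mem_cyc[OF c(1)] mem_cyc[OF c(2)] by (auto simp: set_add_iff)
    then have "cyc (x \<oplus>\<^bsub>M\<^esub> y) \<subseteq> cyc x <+>\<^bsub>M\<^esub> cyc y" by (rule cyc_minimal[OF submodule_set_add[OF cx cy]])
    then show "x \<oplus>\<^bsub>M\<^esub> y \<in> ?H" using bd_mono[OF bd_add[OF cx cy b]] c by simp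
  next
    have act: "act p x \<in> ?H" if x: "x \<in> ?H" for p x
    proof -
      have "cyc (act p x) \<subseteq> cyc x" using x by (intro cyc_minimal submodule_cyc act_mem_cyc) simp
      then show ?thesis using x bd_mono by auto
    qed
    show "x \<in> ?H \<Longrightarrow> sc c x \<in> ?H" "x \<in> ?H \<Longrightarrow> act (letter g) x \<in> ?H" for c g x by (rule act, assumption)+
  qed blast
  have "?H = carrier M"
  proof (rule submodule_eq_carrier[OF H])
    fix w r assume w: "w \<in> Wt r" "act lE w \<in> ?H" "act lX w \<in> ?H"
    have wc: "w \<in> carrier M" using w(1) by (rule Wt_carrier)
    let ?N = "cyc (act lE w) <+>\<^bsub>M\<^esub> cyc (act lX w)"
    have c: "submodule (cyc (act lE w)) A M" "submodule (cyc (act lX w)) A M" using wc by (simp_all add: submodule_cyc)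
    have N: "submodule ?N A M" by (rule submodule_set_add[OF c])
    have EN: "act lE w \<in> ?N" "act lX w \<in> ?N" using subset_set_add[OF c] mem_cyc wc by auto
    obtain J where J: "\<And>j x. j > J \<Longrightarrow> x \<in> ?N \<Longrightarrow> x \<in> Wt (q powi j * \<kappa>) \<Longrightarrow> x = \<zero>\<^bsub>M\<^esub>"
      using bd_add[OF c] w(2,3) unfolding bd_def by blast
    \<comment> \<open>Either the coset of \<open>\<kappa>\<close> contains no weight \<open>q\<^sup>-\<^sup>n r\<close>, or these weights have bounded exponents.\<close>
    obtain J' :: int where J': "\<And>j n. j > J' \<Longrightarrow> q powi j * \<kappa> \<noteq> q powi (- int n) * r"
    proof (cases "\<exists>j n. q powi j * \<kappa> = q powi (- int n) * r")
      case False
      then show thesis using that[of 0] by blast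
    next
      case True
      then obtain j0 n0 where e: "q powi j0 * \<kappa> = q powi (- int n0) * r" by blast
      have "j \<le> j0 + int n0" if "q powi j * \<kappa> = q powi (- int n) * r" for j n
      proof -
        have "q powi (j0 + int n0) * \<kappa> = r"
          using e q_nonzero by (simp add: power_int_add power_int_minus divide_simps mult_ac)
        then have "q powi j * \<kappa> = q powi (- int n + (j0 + int n0)) * \<kappa>"
          using that by (simp only: power_int_add[OF disjI1[OF q_nonzero]] mult.assoc)
        then have "j = - int n + (j0 + int n0)" using \<kappa> q_powi_inj by simp
        then show ?thesis by simp
      qed
      then show thesis using that[of "j0 + int n0"] by (meson not_le)
    qed
    have "x = \<zero>\<^bsub>M\<^esub>" if j: "j > max J J'" and x: "x \<in> cyc w" "x \<in> Wt (q powi j * \<kappa>)" for j x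
    proof -
      obtain p where p: "x = act p w" using x(1) by (auto simp: cyc_def)
      have "pr (q powi j * \<kappa>) (act p w) \<in> ?N" by (rule pr_cyclic[OF N w(1) EN]) (use J' j in simp)
      then have "x \<in> ?N" using pr_weight[OF x(2), of "q powi j * \<kappa>"] by (simp add: p)
      then show ?thesis using J[OF _ _ x(2)] j by simp
    qed
    then show "w \<in> ?H" using wc unfolding bd_def by blast
  qed
  then have "bd (cyc m)" using m by blast
  then show ?thesis by (simp add: bd_def)
qed

end

section \<open>Linkage classes and components\<close>

context osc_central
begin

abbreviation "T r \<equiv> component_T q C0 r"

lemma component_T_self: "r \<in> T r"
  by (simp add: component_T_def)

lemma component_T_sym: "t \<in> T r \<Longrightarrow> r \<in> T t"
proof -
  have "sym {(s, s'). s \<noteq> 0 \<and> s' \<noteq> 0 \<and> linked q C0 s s'}" by (rule symI) (auto simp: linked_def)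
  then show "t \<in> T r \<Longrightarrow> r \<in> T t" unfolding component_T_def by (simp add: symD[OF sym_rtrancl])
qed

lemma component_T_eq: "t \<in> T r \<Longrightarrow> T t = T r"
  using component_T_sym[of t r] unfolding component_T_def by (auto intro: rtrancl_trans)

lemma component_T_nonzero: "t \<in> T r \<Longrightarrow> r \<noteq> 0 \<Longrightarrow> t \<noteq> 0"
  unfolding component_T_def by (auto elim: rtranclE)

lemma linked_component_T: "linked q C0 r t \<Longrightarrow> r \<noteq> 0 \<Longrightarrow> t \<noteq> 0 \<Longrightarrow> t \<in> T r"
  unfolding component_T_def by auto

end

context osc_O_module
begin

text \<open>Let \<open>Q = component (T r)\<close>, and let \<open>y \<in> A v\<close> of weight \<open>t\<close> be singular modulo \<open>L\<close>. If \<open>y\<close> lies in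
  \<open>L + Q\<close>, then \<open>t\<close> occurs in \<open>Q\<close>. If not, then the image of \<open>A v\<close> modulo \<open>L + Q\<close> is a quotient of
  \<open>Z(r)\<close> in which \<open>y\<close> is a highest weight vector, so \<open>r\<close> and \<open>t\<close> are linked.\<close>

lemma highest_weight_mem_component:
  assumes v: "v \<in> Wt r" and r: "r \<noteq> 0" and Ev: "act lE v \<in> component (T r)" and Xv: "act lX v \<in> component (T r)"
  shows "v \<in> component (T r)"
proof -
  let ?Q = "component (T r)"
  note Q = submodule_component[of "T r"]
  have vc: "v \<in> carrier M" using v by (rule Wt_carrier)
  have "t \<in> T r" if "occurs (cyc v) t" for t
  proof -
    have t: "t \<noteq> 0" by (rule occurs_nonzero[OF that])
    obtain L y where L: "submodule L A M" and y: "y \<in> cyc v" "y \<in> Wt t" "y \<notin> L" "act lE y \<in> L" "act lX y \<in> L"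
      using \<open>occurs (cyc v) t\<close> unfolding occurs_def by blast
    have yc: "y \<in> carrier M" using y(2) by (rule Wt_carrier)
    have LQ: "submodule (L <+>\<^bsub>M\<^esub> ?Q) A M" by (rule submodule_set_add[OF L Q])
    note sub = subset_set_add[OF L Q]
    show ?thesis
    proof (cases "y \<in> L <+>\<^bsub>M\<^esub> ?Q")
      case True
      then obtain l a where la: "l \<in> L" "l \<in> Wt t" "a \<in> ?Q" "a \<in> Wt t" "y = l \<oplus>\<^bsub>M\<^esub> a"
        by (rule weight_vector_in_sum[OF L Q y(2)])
      have c: "l \<in> carrier M" "a \<in> carrier M" using la(2,4) Wt_carrier by blast+
      have a: "a = y \<ominus>\<^bsub>M\<^esub> l" using c by (simp add: la(5) M.add_minus_cancel_left)
      have "act p a \<in> L" if "act p y \<in> L" for p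
        unfolding a using submodule_minus[OF L that submodule_act[OF L la(1)]] yc c by (simp add: act_minus_right)
      moreover have "a \<notin> L" using y(3) la(1,5) submodule_add[OF L] by blast
      ultimately have "occurs ?Q t" using occursI[OF L la(3,4)] y(4,5) by blast
      then show ?thesis by (rule occurs_component)
    next
      case False
      obtain p where p: "y = act p v" using y(1) by (auto simp: cyc_def)
      define J where "J = {b. act b v \<in> L <+>\<^bsub>M\<^esub> ?Q}"
      have "left_ideal J"
        using submodule_zero[OF LQ] submodule_add[OF LQ] submodule_act[OF LQ] vc
        by (simp add: left_ideal_def J_def act_add act_mult)
      moreover have "I \<subseteq> J"
      proof
        fix b assume "b \<in> I"
        then have "act b = act 0" by (intro act_cong) simp
        then show "b \<in> J" using vc submodule_zero[OF LQ] by (simp add: J_def)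
      qed
      moreover have "act (lK - const r) v = \<zero>\<^bsub>M\<^esub>" "act (lK - const t) y = \<zero>\<^bsub>M\<^esub>"
        using v y(2) by (simp_all add: Wt_iff act_minus minus_eq_zero_iff)
      then have "{lE, lX, lK - const r} \<subseteq> J" "(lK - const t) * p \<in> J"
        using Ev Xv sub submodule_zero[OF LQ] vc by (auto simp: J_def act_mult p)
      moreover have "p \<notin> J" "lE * p \<in> J" "lX * p \<in> J"
        using False y(4,5) sub vc by (auto simp: J_def act_mult p)
      ultimately have "singular_link r t" unfolding singular_link_def by (intro exI[of _ J] exI[of _ p]) simp
      then show ?thesis using linked_component_T[OF linked_if_singular_link r t] by blast
    qed
  qed
  then show ?thesis using vc by (simp add: component_def)
qed

text \<open>A vector \<open>w\<close> of weight \<open>r\<close> that is singular modulo \<open>H\<close> is lifted to one that is singular modulo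
  \<open>Q = component (T r)\<close>. The weights occurring in \<open>H\<close> modulo \<open>Q\<close> are outside \<open>T r\<close>, because \<open>H\<close>
  is contained in \<open>Q + component (- T r)\<close>, hence are not linked to \<open>r\<close>; and \<open>G\<close> can be chosen
  finite, because the weights of \<open>A w\<close> are bounded and weight spaces are finite dimensional.
  The lifted vector lies in \<open>Q\<close>, and thus in \<open>H\<close>.\<close>

lemma component_sum_eq_carrier:
  assumes sub: "submodule H A M" and comp: "\<And>r. r \<noteq> 0 \<Longrightarrow> component (T r) \<subseteq> H"
    and split: "\<And>r. H \<subseteq> component (T r) <+>\<^bsub>M\<^esub> component (- T r)"
  shows "H = carrier M"
proof (rule submodule_eq_carrier[OF sub])
  fix w r assume w: "w \<in> Wt r" "act lE w \<in> H" "act lX w \<in> H"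
  have wc: "w \<in> carrier M" using w(1) by (rule Wt_carrier)
  show "w \<in> H"
  proof (cases "r = 0")
    case True
    then show ?thesis using Wt_zero_trivial[of w] w(1) submodule_zero[OF sub] by simp
  next
    case r: False
    let ?Q = "component (T r)" and ?Q' = "component (- T r)"
    note Q = submodule_component[of "T r"] and Q' = submodule_component[of "- T r"]
    obtain J where J: "\<And>j x. j > J \<Longrightarrow> x \<in> cyc w \<Longrightarrow> x \<in> Wt (q powi j * r) \<Longrightarrow> x = \<zero>\<^bsub>M\<^esub>"
      using weights_bounded[OF wc r] by blast
    have "\<exists>S. finite S \<and> S \<subseteq> Wt \<mu> \<and> gspan S = Wt \<mu>" for \<mu>
      using weight_finite[of \<mu>] by (simp add: fin_generated_def)
    then obtain S where S: "\<And>\<mu>. finite (S \<mu>)" "\<And>\<mu>. S \<mu> \<subseteq> Wt \<mu>" "\<And>\<mu>. gspan (S \<mu>) = Wt \<mu>" by metis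
    define G where "G = (\<Union>j\<in>{1..J}. S (q powi j * r))"
    have "\<exists>v'\<in>Wt r. v' \<ominus>\<^bsub>M\<^esub> w \<in> H \<and> act lE v' \<in> ?Q \<and> act lX v' \<in> ?Q"
    proof (rule lift_singular[OF Q sub comp[OF r] r S(1)[of r] _ _ _ _ _ w])
      show "S r \<subseteq> carrier M" using S(2)[of r] Wt_carrier by blast
      show "Wt r \<subseteq> gspan (S r)" by (simp add: S(3))
      show "finite G" by (simp add: G_def S(1))
      show "G \<subseteq> carrier M" using S(2) Wt_carrier by (auto simp: G_def)
    next
      fix s y assume y: "y \<in> H" "y \<in> Wt s" "y \<notin> ?Q" "act lE y \<in> ?Q" "act lX y \<in> ?Q"
      show "\<not> singular_link s r"
      proof
        assume link: "singular_link s r"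
        have "y \<in> ?Q <+>\<^bsub>M\<^esub> ?Q'" using y(1) split by blast
        then obtain a b where ab: "a \<in> ?Q" "a \<in> Wt s" "b \<in> ?Q'" "b \<in> Wt s" "y = a \<oplus>\<^bsub>M\<^esub> b"
          by (rule weight_vector_in_sum[OF Q Q' y(2)])
        have c: "a \<in> carrier M" "b \<in> carrier M" "y \<in> carrier M" using ab(2,4) y(2) Wt_carrier by blast+
        have b: "b = y \<ominus>\<^bsub>M\<^esub> a" using c by (simp add: ab(5) M.add_minus_cancel_left)
        have "act p b \<in> ?Q" if "act p y \<in> ?Q" for p
          unfolding b using submodule_minus[OF Q that submodule_act[OF Q ab(1)]] c by (simp add: act_minus_right)
        moreover have "b \<notin> ?Q" using y(3) ab(1,5) submodule_add[OF Q] by blast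
        ultimately have occ: "occurs ?Q' s" using occursI[OF Q ab(3,4)] y(4,5) by blast
        then have "s \<notin> T r" using occurs_component by blast
        moreover have "r \<in> T s" by (rule linked_component_T[OF linked_if_singular_link[OF link] occurs_nonzero[OF occ] r])
        ultimately show False using component_T_sym by blast
      qed
    next
      fix i x assume x: "0 < i" "x \<in> cyc w <+>\<^bsub>M\<^esub> ?Q" "x \<in> H" "x \<in> Wt (q powi i * r)"
      have xc: "x \<in> carrier M" using x(4) by (rule Wt_carrier)
      let ?G = "G \<inter> Wt (q powi i * r)"
      have Gc: "?G \<subseteq> carrier M" using Wt_carrier by blast
      note sp = G.submodule_span_submodule[OF Gc]
      show "x \<in> gspan ?G <+>\<^bsub>M\<^esub> ?Q"
      proof (cases "i \<le> J")
        case True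
        then have "S (q powi i * r) \<subseteq> ?G" using S(2) x(1) by (auto simp: G_def intro!: bexI[of _ i])
        then have "gspan (S (q powi i * r)) \<subseteq> gspan ?G" by (rule G.submodule_span_mono)
        then have "x \<in> gspan ?G" using x(4) S(3) by blast
        then show ?thesis using G.subset_set_add(1)[OF sp gsub_if_submodule[OF Q]] by blast
      next
        case False
        obtain h n where hn: "h \<in> cyc w" "h \<in> Wt (q powi i * r)" "n \<in> ?Q" "n \<in> Wt (q powi i * r)" "x = h \<oplus>\<^bsub>M\<^esub> n"
          by (rule weight_vector_in_sum[OF submodule_cyc[OF wc] Q x(4,2)])
        have "h = \<zero>\<^bsub>M\<^esub>" using J[OF _ hn(1,2)] False by simp
        then have "x \<in> ?Q" using hn(3,5) submodule_subset[OF Q] by simp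
        then show ?thesis using G.subset_set_add(2)[OF sp gsub_if_submodule[OF Q]] by blast
      qed
    qed
    then obtain v where v: "v \<in> Wt r" "v \<ominus>\<^bsub>M\<^esub> w \<in> H" "act lE v \<in> ?Q" "act lX v \<in> ?Q" by blast
    have "v \<in> H" using highest_weight_mem_component[OF v(1) r v(3,4)] comp[OF r] by blast
    then have "v \<ominus>\<^bsub>M\<^esub> (v \<ominus>\<^bsub>M\<^esub> w) \<in> H" by (rule submodule_minus[OF sub _ v(2)])
    moreover have "v \<ominus>\<^bsub>M\<^esub> (v \<ominus>\<^bsub>M\<^esub> w) = w"
      using wc Wt_carrier[OF v(1)] by (simp add: M.minus_minus_cancel)
    ultimately show ?thesis by simp
  qed
qed

end

section \<open>Direct sums\<close>

context left_module
begin

lemma smult_finsum: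
  "finite F \<Longrightarrow> f \<in> F \<rightarrow> carrier M \<Longrightarrow> a \<in> carrier R \<Longrightarrow>
    a \<odot>\<^bsub>M\<^esub> finsum M f F = finsum M (\<lambda>i. a \<odot>\<^bsub>M\<^esub> f i) F"
proof (induction F rule: finite_induct)
  case empty
  then show ?case by (simp add: smult_zero_right)
next
  case (insert i F)
  moreover have "(\<lambda>i. a \<odot>\<^bsub>M\<^esub> f i) \<in> F \<rightarrow> carrier M" "f \<in> F \<rightarrow> carrier M" "f i \<in> carrier M"
    using insert.prems by (auto simp: Pi_iff smult_closed)
  ultimately show ?case by (simp add: smult_r_distr smult_closed)
qed

lemma finsum_mem:
  assumes H: "H \<subseteq> carrier M" "\<zero>\<^bsub>M\<^esub> \<in> H" "\<And>x y. x \<in> H \<Longrightarrow> y \<in> H \<Longrightarrow> x \<oplus>\<^bsub>M\<^esub> y \<in> H"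
  shows "finite F \<Longrightarrow> (\<And>i. i \<in> F \<Longrightarrow> f i \<in> H) \<Longrightarrow> finsum M f F \<in> H"
proof (induction F rule: finite_induct)
  case (insert i F)
  moreover have "f \<in> F \<rightarrow> carrier M" "f i \<in> carrier M" using insert.prems H(1) by auto
  ultimately show ?case using H(3) by simp
qed (simp add: H(2))

lemma internal_direct_sum_induct:
  assumes "internal_direct_sum R M I N"
    and H: "H \<subseteq> carrier M" "\<zero>\<^bsub>M\<^esub> \<in> H" "\<And>x y. x \<in> H \<Longrightarrow> y \<in> H \<Longrightarrow> x \<oplus>\<^bsub>M\<^esub> y \<in> H"
    and N: "\<And>i. i \<in> I \<Longrightarrow> N i \<subseteq> H"
  shows "carrier M \<subseteq> H"
proof
  fix m assume "m \<in> carrier M"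
  then obtain f where f: "f \<in> (\<Pi>\<^sub>E i\<in>I. N i)" "finite {i\<in>I. f i \<noteq> \<zero>\<^bsub>M\<^esub>}" "m = finsum M f {i\<in>I. f i \<noteq> \<zero>\<^bsub>M\<^esub>}"
    using assms(1) unfolding internal_direct_sum_def by blast
  have "f i \<in> H" if "i \<in> {i\<in>I. f i \<noteq> \<zero>\<^bsub>M\<^esub>}" for i
    using that f(1) N by (auto simp: PiE_iff)
  then show "m \<in> H" unfolding f(3) by (intro finsum_mem[OF H f(2)])
qed

lemma finsum_supported:
  assumes "finite F" "G \<subseteq> F" "\<And>i. i \<in> F \<Longrightarrow> f i \<in> carrier M" "\<And>i. i \<in> F - G \<Longrightarrow> f i = \<zero>\<^bsub>M\<^esub>"
  shows "finsum M f F = finsum M f G"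
  using assms by (intro M.add.finprod_mono_neutral_cong_right) auto

text \<open>The elements with a finite decomposition form a submodule, which is everything by \<open>gen\<close>.
  For uniqueness, in a vanishing sum each term is also minus the sum of the others, which lies in
  the submodule \<open>N'\<close> that meets its own summand trivially.\<close>

lemma internal_direct_sumI:
  assumes N: "\<And>i. i \<in> I \<Longrightarrow> submodule (N i) R M"
    and gen: "\<And>H. submodule H R M \<Longrightarrow> (\<And>i. i \<in> I \<Longrightarrow> N i \<subseteq> H) \<Longrightarrow> carrier M \<subseteq> H"
    and indep: "\<And>i. i \<in> I \<Longrightarrow> \<exists>N'. submodule N' R M \<and> (\<forall>j\<in>I. j \<noteq> i \<longrightarrow> N j \<subseteq> N') \<and> N i \<inter> N' \<subseteq> {\<zero>\<^bsub>M\<^esub>}"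
  shows "internal_direct_sum R M I N"
  unfolding internal_direct_sum_def
proof (intro conjI ballI)
  fix m assume m: "m \<in> carrier M"
  define fam where "fam f F x \<longleftrightarrow> finite F \<and> F \<subseteq> I \<and> (\<forall>i\<in>I. f i \<in> N i) \<and> (\<forall>i\<in>I - F. f i = \<zero>\<^bsub>M\<^esub>) \<and> x = finsum M f F"
    for f F x
  have Nc: "x \<in> carrier M" if "i \<in> I" "x \<in> N i" for i x using submodule_subset[OF N[OF that(1)] that(2)] .
  have fam_carrier: "f i \<in> carrier M" if "fam f F x" "i \<in> I" for f F x i
    using Nc[OF that(2)] that by (simp add: fam_def)
  have fam_ext: "fam f F' x" if f: "fam f F x" and F': "F \<subseteq> F'" "finite F'" "F' \<subseteq> I" for f F F' x
  proof -
    have "finsum M f F' = finsum M f F"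
    proof (rule finsum_supported[OF F'(2,1)])
      show "f i \<in> carrier M" if "i \<in> F'" for i using fam_carrier[OF f] that F'(3) by blast
      show "f i = \<zero>\<^bsub>M\<^esub>" if "i \<in> F' - F" for i using f that F'(3) by (auto simp: fam_def)
    qed
    then show ?thesis using f F' by (auto simp: fam_def)
  qed
  have "submodule {x. \<exists>f F. fam f F x} R M"
    unfolding submodule_iff
  proof (intro conjI ballI subsetI)
    fix x assume "x \<in> {x. \<exists>f F. fam f F x}"
    then show "x \<in> carrier M" using Nc by (auto simp: fam_def intro!: M.finsum_closed)
  next
    have "fam (\<lambda>i. \<zero>\<^bsub>M\<^esub>) {} \<zero>\<^bsub>M\<^esub>" using submodule_zero[OF N] by (simp add: fam_def)
    then show "\<zero>\<^bsub>M\<^esub> \<in> {x. \<exists>f F. fam f F x}" by blast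
  next
    fix x y assume "x \<in> {x. \<exists>f F. fam f F x}" "y \<in> {x. \<exists>f F. fam f F x}"
    then obtain f F g G where fg: "fam f F x" "fam g G y" by blast
    then have fin: "finite (F \<union> G)" "F \<union> G \<subseteq> I" by (auto simp: fam_def)
    have f: "fam f (F \<union> G) x" and g: "fam g (F \<union> G) y" using fam_ext[OF fg(1) _ fin] fam_ext[OF fg(2) _ fin] by auto
    have "f \<in> F \<union> G \<rightarrow> carrier M" "g \<in> F \<union> G \<rightarrow> carrier M" using f g fin(2) Nc by (auto simp: fam_def)
    then have "fam (\<lambda>i. f i \<oplus>\<^bsub>M\<^esub> g i) (F \<union> G) (x \<oplus>\<^bsub>M\<^esub> y)"
      using f g submodule_add[OF N] by (simp add: fam_def M.finsum_addf)
    then show "x \<oplus>\<^bsub>M\<^esub> y \<in> {x. \<exists>f F. fam f F x}" by blast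
  next
    fix a x assume a: "a \<in> carrier R" and "x \<in> {x. \<exists>f F. fam f F x}"
    then obtain f F where f: "fam f F x" by blast
    have "f \<in> F \<rightarrow> carrier M" using f Nc by (auto simp: fam_def)
    then have "fam (\<lambda>i. a \<odot>\<^bsub>M\<^esub> f i) F (a \<odot>\<^bsub>M\<^esub> x)"
      using f a submodule_smult[OF N] by (simp add: fam_def smult_finsum smult_zero_right)
    then show "a \<odot>\<^bsub>M\<^esub> x \<in> {x. \<exists>f F. fam f F x}" by blast
  qed
  moreover have "N i \<subseteq> {x. \<exists>f F. fam f F x}" if i: "i \<in> I" for i
  proof
    fix x assume x: "x \<in> N i"
    have "fam (\<lambda>j. if j = i then x else \<zero>\<^bsub>M\<^esub>) {i} x"
      using i x Nc[OF i x] submodule_zero[OF N] by (simp add: fam_def)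
    then show "x \<in> {x. \<exists>f F. fam f F x}" by blast
  qed
  ultimately have "carrier M \<subseteq> {x. \<exists>f F. fam f F x}" by (rule gen)
  then obtain f F where f: "fam f F m" using m by blast
  show "\<exists>!f. f \<in> (\<Pi>\<^sub>E i\<in>I. N i) \<and> finite {i\<in>I. f i \<noteq> \<zero>\<^bsub>M\<^esub>} \<and> m = finsum M f {i\<in>I. f i \<noteq> \<zero>\<^bsub>M\<^esub>}"
  proof (rule ex1I)
    let ?e = "restrict f I"
    have supp: "{i\<in>I. ?e i \<noteq> \<zero>\<^bsub>M\<^esub>} \<subseteq> F" using f by (auto simp: fam_def)
    have "finsum M f F = finsum M f {i\<in>I. ?e i \<noteq> \<zero>\<^bsub>M\<^esub>}"
      using f Nc by (intro finsum_supported[OF _ supp]) (auto simp: fam_def)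
    also have "\<dots> = finsum M ?e {i\<in>I. ?e i \<noteq> \<zero>\<^bsub>M\<^esub>}"
      using f Nc by (intro M.finsum_cong') (auto simp: fam_def)
    finally show "?e \<in> (\<Pi>\<^sub>E i\<in>I. N i) \<and> finite {i\<in>I. ?e i \<noteq> \<zero>\<^bsub>M\<^esub>} \<and> m = finsum M ?e {i\<in>I. ?e i \<noteq> \<zero>\<^bsub>M\<^esub>}"
      using f finite_subset[OF supp] by (auto simp: fam_def PiE_iff)
  next
    fix g assume g: "g \<in> (\<Pi>\<^sub>E i\<in>I. N i) \<and> finite {i\<in>I. g i \<noteq> \<zero>\<^bsub>M\<^esub>} \<and> m = finsum M g {i\<in>I. g i \<noteq> \<zero>\<^bsub>M\<^esub>}"
    let ?G = "{i\<in>I. g i \<noteq> \<zero>\<^bsub>M\<^esub>}"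
    have gN: "g i \<in> N i" if "i \<in> I" for i using g that by (auto simp: PiE_iff)
    have "fam g ?G m" using g gN by (auto simp: fam_def)
    have fin: "finite (F \<union> ?G)" "F \<union> ?G \<subseteq> I" using f g by (auto simp: fam_def)
    have f': "fam f (F \<union> ?G) m" and g': "fam g (F \<union> ?G) m"
      using fam_ext[OF f _ fin] fam_ext[OF \<open>fam g ?G m\<close> _ fin] by auto
    let ?n = "\<ominus>\<^bsub>R\<^esub> \<one>\<^bsub>R\<^esub>"
    define d where "d i = f i \<oplus>\<^bsub>M\<^esub> ?n \<odot>\<^bsub>M\<^esub> g i" for i
    have n: "?n \<in> carrier R" by simp
    have c: "f i \<in> carrier M" "g i \<in> carrier M" "d i \<in> N i" if "i \<in> I" for i
      using f' that Nc gN[OF that] submodule_add[OF N[OF that] _ submodule_smult[OF N[OF that] n gN[OF that]]]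
      by (auto simp: fam_def d_def)
    have fc: "f \<in> F \<union> ?G \<rightarrow> carrier M" "g \<in> F \<union> ?G \<rightarrow> carrier M" "(\<lambda>i. ?n \<odot>\<^bsub>M\<^esub> g i) \<in> F \<union> ?G \<rightarrow> carrier M"
      using c fin(2) smult_closed[OF n] by auto
    have "d = (\<lambda>i. f i \<oplus>\<^bsub>M\<^esub> ?n \<odot>\<^bsub>M\<^esub> g i)" by (rule ext) (rule d_def)
    then have "finsum M d (F \<union> ?G) = finsum M f (F \<union> ?G) \<oplus>\<^bsub>M\<^esub> finsum M (\<lambda>i. ?n \<odot>\<^bsub>M\<^esub> g i) (F \<union> ?G)"
      using M.finsum_addf[OF fc(1,3)] by (simp only:)
    also have "finsum M f (F \<union> ?G) = m" using f' by (simp add: fam_def)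
    also have "finsum M (\<lambda>i. ?n \<odot>\<^bsub>M\<^esub> g i) (F \<union> ?G) = ?n \<odot>\<^bsub>M\<^esub> m"
      using smult_finsum[OF fin(1) fc(2) n] g' by (simp add: fam_def)
    finally have d0: "finsum M d (F \<union> ?G) = \<zero>\<^bsub>M\<^esub>" using m by (simp add: smult_neg_one M.r_neg)
    have di: "d i = \<zero>\<^bsub>M\<^esub>" if i: "i \<in> F \<union> ?G" for i
    proof -
      have iI: "i \<in> I" using i fin(2) by blast
      obtain N' where N': "submodule N' R M" "\<And>j. j \<in> I \<Longrightarrow> j \<noteq> i \<Longrightarrow> N j \<subseteq> N'" "N i \<inter> N' \<subseteq> {\<zero>\<^bsub>M\<^esub>}"
        using indep[OF iI] by blast
      let ?F = "F \<union> ?G - {i}"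
      have s: "finsum M d ?F \<in> N'"
      proof (rule finsum_mem)
        show "N' \<subseteq> carrier M" using submodule_subset[OF N'(1)] by blast
        show "d j \<in> N'" if "j \<in> ?F" for j using that N'(2) c(3) fin(2) by blast
      qed (use fin(1) submodule_zero[OF N'(1)] submodule_add[OF N'(1)] in auto)
      have dc: "d \<in> ?F \<rightarrow> carrier M" "d i \<in> carrier M" using Nc c(3) fin(2) iI by blast+
      have "finsum M d (insert i ?F) = d i \<oplus>\<^bsub>M\<^esub> finsum M d ?F"
        using fin(1) dc by (intro M.finsum_insert) auto
      moreover have "insert i ?F = F \<union> ?G" using i by blast
      ultimately have "d i \<oplus>\<^bsub>M\<^esub> finsum M d ?F = \<zero>\<^bsub>M\<^esub>" using d0 by simp
      then have "\<ominus>\<^bsub>M\<^esub> finsum M d ?F = d i" using submodule_subset[OF N'(1) s] dc by (intro M.minus_equality)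
      then have "d i \<in> N'" using submodule_neg[OF N'(1) s] by simp
      then show ?thesis using c(3)[OF iI] N'(3) by blast
    qed
    have "g i = f i" if i: "i \<in> I" for i
    proof (cases "i \<in> F \<union> ?G")
      case True
      have "f i \<ominus>\<^bsub>M\<^esub> g i = \<zero>\<^bsub>M\<^esub>" using di[OF True] c[OF i] by (simp add: d_def smult_neg_one M.minus_eq)
      then show ?thesis using c[OF i] by (simp add: minus_eq_zero_iff)
    next
      case False
      then show ?thesis using f i by (auto simp: fam_def)
    qed
    then show "g = restrict f I" using g by (auto simp: PiE_iff extensional_def restrict_def)
  qed
qed (rule N)

lemma fin_generated_restrict:
  assumes H: "submodule H R M" and N: "N \<subseteq> H"
  shows "fin_generated R (M\<lparr>carrier := H\<rparr>) N \<longleftrightarrow> fin_generated R M N"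
  unfolding fin_generated_def using submodule_span_restrict[OF H] N by (metis order_trans)

end

section \<open>Blocks of category O\<close>

lemma weight_space_restrict: "N \<subseteq> carrier M \<Longrightarrow> weight_space q C0 (M\<lparr>carrier := N\<rparr>) r = weight_space q C0 M r \<inter> N"
  by (auto simp: weight_space_def)

lemma (in osc_central) category_O_iff:
  "M \<in> category_O q C0 \<longleftrightarrow> osc_O_module q C0 M \<and> fin_generated A M (carrier M)"
proof
  assume M: "M \<in> category_O q C0"
  then have "left_module A M" by (simp add: category_O_def)
  then interpret M: osc_central_module q C0 M by (rule osc_central_moduleI)
  show "osc_O_module q C0 M \<and> fin_generated A M (carrier M)"
    using M by (auto simp: category_O_def intro!: osc_O_module.intro osc_central_weight_module.intro
        weight_module.intro weight_module_axioms.intro osc_O_module_axioms.intro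
        M.osc_module_axioms M.osc_central_module_axioms)
next
  assume a: "osc_O_module q C0 M \<and> fin_generated A M (carrier M)"
  then interpret M: osc_O_module q C0 M by blast
  show "M \<in> category_O q C0"
    using a M.left_module_axioms M.weight_span M.weight_finite M.B_plus_finite by (simp add: category_O_def)
qed

context osc_O_module
begin

lemma submodule_in_category_O:
  assumes N: "submodule N A M" and fg: "fin_generated A M N"
  shows "M\<lparr>carrier := N\<rparr> \<in> category_O q C0"
  unfolding category_O_def
proof (intro CollectI conjI allI ballI)
  let ?N = "M\<lparr>carrier := N\<rparr>"
  have Nc: "N \<subseteq> carrier M" using submodule_subset[OF N] by blast
  note gN = gsub_if_submodule[OF N]
  note fg_restrict = G.fin_generated_restrict[OF gN]
  show "left_module A ?N" by (rule left_module_submodule[OF N])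
  show "fin_generated A ?N (carrier ?N)" using fg fin_generated_restrict[OF N] by simp
  have Wt_N: "weight_space q C0 ?N r = Wt r \<inter> N" for r by (rule weight_space_restrict[OF Nc])
  let ?W = "\<Union>r. Wt r \<inter> N"
  have W: "?W \<subseteq> N" "?W \<subseteq> carrier M" using Nc by blast+
  have "gspan ?W = N"
  proof
    show "gspan ?W \<subseteq> N" by (rule G.submodule_span_minimal[OF gN W(1)])
    show "N \<subseteq> gspan ?W"
    proof
      fix x assume x: "x \<in> N"
      have prx: "pr r x \<in> gspan ?W" for r
      proof (rule subsetD[OF G.subset_submodule_span])
        have "pr r x \<in> Wt r" using Nc x by (intro pr_Wt) blast
        then show "pr r x \<in> ?W" using pr_submodule[OF N x] by blast
      qed
      have "x \<in> carrier M" using x Nc by blast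
      then show "x \<in> gspan ?W" using prx by (rule mem_if_pr_mem[OF G.submodule_span_submodule[OF W(2)]])
    qed
  qed
  then show "submodule_span (osc_ground q C0) ?N (\<Union>r. weight_space q C0 ?N r) = carrier ?N"
    unfolding Wt_N using G.submodule_span_restrict[OF gN W(1)] by simp
  show "fin_generated (osc_ground q C0) ?N (weight_space q C0 ?N r)" for r
  proof -
    obtain S where S: "finite S" "S \<subseteq> Wt r" "gspan S = Wt r" using weight_finite[of r] by (auto simp: fin_generated_def)
    have "fin_generated (osc_ground q C0) M (Wt r \<inter> N)"
      unfolding fin_generated_def
      using finite_spanning_subspace[OF S(1) _ G.submodule_Int[OF gsub_Wt[of r] gN]] S(2,3) Wt_carrier by blast
    then show ?thesis unfolding Wt_N by (subst fg_restrict) blast+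
  qed
  fix m assume "m \<in> carrier ?N"
  then have m: "m \<in> N" "m \<in> carrier M" using Nc by auto
  interpret B: left_module "osc_B_plus q C0" M by (rule left_module_B_plus)
  note BN = B_plus_submodule_if_submodule[OF N]
  have "Bspan m \<subseteq> N" using B.submodule_span_minimal[OF BN] m(1) by blast
  then show "fin_generated (osc_ground q C0) ?N (submodule_span (osc_B_plus q C0) ?N {m})"
    using B.submodule_span_restrict[OF BN, of "{m}"] m(1) fg_restrict B_plus_finite[OF m(2)] by simp
qed

lemma simple_subquotient_highest_weight:
  assumes N: "submodule N A M" and L: "submodule L A M" "L \<subseteq> N"
    and simple: "simple_module A (quotient_module (M\<lparr>carrier := N\<rparr>) L)"
  shows "\<exists>t. occurs N t \<and> module_iso A (quotient_module (M\<lparr>carrier := N\<rparr>) L) (simple_V q C0 t)"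
proof -
  let ?P = "M\<lparr>carrier := N\<rparr>" and ?h = "\<lambda>x. L +>\<^bsub>M\<lparr>carrier := N\<rparr>\<^esub> x"
  let ?S = "quotient_module ?P L"
  interpret P: left_module A ?P by (rule left_module_submodule[OF N])
  have LP: "submodule L A ?P" using submodule_restrict_iff[OF N] L by simp
  have h: "left_module_hom A ?P ?S ?h" by (rule P.left_module_hom_quotient[OF LP])
  interpret h: left_module_hom A ?P ?S ?h by (rule h)
  have ker: "h.ker = L" by (rule P.ker_quotient[OF LP])
  have "L \<noteq> N" using simple unfolding h.simple_iff_maximal_ker[OF P.quotient_carrier[OF LP, symmetric]] ker by auto
  then have "\<not> N \<subseteq> L" using L(2) by blast
  then obtain w t where w: "w \<in> N" "w \<in> Wt t" "w \<notin> L" "act lE w \<in> L" "act lX w \<in> L"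
    using highest_weight_vector_exists[OF N L(1)] by blast
  have wc: "w \<in> carrier M" using w(2) by (rule Wt_carrier)
  interpret S: osc_module q C0 ?S by (rule osc_moduleI[OF h.cod.left_module_axioms])
  interpret P': osc_module q C0 ?P by (rule osc_moduleI[OF P.left_module_axioms])
  have hact: "S.act p (?h w) = ?h (act p w)" for p
    using hom_act[OF P'.osc_module_axioms S.osc_module_axioms h, of w p] w(1) by (simp add: P'.act_def act_def)
  have h0: "?h x = \<zero>\<^bsub>?S\<^esub> \<longleftrightarrow> x \<in> L" if "x \<in> N" for x using that ker by (auto simp: h.ker_def)
  have "act (lK - const t) w = \<zero>\<^bsub>M\<^esub>" using w(2) wc by (simp add: Wt_iff act_minus minus_eq_zero_iff)
  then have "act (lK - const t) w \<in> L" using submodule_zero[OF L(1)] by simp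
  then have "module_iso A ?S (simple_V q C0 t)"
    using w L(2) h0 h.hom_closed[of w]
    by (intro simple_module_with_highest_weight(2)[OF simple, of "?h w"]) (auto simp: hact)
  moreover have "occurs N t" by (rule occursI[OF L(1) w])
  ultimately show ?thesis by blast
qed

text \<open>Blocks are defined through simple subquotients, and these are only known up to isomorphism:
  from \<open>V(t) \<cong> V(t')\<close> with \<open>t' \<in> T r\<close> it follows that \<open>t\<close> and \<open>t'\<close> are linked, as \<open>V(t)\<close> is a quotient
  of \<open>Z(t)\<close>.\<close>

lemma block_occurs:
  assumes M: "M \<in> block_O q C0 r" and r: "r \<noteq> 0" and o: "occurs (carrier M) t"
  shows "t \<in> T r"
proof -
  have t: "t \<noteq> 0" by (rule occurs_nonzero[OF o])
  obtain L w where L: "submodule L A M" and w: "w \<in> Wt t" "w \<notin> L" "act lE w \<in> L" "act lX w \<in> L"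
    using o unfolding occurs_def by blast
  have wc: "w \<in> carrier M" using w(1) by (rule Wt_carrier)
  have "act (lK - const t) w = \<zero>\<^bsub>M\<^esub>" using w(1) wc by (simp add: Wt_iff act_minus minus_eq_zero_iff)
  then have hw: "act (lK - const t) w \<in> L" using submodule_zero[OF L] by simp
  note ss = simple_subquotient[OF L wc w(2) hw w(3,4)]
  obtain S where S: "S \<in> subquotients A M" "simple_module A S" "module_iso A S (simple_V q C0 t)" using ss(1) by blast
  obtain t' where t': "t' \<in> T r" "module_iso A S (simple_V q C0 t')" using M S(1,2) unfolding block_O_def by blast
  have "left_module A S" using S(2) by (simp add: simple_module_def)
  from module_iso_sym[OF this ss(3) S(3)] have "module_iso A (simple_V q C0 t) (simple_V q C0 t')"
    using t'(2) by (rule module_iso_trans)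
  then have "linked q C0 t t'" using ss(2) by (auto simp: linked_def)
  then have "t' \<in> T t" using t component_T_nonzero[OF t'(1) r] by (rule linked_component_T)
  then show ?thesis using t'(1) component_T_eq component_T_self by metis
qed

lemma component_in_block:
  assumes N: "N = component (T r)" and fg: "fin_generated A M N"
  shows "M\<lparr>carrier := N\<rparr> \<in> block_O q C0 r"
  unfolding block_O_def
proof (intro CollectI conjI ballI impI)
  have sub: "submodule N A M" unfolding N by (rule submodule_component)
  show "M\<lparr>carrier := N\<rparr> \<in> category_O q C0" by (rule submodule_in_category_O[OF sub fg])
  fix S assume S: "S \<in> subquotients A (M\<lparr>carrier := N\<rparr>)" "simple_module A S"
  then obtain U L where UL: "submodule U A M" "U \<subseteq> N" "submodule L A M" "L \<subseteq> U"
    "S = quotient_module (M\<lparr>carrier := U\<rparr>) L"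
    unfolding subquotients_def submodule_restrict_iff[OF sub] by auto
  obtain t where t: "occurs U t" "module_iso A S (simple_V q C0 t)"
    using simple_subquotient_highest_weight[OF UL(1,3,4)] S(2) UL(5) by blast
  have "t \<in> T r" using occurs_component occurs_mono[OF t(1) UL(2)] N by blast
  then show "\<exists>t\<in>T r. module_iso A S (simple_V q C0 t)" using t(2) by blast
qed

end

locale linkage_representatives = osc_central q C0
  for q :: "'k::field" and C0 :: "(uq_gen, 'k) pres_elt" +
  fixes Rep :: "'k set"
  assumes Rep_nonzero: "Rep \<subseteq> - {0}"
    and Rep: "\<And>s. s \<noteq> 0 \<Longrightarrow> \<exists>!r. r \<in> Rep \<and> T r = T s"
begin

lemma Rep_disjoint:
  assumes "i \<in> Rep" "j \<in> Rep" "i \<noteq> j" shows "T i \<inter> T j = {}"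
proof (rule ccontr)
  assume "T i \<inter> T j \<noteq> {}"
  then obtain t where "t \<in> T i" "t \<in> T j" by blast
  then have "T i = T j" using component_T_eq by metis
  moreover have "i \<noteq> 0" using assms Rep_nonzero by auto
  ultimately show False using Rep[of i] assms by metis
qed

text \<open>Only finitely many components are nonzero, because those that contain the components of finitely
  many generators already span the module; and each is finitely generated, by the components of
  the generators.\<close>

lemma direct_sum_of_components:
  fixes M :: "('k osc_elt, 'm) module"
  assumes M: "M \<in> category_O q C0"
  defines "N \<equiv> \<lambda>i. osc_module.component q C0 M (T i)"
  shows "internal_direct_sum A M Rep N" and "finite {i\<in>Rep. N i \<noteq> {\<zero>\<^bsub>M\<^esub>}}"
    and "i \<in> Rep \<Longrightarrow> M\<lparr>carrier := N i\<rparr> \<in> block_O q C0 i"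
proof -
  interpret M: osc_O_module q C0 M using M category_O_iff by blast
  have fg: "fin_generated A M (carrier M)" using M category_O_iff by blast
  have N: "submodule (N i) A M" for i unfolding N_def by (rule M.submodule_component)
  define N' where "N' i = M.component (- T i)" for i
  have N': "submodule (N' i) A M" for i unfolding N'_def by (rule M.submodule_component)
  have NN': "N j \<subseteq> N' i" if "T i \<inter> T j = {}" for i j
    unfolding N_def N'_def using that by (intro M.component_mono) blast
  have disj: "x = \<zero>\<^bsub>M\<^esub>" if "x \<in> N i" "x \<in> N' i" for i x
    using M.component_disjoint[of "T i" "- T i" x] that by (auto simp: N_def N'_def)
  have Nc: "(\<Union>i\<in>F. N i) \<subseteq> carrier M" for F using M.submodule_subset[OF N] by blast
  let ?H = "submodule_span A M (\<Union>i\<in>Rep. N i)"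
  have H: "submodule ?H A M" by (rule M.submodule_span_submodule[OF Nc])
  have H_split: "?H \<subseteq> N r <+>\<^bsub>M\<^esub> N' r" for r
  proof (rule M.submodule_span_minimal[OF M.submodule_set_add[OF N N']])
    have "N i \<subseteq> N r <+>\<^bsub>M\<^esub> N' r" for i
    proof (cases "T r \<inter> T i = {}")
      case True
      then show ?thesis using NN' M.subset_set_add(2)[OF N N'] by blast
    next
      case False
      then have "T i = T r" using component_T_eq by blast
      then show ?thesis using M.subset_set_add(1)[OF N N'] by (simp add: N_def)
    qed
    then show "(\<Union>i\<in>Rep. N i) \<subseteq> N r <+>\<^bsub>M\<^esub> N' r" by blast
  qed
  have H_eq: "?H = carrier M"
  proof (rule M.component_sum_eq_carrier[OF H])
    fix r :: 'k assume "r \<noteq> 0"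
    then obtain i where i: "i \<in> Rep" "T i = T r" using Rep by blast
    then have "N i \<subseteq> ?H" using M.subset_submodule_span[of "\<Union>i\<in>Rep. N i"] by blast
    then show "M.component (T r) \<subseteq> ?H" using i by (simp add: N_def)
  qed (use H_split in \<open>simp add: N_def N'_def\<close>)
  show ds: "internal_direct_sum A M Rep N"
  proof (rule M.internal_direct_sumI[OF N])
    fix U assume "submodule U A M" "\<And>i. i \<in> Rep \<Longrightarrow> N i \<subseteq> U"
    then have "?H \<subseteq> U" by (intro M.submodule_span_minimal) auto
    then show "carrier M \<subseteq> U" by (simp add: H_eq)
  next
    fix i assume "i \<in> Rep"
    then have "\<forall>j\<in>Rep. j \<noteq> i \<longrightarrow> N j \<subseteq> N' i" using NN' Rep_disjoint by blast
    then show "\<exists>N'. submodule N' A M \<and> (\<forall>j\<in>Rep. j \<noteq> i \<longrightarrow> N j \<subseteq> N') \<and> N i \<inter> N' \<subseteq> {\<zero>\<^bsub>M\<^esub>}"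
      using N'[of i] disj[of _ i] by blast
  qed
  obtain S where S: "finite S" "S \<subseteq> carrier M" "submodule_span A M S = carrier M"
    using fg unfolding fin_generated_def by blast
  have "\<exists>F. finite F \<and> F \<subseteq> Rep \<and> s \<in> submodule_span A M (\<Union>i\<in>F. N i)" if s: "s \<in> S" for s
  proof -
    obtain f where f: "f \<in> (\<Pi>\<^sub>E i\<in>Rep. N i)" "finite {i\<in>Rep. f i \<noteq> \<zero>\<^bsub>M\<^esub>}" "s = finsum M f {i\<in>Rep. f i \<noteq> \<zero>\<^bsub>M\<^esub>}"
      using ds s S(2) unfolding internal_direct_sum_def by blast
    let ?F = "{i\<in>Rep. f i \<noteq> \<zero>\<^bsub>M\<^esub>}"
    note sp = M.submodule_span_submodule[OF Nc[of ?F]]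
    have "s \<in> submodule_span A M (\<Union>i\<in>?F. N i)"
      unfolding f(3)
    proof (rule M.finsum_mem[OF _ M.submodule_zero[OF sp] M.submodule_add[OF sp] f(2)])
      show "submodule_span A M (\<Union>i\<in>?F. N i) \<subseteq> carrier M" using M.submodule_subset[OF sp] by blast
      show "f i \<in> submodule_span A M (\<Union>i\<in>?F. N i)" if "i \<in> ?F" for i
        using that f(1) M.subset_submodule_span[of "\<Union>i\<in>?F. N i"] by (auto simp: PiE_iff)
    qed
    then show ?thesis using f(2) by (intro exI[of _ ?F]) blast
  qed
  then obtain F where F: "\<And>s. s \<in> S \<Longrightarrow> finite (F s) \<and> F s \<subseteq> Rep \<and> s \<in> submodule_span A M (\<Union>i\<in>F s. N i)"
    by metis
  let ?F = "\<Union>s\<in>S. F s"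
  have "S \<subseteq> submodule_span A M (\<Union>i\<in>?F. N i)"
  proof
    fix s assume s: "s \<in> S"
    have "submodule_span A M (\<Union>i\<in>F s. N i) \<subseteq> submodule_span A M (\<Union>i\<in>?F. N i)"
      using s by (intro M.submodule_span_mono) blast
    then show "s \<in> submodule_span A M (\<Union>i\<in>?F. N i)" using F[OF s] by blast
  qed
  then have span: "carrier M \<subseteq> submodule_span A M (\<Union>i\<in>?F. N i)"
    unfolding S(3)[symmetric] by (rule M.submodule_span_minimal[OF M.submodule_span_submodule[OF Nc]])
  have "N i = {\<zero>\<^bsub>M\<^esub>}" if i: "i \<in> Rep" "i \<notin> ?F" for i
  proof -
    have "N j \<subseteq> N' i" if "j \<in> ?F" for j
    proof (rule NN', rule Rep_disjoint[OF i(1)])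
      show "j \<in> Rep" using that F by blast
      show "i \<noteq> j" using that i(2) by metis
    qed
    then have "submodule_span A M (\<Union>i\<in>?F. N i) \<subseteq> N' i" by (intro M.submodule_span_minimal[OF N']) blast
    then have "N i \<subseteq> N' i" using span M.submodule_subset[OF N] by blast
    then show ?thesis using disj M.submodule_zero[OF N] by blast
  qed
  then have "{i\<in>Rep. N i \<noteq> {\<zero>\<^bsub>M\<^esub>}} \<subseteq> ?F" by blast
  moreover have "finite ?F" using S(1) F by blast
  ultimately show "finite {i\<in>Rep. N i \<noteq> {\<zero>\<^bsub>M\<^esub>}}" by (rule finite_subset)
  have "fin_generated A M (N i)" for i
  proof -
    have "\<exists>a. a \<in> N i \<and> (\<exists>b\<in>N' i. s = a \<oplus>\<^bsub>M\<^esub> b)" if "s \<in> S" for s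
    proof -
      have "s \<in> N i <+>\<^bsub>M\<^esub> N' i" using that S(2) H_split[of i] H_eq by blast
      then show ?thesis by (auto simp: M.set_add_iff)
    qed
    then obtain a where a: "\<And>s. s \<in> S \<Longrightarrow> a s \<in> N i \<and> (\<exists>b\<in>N' i. s = a s \<oplus>\<^bsub>M\<^esub> b)" by metis
    let ?U = "submodule_span A M (a ` S)"
    have aN: "a ` S \<subseteq> N i" using a by blast
    then have U: "submodule ?U A M" using M.submodule_subset[OF N] by (intro M.submodule_span_submodule) blast
    have UN: "?U \<subseteq> N i" by (rule M.submodule_span_minimal[OF N aN])
    have "S \<subseteq> ?U <+>\<^bsub>M\<^esub> N' i"
      using a M.subset_submodule_span[of "a ` S"] by (fastforce simp: M.set_add_iff)
    then have all: "carrier M \<subseteq> ?U <+>\<^bsub>M\<^esub> N' i"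
      unfolding S(3)[symmetric] by (rule M.submodule_span_minimal[OF M.submodule_set_add[OF U N']])
    have "N i \<subseteq> ?U"
    proof
      fix x assume x: "x \<in> N i"
      then have xc: "x \<in> carrier M" by (rule M.submodule_subset[OF N])
      have "x \<in> ?U <+>\<^bsub>M\<^esub> N' i" using all xc by blast
      then obtain u n where un: "u \<in> ?U" "n \<in> N' i" "x = u \<oplus>\<^bsub>M\<^esub> n" unfolding M.set_add_iff by blast
      have c: "u \<in> carrier M" "n \<in> carrier M" using M.submodule_subset[OF U un(1)] M.submodule_subset[OF N' un(2)] .
      have "x \<ominus>\<^bsub>M\<^esub> u = n" using c by (simp add: un(3) M.M.add_minus_cancel_left)
      moreover have "x \<ominus>\<^bsub>M\<^esub> u \<in> N i" using M.submodule_minus[OF N x] un(1) UN by blast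
      ultimately have "n = \<zero>\<^bsub>M\<^esub>" using disj un(2) by simp
      then show "x \<in> ?U" using un(1,3) c by simp
    qed
    then show ?thesis unfolding fin_generated_def using S(1) aN UN by blast
  qed
  then show "M\<lparr>carrier := N i\<rparr> \<in> block_O q C0 i" if "i \<in> Rep" for i
    by (intro M.component_in_block) (simp add: N_def)
qed

end

text \<open>Finite generation and the finiteness of weight spaces pass to finite sums. That \<open>K\<close> is
  diagonalizable and \<open>B_+\<close> locally finite can be tested on the elements of the summands, since the
  vectors with these properties are closed under addition.\<close>

lemma (in osc_central) direct_sum_in_category_O:
  fixes M :: "('k osc_elt, 'm) module"
  assumes M: "left_module A M" and ds: "internal_direct_sum A M J N"
    and O: "\<And>i. i \<in> J \<Longrightarrow> M\<lparr>carrier := N i\<rparr> \<in> category_O q C0"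
    and fin: "finite {i\<in>J. N i \<noteq> {\<zero>\<^bsub>M\<^esub>}}"
  shows "M \<in> category_O q C0"
proof -
  interpret M0: osc_central_module q C0 M by (rule osc_central_moduleI[OF M])
  have N: "submodule (N i) A M" if "i \<in> J" for i using ds that by (simp add: internal_direct_sum_def)
  have Nc: "N i \<subseteq> carrier M" if "i \<in> J" for i using M0.submodule_subset[OF N[OF that]] by blast
  note gN = M0.gsub_if_submodule[OF N]
  define J0 where "J0 = {i\<in>J. N i \<noteq> {\<zero>\<^bsub>M\<^esub>}}"
  have J0: "finite J0" "i \<in> J0 \<Longrightarrow> i \<in> J" "i \<in> J \<Longrightarrow> i \<notin> J0 \<Longrightarrow> N i = {\<zero>\<^bsub>M\<^esub>}" for i
    using fin by (auto simp: J0_def)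
  have Wt_N: "weight_space q C0 (M\<lparr>carrier := N i\<rparr>) r = weight_space q C0 M r \<inter> N i" if "i \<in> J" for i r
    by (rule weight_space_restrict[OF Nc[OF that]])
  note induct = M0.internal_direct_sum_induct[OF ds]

  have "fin_generated A M (carrier M)"
  proof -
    have "\<exists>S. finite S \<and> S \<subseteq> N i \<and> submodule_span A M S = N i" if "i \<in> J0" for i
      using O[OF J0(2)[OF that]] M0.fin_generated_restrict[OF N[OF J0(2)[OF that]] subset_refl]
      by (simp add: category_O_def fin_generated_def)
    then obtain S where S: "\<And>i. i \<in> J0 \<Longrightarrow> finite (S i) \<and> S i \<subseteq> N i \<and> submodule_span A M (S i) = N i" by metis
    let ?U = "\<Union>i\<in>J0. S i"
    have U: "finite ?U" "?U \<subseteq> carrier M" using S J0(1) Nc[OF J0(2)] by blast+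
    note sp = M0.submodule_span_submodule[OF U(2)]
    have sp_c: "submodule_span A M ?U \<subseteq> carrier M" using M0.submodule_subset[OF sp] by blast
    have "carrier M \<subseteq> submodule_span A M ?U"
    proof (rule induct[OF sp_c M0.submodule_zero[OF sp] M0.submodule_add[OF sp]])
      fix i assume i: "i \<in> J"
      show "N i \<subseteq> submodule_span A M ?U"
      proof (cases "i \<in> J0")
        case True
        then have "submodule_span A M (S i) \<subseteq> submodule_span A M ?U" by (intro M0.submodule_span_mono) blast
        then show ?thesis using S[OF True] by simp
      qed (use J0(3)[OF i] M0.submodule_zero[OF sp] in simp)
    qed
    then show ?thesis unfolding fin_generated_def using U sp_c by blast
  qed
  moreover have "osc_O_module q C0 M"
  proof -
    let ?W = "\<Union>r. M0.Wt r"
    have Wc: "?W \<subseteq> carrier M" using M0.Wt_carrier by blast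
    note sp = M0.G.submodule_span_submodule[OF Wc]
    have sp_c: "M0.gspan ?W \<subseteq> carrier M" using M0.G.submodule_subset[OF sp] by blast
    have "carrier M \<subseteq> M0.gspan ?W"
    proof (rule induct[OF sp_c M0.G.submodule_zero[OF sp] M0.G.submodule_add[OF sp]])
      fix i assume i: "i \<in> J"
      have "submodule_span (osc_ground q C0) (M\<lparr>carrier := N i\<rparr>) (\<Union>r. M0.Wt r \<inter> N i) = N i"
        using O[OF i] by (simp add: category_O_def Wt_N[OF i])
      moreover have "(\<Union>r. M0.Wt r \<inter> N i) \<subseteq> N i" by blast
      ultimately have "M0.gspan (\<Union>r. M0.Wt r \<inter> N i) = N i"
        using M0.G.submodule_span_restrict[OF gN[OF i]] by simp
      moreover have "M0.gspan (\<Union>r. M0.Wt r \<inter> N i) \<subseteq> M0.gspan ?W" by (rule M0.G.submodule_span_mono) blast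
      ultimately show "N i \<subseteq> M0.gspan ?W" by simp
    qed
    then have "M0.gspan ?W = carrier M" using sp_c by blast
    then interpret M: osc_central_weight_module q C0 M
      by (intro osc_central_weight_module.intro weight_module.intro weight_module_axioms.intro
          M0.osc_module_axioms M0.osc_central_module_axioms)
    have "fin_generated (osc_ground q C0) M (M0.Wt r)" for r
    proof -
      have "\<exists>S. finite S \<and> S \<subseteq> M0.Wt r \<inter> N i \<and> M0.gspan S = M0.Wt r \<inter> N i" if "i \<in> J0" for i
      proof -
        note i = J0(2)[OF that]
        have "fin_generated (osc_ground q C0) (M\<lparr>carrier := N i\<rparr>) (M0.Wt r \<inter> N i)"
          using O[OF i] by (simp add: category_O_def Wt_N[OF i])
        then have "fin_generated (osc_ground q C0) M (M0.Wt r \<inter> N i)"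
          using M0.G.fin_generated_restrict[OF gN[OF i]] by blast
        then show ?thesis by (simp add: fin_generated_def)
      qed
      then obtain S where S: "\<And>i. i \<in> J0 \<Longrightarrow> finite (S i) \<and> S i \<subseteq> M0.Wt r \<inter> N i \<and> M0.gspan (S i) = M0.Wt r \<inter> N i"
        by metis
      let ?U = "\<Union>i\<in>J0. S i"
      have U: "finite ?U" "?U \<subseteq> M0.Wt r" using S J0(1) by blast+
      then have Uc: "?U \<subseteq> carrier M" using M0.Wt_carrier by blast
      note sp = M0.G.submodule_span_submodule[OF Uc]
      \<comment> \<open>The weight space of the sum is spanned by those of the summands, because projecting commutes
        with decomposing.\<close>
      let ?H = "{x \<in> carrier M. M.pr r x \<in> M0.gspan ?U}"
      have "carrier M \<subseteq> ?H"
      proof (rule induct)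
        show "\<zero>\<^bsub>M\<^esub> \<in> ?H" using M0.G.submodule_zero[OF sp] by simp
        show "x \<oplus>\<^bsub>M\<^esub> y \<in> ?H" if "x \<in> ?H" "y \<in> ?H" for x y
          using that M0.G.submodule_add[OF sp] by (simp add: M.pr_add)
        fix i assume i: "i \<in> J"
        show "N i \<subseteq> ?H"
        proof
          fix x assume x: "x \<in> N i"
          then have xc: "x \<in> carrier M" using Nc[OF i] by blast
          show "x \<in> ?H"
          proof (cases "i \<in> J0")
            case True
            have "M.pr r x \<in> M0.gspan (S i)" using S[OF True] M.pr_submodule[OF N[OF i] x] M.pr_Wt[OF xc] by blast
            moreover have "M0.gspan (S i) \<subseteq> M0.gspan ?U" using True by (intro M0.G.submodule_span_mono) blast
            ultimately show ?thesis using xc by blast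
          next
            case False
            then show ?thesis using J0(3)[OF i] x M0.G.submodule_zero[OF sp] by simp
          qed
        qed
      qed blast
      then have "M0.Wt r \<subseteq> M0.gspan ?U" using M.pr_weight[of _ r r] M0.Wt_carrier by fastforce
      moreover have "M0.gspan ?U \<subseteq> M0.Wt r" by (rule M0.G.submodule_span_minimal[OF M0.gsub_Wt U(2)])
      ultimately show ?thesis unfolding fin_generated_def using U by blast
    qed
    moreover have "fin_generated (osc_ground q C0) M (M0.Bspan m)" if "m \<in> carrier M" for m
    proof -
      interpret B: left_module "osc_B_plus q C0" M by (rule M0.left_module_B_plus)
      let ?H = "{m \<in> carrier M. fin_generated (osc_ground q C0) M (M0.Bspan m)}"
      have fg: "m \<in> ?H" if m: "m \<in> carrier M" and S: "finite S" "S \<subseteq> carrier M" "M0.Bspan m \<subseteq> M0.gspan S" for m S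
        using M0.finite_spanning_subspace[OF S(1,2) M0.Bspan(2)[OF m] S(3)] m by (simp add: fin_generated_def)
      have "carrier M \<subseteq> ?H"
      proof (rule induct)
        have "M0.Bspan \<zero>\<^bsub>M\<^esub> \<subseteq> {\<zero>\<^bsub>M\<^esub>}" by (rule B.submodule_span_minimal[OF B.submodule_trivial]) simp
        then show "\<zero>\<^bsub>M\<^esub> \<in> ?H" using M0.gspan_empty by (intro fg[of _ "{}"]) simp_all
      next
        fix x y assume "x \<in> ?H" "y \<in> ?H"
        then obtain S S' where c: "x \<in> carrier M" "y \<in> carrier M"
          and S: "finite S" "S \<subseteq> M0.Bspan x" "M0.gspan S = M0.Bspan x"
          and S': "finite S'" "S' \<subseteq> M0.Bspan y" "M0.gspan S' = M0.Bspan y"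
          unfolding fin_generated_def by blast
        note bx = M0.Bspan[OF c(1)] and by' = M0.Bspan[OF c(2)]
        have SS: "S \<union> S' \<subseteq> carrier M"
          using S(2) S'(2) B.submodule_subset[OF bx(1)] B.submodule_subset[OF by'(1)] by blast
        have "x \<oplus>\<^bsub>M\<^esub> y \<in> M0.Bspan x <+>\<^bsub>M\<^esub> M0.Bspan y" using bx(3) by'(3) by (auto simp: B.set_add_iff)
        then have "M0.Bspan (x \<oplus>\<^bsub>M\<^esub> y) \<subseteq> M0.Bspan x <+>\<^bsub>M\<^esub> M0.Bspan y"
          by (intro B.submodule_span_minimal[OF B.submodule_set_add[OF bx(1) by'(1)]]) simp
        also have "\<dots> \<subseteq> M0.gspan (S \<union> S')"
        proof (rule M0.G.set_add_subset[OF M0.G.submodule_span_submodule[OF SS]])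
          show "M0.Bspan x \<subseteq> M0.gspan (S \<union> S')" unfolding S(3)[symmetric] by (rule M0.G.submodule_span_mono) blast
          show "M0.Bspan y \<subseteq> M0.gspan (S \<union> S')" unfolding S'(3)[symmetric] by (rule M0.G.submodule_span_mono) blast
        qed
        finally show "x \<oplus>\<^bsub>M\<^esub> y \<in> ?H" using S(1) S'(1) SS c by (intro fg[of _ "S \<union> S'"]) simp_all
      next
        fix i assume i: "i \<in> J"
        note BN = M0.B_plus_submodule_if_submodule[OF N[OF i]]
        show "N i \<subseteq> ?H"
        proof
          fix x assume x: "x \<in> N i"
          have sub: "M0.Bspan x \<subseteq> N i" using B.submodule_span_minimal[OF BN] x by blast
          have "fin_generated (osc_ground q C0) (M\<lparr>carrier := N i\<rparr>) (M0.Bspan x)"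
            using O[OF i] x B.submodule_span_restrict[OF BN, of "{x}", symmetric] by (simp add: category_O_def)
          then show "x \<in> ?H" using M0.G.fin_generated_restrict[OF gN[OF i] sub] x Nc[OF i] by blast
        qed
      qed blast
      then show ?thesis using that by blast
    qed
    ultimately show ?thesis
      by (intro osc_O_module.intro osc_O_module_axioms.intro M.osc_central_weight_module_axioms)
  qed
  ultimately show ?thesis using category_O_iff by blast
qed

text \<open>A vector that is singular modulo the kernel of a nonzero homomorphism has a nonzero image, which
  is a highest weight vector; so its weight occurs both in \<open>M\<close> and in \<open>N\<close>.\<close>

lemma (in linkage_representatives) no_homs_between_blocks:
  fixes M N :: "('k osc_elt, 'm) module"
  assumes ij: "i \<in> Rep" "j \<in> Rep" "i \<noteq> j" and M: "M \<in> block_O q C0 i" and N: "N \<in> block_O q C0 j"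
    and h: "h \<in> module_homs A M N" and x: "x \<in> carrier M"
  shows "h x = \<zero>\<^bsub>N\<^esub>"
proof (rule ccontr)
  interpret M: osc_O_module q C0 M using M category_O_iff by (auto simp: block_O_def)
  interpret N: osc_O_module q C0 N using N category_O_iff by (auto simp: block_O_def)
  have h': "left_module_hom A M N h"
    by (intro left_module_hom.intro left_module_hom_axioms.intro M.left_module_axioms N.left_module_axioms h)
  interpret h: left_module_hom A M N h by (rule h')
  assume "h x \<noteq> \<zero>\<^bsub>N\<^esub>"
  then have "\<not> carrier M \<subseteq> h.ker" using x by (auto simp: h.ker_def)
  then obtain w t where w: "w \<in> M.Wt t" "w \<notin> h.ker" "M.act lE w \<in> h.ker" "M.act lX w \<in> h.ker"
    using M.highest_weight_vector_exists[OF M.submodule_carrier h.submodule_ker] by blast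
  have wc: "w \<in> carrier M" using w(1) by (rule M.Wt_carrier)
  have "M.occurs (carrier M) t" by (rule M.occursI[OF h.submodule_ker wc w])
  then have "t \<in> T i" using M.block_occurs[OF M] ij(1) Rep_nonzero by blast
  moreover have "t \<in> T j"
  proof -
    have act: "N.act p (h w) = h (M.act p w)" for p
      using hom_act[OF M.osc_module_axioms N.osc_module_axioms h' wc] by simp
    have "h w \<in> N.Wt t" using w(1) h.hom_closed[OF wc] act[of lK] act[of "const t"] by (simp add: N.Wt_iff M.Wt_iff)
    moreover have "h w \<notin> {\<zero>\<^bsub>N\<^esub>}" "N.act lE (h w) \<in> {\<zero>\<^bsub>N\<^esub>}" "N.act lX (h w) \<in> {\<zero>\<^bsub>N\<^esub>}"
      using w wc by (simp_all add: act h.ker_def)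
    ultimately have "N.occurs (carrier N) t" by (rule N.occursI[OF N.submodule_trivial h.hom_closed[OF wc]])
    moreover have "j \<noteq> 0" using ij(2) Rep_nonzero by blast
    ultimately show ?thesis using N.block_occurs[OF N] by simp
  qed
  ultimately show False using Rep_disjoint[OF ij] by blast
qed

theorem corollary8p11:
  fixes q :: "'k::field" and C0 :: "(uq_gen, 'k) pres_elt" and Rep :: "'k set"
  assumes "CHAR('k) \<noteq> 2"
    and "q \<noteq> 0" and "\<forall>n::nat. n > 0 \<longrightarrow> q ^ n \<noteq> 1"
    and "C0 \<in> ring_center (uq_sl2 q)" and "C0 \<noteq> \<zero>\<^bsub>uq_sl2 q\<^esub>"
    and "Rep \<subseteq> - {0}"
    and "\<forall>s. s \<noteq> 0 \<longrightarrow> (\<exists>!r. r \<in> Rep \<and> component_T q C0 r = component_T q C0 s)"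
  shows "direct_sum_of_subcategories (osc_algebra q C0)
           (category_O q C0 :: ('k osc_elt, 'm) module set) (block_O q C0) Rep"
proof -
  interpret linkage_representatives q C0 Rep
    using assms by unfold_locales blast+
  show ?thesis
    unfolding direct_sum_of_subcategories_def
  proof (intro conjI ballI allI impI)
    show block: "block_O q C0 i \<subseteq> category_O q C0" for i by (auto simp: block_O_def)
    show "h x = \<zero>\<^bsub>N\<^esub>"
      if "i \<in> Rep" "j \<in> Rep" "i \<noteq> j" "M \<in> block_O q C0 i" "N \<in> block_O q C0 j" "h \<in> module_homs A M N"
        "x \<in> carrier M" for i j h x and M N :: "('k osc_elt, 'm) module"
      by (rule no_homs_between_blocks[OF that])
    fix M :: "('k osc_elt, 'm) module"
    show "M \<in> category_O q C0 \<longleftrightarrow> left_module A M \<and> (\<exists>N. internal_direct_sum A M Rep N \<and>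
      (\<forall>i\<in>Rep. M\<lparr>carrier := N i\<rparr> \<in> block_O q C0 i) \<and> finite {i\<in>Rep. N i \<noteq> {\<zero>\<^bsub>M\<^esub>}})"
    proof
      assume M: "M \<in> category_O q C0"
      then have "left_module A M" by (simp add: category_O_def)
      then show "left_module A M \<and> (\<exists>N. internal_direct_sum A M Rep N \<and>
        (\<forall>i\<in>Rep. M\<lparr>carrier := N i\<rparr> \<in> block_O q C0 i) \<and> finite {i\<in>Rep. N i \<noteq> {\<zero>\<^bsub>M\<^esub>}})"
        using direct_sum_of_components[OF M] by blast
    next
      assume "left_module A M \<and> (\<exists>N. internal_direct_sum A M Rep N \<and>
        (\<forall>i\<in>Rep. M\<lparr>carrier := N i\<rparr> \<in> block_O q C0 i) \<and> finite {i\<in>Rep. N i \<noteq> {\<zero>\<^bsub>M\<^esub>}})"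
      then obtain N where *: "left_module A M" "internal_direct_sum A M Rep N"
        "\<And>i. i \<in> Rep \<Longrightarrow> M\<lparr>carrier := N i\<rparr> \<in> block_O q C0 i" "finite {i\<in>Rep. N i \<noteq> {\<zero>\<^bsub>M\<^esub>}}" by blast
      show "M \<in> category_O q C0" using *(3,4) block by (intro direct_sum_in_category_O[OF *(1,2)]) blast+
    qed
  qed
qed

end
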